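(* Let $\sigma:[0,\infty)\to(0,\infty)$ be Lipschitz and let $f\ge 0$ be a probability density supported on $[0,\infty)$. Then there exists a unique classical solution $(q,\ell)$ of the free boundary problem $$\frac{\partial q(t,x)}{\partial t}=\frac12\,\sigma^2(\ell(t))\,\frac{\partial^2 q(t,x)}{\partial x^2},\qquad t>0,\ x>0,$$ $$\frac{\partial^+ q(t,0)}{\partial^+ x}=0,\qquad t>0,$$ $$\ell(t)=\frac12\int_0^t q(s,0)\,\sigma^2(\ell(s))\,\mathrm{d}s,\qquad t\ge 0,$$ $$\lim_{t\downarrow 0}q(t,\mathrm{d}x)=f(\mathrm{d}x).$$
   Context: The unknown is the pair $(q,\ell)$, with $q(t,x)$ defined for $t>0$, $x\ge 0$ and $\ell:[0,\infty)\to[0,\infty)$. For each $t>0$, $q(t,\cdot)$ is a probability density on $[0,\infty)$. "Classical solution" means that the derivatives appearing in the problem exist in the ordinary sense and the equations hold pointwise. $\partial^+/\partial^+x$ denotes the right-hand derivative in $x$. The last condition means that the probability distribution $q(t,x)\,\mathrm{d}x$ converges weakly to the distribution $f(x)\,\mathrm{d}x$ as $t\downarrow 0$. *)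

theory Defs
  imports "HOL-Probability.Probability"
begin

text \<open>Functions on the half-line (such as \<open>\<sigma>\<close>, \<open>f\<close>, \<open>ell\<close> and \<open>q t\<close>) are represented
  by functions on the reals; their values at negative arguments, and the values of \<open>q t\<close>
  for \<open>t \<le> 0\<close>, are irrelevant.\<close>

definition halfline_density :: "(real \<Rightarrow> real) \<Rightarrow> bool" where
  "halfline_density g \<longleftrightarrow>
     (\<forall>x\<ge>0. 0 \<le> g x) \<and> set_integrable lborel {0..} g \<and> (LBINT x:{0..}. g x) = 1"

definition halfline_law :: "(real \<Rightarrow> real) \<Rightarrow> real measure" where
  "halfline_law g = density lborel (\<lambda>x. ennreal (indicator {0..} x * g x))"

text \<open>The second \<open>x\<close>-derivative is the iterated \<open>deriv\<close>; as \<open>deriv\<close> is total, the existence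
  of both derivatives is required explicitly. The integral in the equation for \<open>ell\<close> is taken
  over \<open>{0<..t}\<close> because \<open>q\<close> is defined for positive times only. Weak convergence as \<open>t\<close>
  decreases to 0 is weak convergence along every sequence of positive times tending to 0.\<close>

definition classical_solution ::
  "(real \<Rightarrow> real) \<Rightarrow> (real \<Rightarrow> real) \<Rightarrow> (real \<Rightarrow> real \<Rightarrow> real) \<Rightarrow> (real \<Rightarrow> real) \<Rightarrow> bool" where
  "classical_solution \<sigma> f q ell \<longleftrightarrow>
     (\<forall>t>0. halfline_density (q t)) \<and>
     (\<forall>t\<ge>0. 0 \<le> ell t) \<and>
     (\<forall>t>0. \<forall>x>0.
        q t differentiable at x \<and>
        deriv (q t) differentiable at x \<and>
        ((\<lambda>s. q s x) has_real_derivative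
           1 / 2 * (\<sigma> (ell t))\<^sup>2 * deriv (deriv (q t)) x) (at t)) \<and>
     (\<forall>t>0. (q t has_real_derivative 0) (at_right 0)) \<and>
     (\<forall>t\<ge>0.
        set_integrable lborel {0<..t} (\<lambda>s. q s 0 * (\<sigma> (ell s))\<^sup>2) \<and>
        ell t = 1 / 2 * (LBINT s:{0<..t}. q s 0 * (\<sigma> (ell s))\<^sup>2)) \<and>
     (\<forall>\<tau> :: nat \<Rightarrow> real. (\<forall>n. 0 < \<tau> n) \<longrightarrow> \<tau> \<longlonglongrightarrow> 0 \<longrightarrow>
        weak_conv_m (\<lambda>n. halfline_law (q (\<tau> n))) (halfline_law f))"

end

theory Submission
  imports Defs
begin

text \<open>With \<open>A' = \<sigma>\<^sup>2(ell)\<close> and \<open>q t x = u (A t) x\<close> the problem becomes the heat equation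
  \<open>u\<^sub>a = u\<^sub>x\<^sub>x / 2\<close> with a Neumann condition at 0, whose solution is the heat semigroup applied to
  the even extension of \<open>f\<close>, together with \<open>ell = L \<circ> A\<close> for \<open>L a = 1/2 \<integral>\<^sub>0\<^sup>a u r 0 dr\<close>. Hence
  \<open>A\<close> solves the autonomous equation \<open>A' = \<sigma>\<^sup>2(L A)\<close>, which is solved uniquely by separation of
  variables; the solution is global because \<open>L a \<le> sqrt a\<close> and \<open>\<sigma>\<close> grows at most linearly.

  For uniqueness of \<open>u\<close> only separate differentiability in time and space is available. Since all
  \<open>u a\<close> are probability densities, pointwise convergence in time improves to convergence in
  \<open>L\<^sup>1\<close> (Scheffe). A Baire category argument on the closed set of times at which joint continuity
  fails, with parabolic barriers started at such times, then gives joint continuity in the interior,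
  so that the maximum principle applies. It passes to the integrals over \<open>{x..x + h}\<close> of the difference of
  two solutions, which are uniform limits of sums of translates; choosing \<open>h\<close> large shows that the
  distribution functions coincide. Conservation of mass thus replaces the boundary condition.\<close>

section \<open>The pointwise heat equation and the maximum principle\<close>

text \<open>The heat problem for \<open>u\<close> decouples: every solution becomes, along its own
  clock, a unit-mass heat flow started from \<open>f\<close>, and only afterwards does the equation
  for \<open>ell\<close> determine that clock. Separation of variables fits because
  \<open>L'\<close> may blow up at 0, so that \<open>\<sigma>\<^sup>2 (L a)\<close> need not be
  Lipschitz in \<open>a\<close>, while it is continuous and positive.

  The obstacle is that a separately continuous function may be jointly discontinuous, whereas a
  maximum principle needs an attained maximum. At each time the solution is Lipschitz in space, with
  a constant depending on the time; Baire's theorem makes the constant uniform on a portion of the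
  bad times, so that barriers of one common curvature fit there. Just after a bad time joint
  continuity cannot be presupposed, and right continuity in \<open>L\<^sup>1\<close> takes its place
  as initial condition.

  Windows \<open>{x..x + h}\<close> suit the data: at time 0 only distribution functions converge,
  and near \<open>x = 0\<close> no pointwise bound is at hand. A long window starting near 0 holds
  almost all the mass of both solutions, one starting far out almost none, so their difference is
  small in either case.\<close>

definition heat_at :: "(real \<Rightarrow> real \<Rightarrow> real) \<Rightarrow> real \<Rightarrow> real \<Rightarrow> bool" where
  "heat_at z t x \<longleftrightarrow> (\<exists>z1 z2.
     (\<forall>\<^sub>F y in nhds x. (z t has_real_derivative z1 y) (at y)) \<and>
     (z1 has_real_derivative z2) (at x) \<and>
     ((\<lambda>s. z s x) has_real_derivative z2 / 2) (at t))"

lemma heat_at_lincomb: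
  assumes "heat_at z t x" "heat_at w t x"
  shows "heat_at (\<lambda>t x. a * z t x + b * w t x) t x"
proof -
  obtain z1 z2 w1 w2 where z:
    "\<forall>\<^sub>F y in nhds x. (z t has_real_derivative z1 y) (at y)"
    "(z1 has_real_derivative z2) (at x)" "((\<lambda>s. z s x) has_real_derivative z2 / 2) (at t)"
    and w: "\<forall>\<^sub>F y in nhds x. (w t has_real_derivative w1 y) (at y)"
    "(w1 has_real_derivative w2) (at x)" "((\<lambda>s. w s x) has_real_derivative w2 / 2) (at t)"
    using assms unfolding heat_at_def by blast
  show ?thesis unfolding heat_at_def
  proof (intro exI conjI)
    show "\<forall>\<^sub>F y in nhds x. ((\<lambda>x. a * z t x + b * w t x) has_real_derivative a * z1 y + b * w1 y) (at y)"
      using z(1) w(1) by eventually_elim (auto intro!: derivative_eq_intros)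
    show "((\<lambda>y. a * z1 y + b * w1 y) has_real_derivative a * z2 + b * w2) (at x)"
      using z(2) w(2) by (auto intro!: derivative_eq_intros)
    show "((\<lambda>s. a * z s x + b * w s x) has_real_derivative (a * z2 + b * w2) / 2) (at t)"
      using z(3) w(3) by (auto intro!: derivative_eq_intros simp: field_simps)
  qed
qed

lemma heat_at_parabola: "heat_at (\<lambda>t x. C * ((x - x0)\<^sup>2 + (t - t0)) + D) t x"
  unfolding heat_at_def
  by (rule exI[of _ "\<lambda>y. C * (2 * (y - x0))"], rule exI[of _ "C * 2"])
     (auto intro!: derivative_eq_intros always_eventually)

lemma heat_at_const: "heat_at (\<lambda>t x. D) t x"
  using heat_at_parabola[of 0 0 0 D] by simp

lemma heat_at_diff:
  assumes "heat_at z t x" "heat_at w t x"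
  shows "heat_at (\<lambda>t x. z t x - w t x) t x"
  using heat_at_lincomb[OF assms, of 1 "-1"] by simp

lemma heat_at_minus: "heat_at z t x \<Longrightarrow> heat_at (\<lambda>t x. - z t x) t x"
  using heat_at_diff[OF heat_at_const[of 0], of z t x] by simp

lemma heat_at_sum:
  assumes "finite S" "\<And>i. i \<in> S \<Longrightarrow> heat_at (z i) t x"
  shows "heat_at (\<lambda>t x. \<Sum>i\<in>S. z i t x) t x"
  using assms
proof (induction S)
  case empty
  show ?case by (simp add: heat_at_const)
next
  case (insert i S)
  then show ?case using heat_at_lincomb[of "z i" t x "\<lambda>t x. \<Sum>i\<in>S. z i t x" 1 1] by simp
qed

lemma heat_at_shift:
  assumes "heat_at z (t + \<tau>) (x + h)"
  shows "heat_at (\<lambda>t x. z (t + \<tau>) (x + h)) t x"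
proof -
  obtain z1 z2 where z:
    "\<forall>\<^sub>F y in nhds (x + h). (z (t + \<tau>) has_real_derivative z1 y) (at y)"
    "(z1 has_real_derivative z2) (at (x + h))"
    "((\<lambda>s. z s (x + h)) has_real_derivative z2 / 2) (at (t + \<tau>))"
    using assms unfolding heat_at_def by blast
  have "filterlim (\<lambda>y. y + h) (nhds (x + h)) (nhds x)"
    by (intro tendsto_intros filterlim_ident)
  from eventually_compose_filterlim[OF z(1) this]
  have "\<forall>\<^sub>F y in nhds x. ((\<lambda>x. z (t + \<tau>) (x + h)) has_real_derivative z1 (y + h)) (at y)"
    by eventually_elim (simp add: DERIV_shift)
  moreover have "((\<lambda>y. z1 (y + h)) has_real_derivative z2) (at x)"
    using z(2) by (simp add: DERIV_shift)
  moreover have "((\<lambda>s. z (s + \<tau>) (x + h)) has_real_derivative z2 / 2) (at t)"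
    using z(3) by (simp add: DERIV_shift[of "\<lambda>s. z s (x + h)"])
  ultimately show ?thesis unfolding heat_at_def
    by (intro exI[of _ "\<lambda>y. z1 (y + h)"] exI[of _ z2]) simp
qed

text \<open>The second derivative exists at the single point \<open>x\<close>, with no continuity to
  expand around. If it were positive, \<open>g1\<close> would vanish at \<open>x\<close> and be
  positive just to the right, and the mean value theorem would push \<open>g\<close> above its
  maximum.\<close>

lemma second_derivative_nonpos_at_max:
  fixes g g1 :: "real \<Rightarrow> real"
  assumes g1: "\<forall>\<^sub>F y in nhds x. (g has_real_derivative g1 y) (at y)"
    and g2: "(g1 has_real_derivative g2) (at x)"
    and max: "\<forall>\<^sub>F y in nhds x. g y \<le> g x"
  shows "g2 \<le> 0"
proof (rule ccontr)
  assume "\<not> g2 \<le> 0"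
  obtain d where d: "d > 0"
    "\<And>y. dist y x < d \<Longrightarrow> (g has_real_derivative g1 y) (at y) \<and> g y \<le> g x"
    using eventually_conj[OF g1 max] unfolding eventually_nhds_metric by auto
  have "g1 x = 0"
    using d by (intro DERIV_local_max[of g "g1 x" x d]) (auto simp: dist_real_def abs_minus_commute)
  obtain e where e: "e > 0" "\<And>h. 0 < h \<Longrightarrow> h < e \<Longrightarrow> g1 x < g1 (x + h)"
    using DERIV_pos_inc_right[OF g2] \<open>\<not> g2 \<le> 0\<close> by auto
  define h where "h = min d e / 2"
  have h: "0 < h" "h < d" "h < e" using d e by (auto simp: h_def)
  obtain \<xi> where \<xi>: "x < \<xi>" "\<xi> < x + h" "g (x + h) - g x = (x + h - x) * g1 \<xi>"
    using h d by (atomize_elim, intro MVT2) (auto simp: dist_real_def)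
  have "g1 \<xi> > 0" using e(2)[of "\<xi> - x"] \<xi> h \<open>g1 x = 0\<close> by auto
  then have "0 < h * g1 \<xi>" using h(1) by (rule mult_pos_pos[rotated])
  then have "g (x + h) > g x" using \<xi>(3) by simp
  then show False using d(2)[of "x + h"] h by (auto simp: dist_real_def)
qed

text \<open>Subtracting \<open>\<epsilon> * (t - s)\<close> makes the time derivative strictly
  negative wherever the second space derivative is nonpositive, which excludes an interior
  maximum.\<close>

lemma heat_max_principle:
  fixes z :: "real \<Rightarrow> real \<Rightarrow> real"
  assumes cont: "continuous_on ({s..e} \<times> {p..r}) (\<lambda>(t, x). z t x)"
    and heat: "\<And>t x. s < t \<Longrightarrow> t \<le> e \<Longrightarrow> p < x \<Longrightarrow> x < r \<Longrightarrow> heat_at z t x"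
    and init: "\<And>x. x \<in> {p..r} \<Longrightarrow> z s x \<le> m"
    and lat: "\<And>t. t \<in> {s..e} \<Longrightarrow> z t p \<le> m" "\<And>t. t \<in> {s..e} \<Longrightarrow> z t r \<le> m"
    and tx: "t \<in> {s..e}" "x \<in> {p..r}"
  shows "z t x \<le> m"
proof (rule ccontr)
  assume "\<not> z t x \<le> m"
  then have neq: "t > s" using init[OF tx(2)] tx(1) by (cases "t = s") auto
  \<comment> \<open>This penalty uses up half of the excess over \<open>m\<close> at the point
    \<open>(t, x)\<close>, so the penalised function still exceeds \<open>m\<close> there.\<close>
  define \<epsilon> where "\<epsilon> = (z t x - m) / 2 / (t - s)"
  have "\<epsilon> * (t - s) = (z t x - m) / 2"
    using neq nonzero_eq_divide_eq[of "t - s" \<epsilon> "(z t x - m) / 2"] by (simp add: \<epsilon>_def)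
  then have \<epsilon>: "\<epsilon> > 0" "z t x - \<epsilon> * (t - s) > m"
    using \<open>\<not> z t x \<le> m\<close> neq by (simp add: \<epsilon>_def, argo)
  define y where "y = (\<lambda>(t, x). z t x - \<epsilon> * (t - s))"
  have "continuous_on ({s..e} \<times> {p..r}) y"
    unfolding y_def using cont by (auto simp: case_prod_unfold intro!: continuous_intros)
  moreover have "compact ({s..e} \<times> {p..r})" by (intro compact_Times compact_Icc)
  ultimately obtain t0 x0 where m0: "t0 \<in> {s..e}" "x0 \<in> {p..r}"
    and max: "\<And>t x. t \<in> {s..e} \<Longrightarrow> x \<in> {p..r} \<Longrightarrow> y (t, x) \<le> y (t0, x0)"
    using continuous_attains_sup[of "{s..e} \<times> {p..r}" y] tx by (auto; blast)
  have gt: "z t0 x0 - \<epsilon> * (t0 - s) > m" using max[OF tx] \<epsilon>(2) by (simp add: y_def)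
  have "\<epsilon> * (t0 - s) \<ge> 0" using \<epsilon> m0 by auto
  have "t0 \<noteq> s" using gt init[OF m0(2)] by auto
  moreover have "x0 \<noteq> p" "x0 \<noteq> r"
    using gt lat[OF m0(1)] \<open>\<epsilon> * (t0 - s) \<ge> 0\<close> by auto
  ultimately have int: "s < t0" "t0 \<le> e" "p < x0" "x0 < r" using m0 by auto
  obtain z1 z2 where d:
    "\<forall>\<^sub>F y in nhds x0. (z t0 has_real_derivative z1 y) (at y)"
    "(z1 has_real_derivative z2) (at x0)" "((\<lambda>s. z s x0) has_real_derivative z2 / 2) (at t0)"
    using heat[OF int] unfolding heat_at_def by blast
  have "\<forall>\<^sub>F y in nhds x0. y \<in> {p<..<r}"
    using int by (intro eventually_nhds_in_open) auto
  then have "\<forall>\<^sub>F y in nhds x0. z t0 y \<le> z t0 x0"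
    by eventually_elim (use max[OF m0(1)] in \<open>auto simp: y_def\<close>)
  from second_derivative_nonpos_at_max[OF d(1,2) this] have "z2 \<le> 0" .
  have "((\<lambda>s'. z s' x0 - \<epsilon> * (s' - s)) has_real_derivative (z2 / 2 - \<epsilon>)) (at t0)"
    using d(3) by (auto intro!: derivative_eq_intros)
  moreover have "z2 / 2 - \<epsilon> < 0" using \<open>z2 \<le> 0\<close> \<epsilon> by auto
  \<comment> \<open>The maximum may sit at the final time \<open>e\<close>; the contradiction
    therefore comes from earlier times only.\<close>
  ultimately obtain d where d: "d > 0"
     "\<And>h. 0 < h \<Longrightarrow> h < d \<Longrightarrow> z (t0 - h) x0 - \<epsilon> * ((t0 - h) - s) > z t0 x0 - \<epsilon> * (t0 - s)"
    using DERIV_neg_dec_left by blast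
  define h where "h = min (d / 2) (t0 - s)"
  have "0 < h" "h < d" "t0 - h \<in> {s..e}" using d int by (auto simp: h_def)
  then show False using d(2)[of h] max[of "t0 - h" x0] m0 by (auto simp: y_def)
qed

section \<open>The heat kernel\<close>

text \<open>By the mean value theorem the difference quotients inherit the bound \<open>w\<close>,
  so dominated convergence applies along every sequence of increments.\<close>

lemma has_real_derivative_lebesgue_integral:
  fixes F F' :: "real \<Rightarrow> 'a \<Rightarrow> real"
  assumes d: "0 < d"
    and int: "\<And>x. \<bar>x - x0\<bar> < d \<Longrightarrow> integrable M (F x)"
    and deriv: "\<And>x y. \<bar>x - x0\<bar> < d \<Longrightarrow> ((\<lambda>x. F x y) has_real_derivative F' x y) (at x)"
    and bound: "\<And>x y. \<bar>x - x0\<bar> < d \<Longrightarrow> \<bar>F' x y\<bar> \<le> w y"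
    and w: "integrable M w"
    and meas: "F' x0 \<in> borel_measurable M"
  shows "((\<lambda>x. \<integral>y. F x y \<partial>M) has_real_derivative (\<integral>y. F' x0 y \<partial>M)) (at x0)"
proof -
  \<comment> \<open>Taking the limit within the neighbourhood puts every increment of a test
    sequence into the range where the hypotheses apply.\<close>
  have at0: "at (0::real) within {-d<..<d} = at 0"
    using d by (intro at_within_open) auto
  have quot: "\<bar>(F (x0 + h) y - F x0 y) / h\<bar> \<le> w y" if h: "\<bar>h\<bar> < d" "h \<noteq> 0" for h y
  proof -
    have *: "\<exists>z. \<bar>z - x0\<bar> < d \<and> F b y - F a y = (b - a) * F' z y"
      if "a < b" "\<bar>a - x0\<bar> < d" "\<bar>b - x0\<bar> < d" for a b
    proof -
      have "\<exists>z>a. z < b \<and> F b y - F a y = (b - a) * F' z y"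
        using that by (intro MVT2 deriv) auto
      then obtain z where "a < z" "z < b" "F b y - F a y = (b - a) * F' z y" by blast
      then show ?thesis using that by (intro exI[of _ z]) auto
    qed
    have "\<exists>z. \<bar>z - x0\<bar> < d \<and> F (x0 + h) y - F x0 y = h * F' z y"
    proof (cases "h > 0")
      case True then show ?thesis using *[of x0 "x0 + h"] h d by auto
    next
      case False
      then obtain z where "\<bar>z - x0\<bar> < d" "F x0 y - F (x0 + h) y = (x0 - (x0 + h)) * F' z y"
        using *[of "x0 + h" x0] h d by auto
      then show ?thesis by (intro exI[of _ z]) auto
    qed
    then obtain z where "\<bar>z - x0\<bar> < d" "F (x0 + h) y - F x0 y = h * F' z y" by blast
    then show ?thesis using h bound[of z y] by simp
  qed
  have "((\<lambda>h. ((\<integral>y. F (x0 + h) y \<partial>M) - (\<integral>y. F x0 y \<partial>M)) / h) \<longlongrightarrow> (\<integral>y. F' x0 y \<partial>M)) (at 0 within {-d<..<d})"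
    unfolding tendsto_at_iff_sequentially
  proof (intro allI impI)
    fix X :: "nat \<Rightarrow> real" assume X: "\<forall>i. X i \<in> {- d<..<d} - {0}" "X \<longlonglongrightarrow> 0"
    have Xd: "\<bar>X i\<bar> < d" "X i \<noteq> 0" for i using X(1) by (auto simp: abs_less_iff dest: spec[of _ i])
    have eq: "((\<integral>y. F (x0 + X i) y \<partial>M) - (\<integral>y. F x0 y \<partial>M)) / X i
        = (\<integral>y. (F (x0 + X i) y - F x0 y) / X i \<partial>M)" for i
      using int[of "x0 + X i"] int[of x0] Xd[of i] d by simp
    have "(\<lambda>i. (\<integral>y. (F (x0 + X i) y - F x0 y) / X i \<partial>M)) \<longlonglongrightarrow> (\<integral>y. F' x0 y \<partial>M)"
    proof (rule integral_dominated_convergence[where w = w])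
      show "(\<lambda>y. (F (x0 + X i) y - F x0 y) / X i) \<in> borel_measurable M" for i
        using int[of "x0 + X i"] int[of x0] Xd[of i] d by auto
      have "(\<lambda>i. (F (x0 + X i) y - F x0 y) / X i) \<longlonglongrightarrow> F' x0 y" for y
      proof -
        have "((\<lambda>h. (F (x0 + h) y - F x0 y) / h) \<longlongrightarrow> F' x0 y) (at 0)"
          using deriv[of x0 y] d by (simp add: DERIV_def)
        then show ?thesis using X Xd
          by (auto simp: tendsto_at_iff_sequentially o_def)
      qed
      then show "AE y in M. (\<lambda>i. (F (x0 + X i) y - F x0 y) / X i) \<longlonglongrightarrow> F' x0 y" by simp
      show "AE y in M. norm ((F (x0 + X i) y - F x0 y) / X i) \<le> w y" for i
        using quot[OF Xd, of i] by simp
    qed (use meas w in auto)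
    then show "((\<lambda>h. ((\<integral>y. F (x0 + h) y \<partial>M) - (\<integral>y. F x0 y \<partial>M)) / h) \<circ> X) \<longlonglongrightarrow> (\<integral>y. F' x0 y \<partial>M)"
      by (simp add: o_def eq)
  qed
  then show ?thesis by (simp add: at0 DERIV_def)
qed

text \<open>Because of the factor 1/2 in the equation, time is the variance;
  \<open>normal_density\<close> expects the standard deviation.\<close>

definition heat_kernel :: "real \<Rightarrow> real \<Rightarrow> real" where
  "heat_kernel a z = normal_density 0 (sqrt a) z"

lemma heat_kernel_eq: "a > 0 \<Longrightarrow> heat_kernel a z = exp (- z\<^sup>2 / (2 * a)) / sqrt (2 * pi * a)"
  by (simp add: heat_kernel_def normal_density_def)

lemma heat_kernel_nonneg: "0 \<le> heat_kernel a z"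
  by (simp add: heat_kernel_def)

lemma heat_kernel_measurable[measurable]: "heat_kernel a \<in> borel_measurable borel"
  unfolding heat_kernel_def[abs_def] by measurable

lemma heat_kernel_deriv_x:
  assumes "a > 0"
  shows "(heat_kernel a has_real_derivative - (z / a) * heat_kernel a z) (at z)"
proof -
  have "((\<lambda>z. exp (- z\<^sup>2 / (2 * a)) / N) has_real_derivative
      - (z / a) * (exp (- z\<^sup>2 / (2 * a)) / N)) (at z)" for N
    using assms by (cases "N = 0") (auto intro!: derivative_eq_intros simp: field_simps)
  moreover have "heat_kernel a = (\<lambda>z. exp (- z\<^sup>2 / (2 * a)) / sqrt (2 * pi * a))"
    using heat_kernel_eq[OF assms] by auto
  ultimately show ?thesis by simp
qed

lemma heat_kernel_deriv_xx:
  assumes "a > 0"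
  shows "((\<lambda>z. - (z / a) * heat_kernel a z) has_real_derivative
    (z\<^sup>2 / a\<^sup>2 - 1 / a) * heat_kernel a z) (at z)"
  using assms by (auto intro!: derivative_eq_intros heat_kernel_deriv_x simp: field_simps power2_eq_square)

lemma heat_kernel_deriv_t:
  assumes "a > 0"
  shows "((\<lambda>a. heat_kernel a z) has_real_derivative
    (z\<^sup>2 / a\<^sup>2 - 1 / a) * heat_kernel a z / 2) (at a)"
proof -
  define i where "i = inverse (sqrt (2 * pi * a))"
  have "i * i = inverse (sqrt (2 * pi * a) * sqrt (2 * pi * a))" by (simp only: i_def inverse_mult_distrib)
  also have "sqrt (2 * pi * a) * sqrt (2 * pi * a) = 2 * pi * a" using assms by simp
  finally have i: "i * i * pi = 1 / (2 * a)" using assms by (simp add: field_simps)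
  have "0 < 2 * pi * a" using assms by simp
  from DERIV_inverse'[OF DERIV_chain2[OF DERIV_real_sqrt[OF this] DERIV_cmult_Id]] assms
  have "((\<lambda>a. inverse (sqrt (2 * pi * a))) has_real_derivative - (i * i * pi) * i) (at a)"
    by (simp add: i_def mult_ac)
  then have d: "((\<lambda>a. inverse (sqrt (2 * pi * a))) has_real_derivative - (1 / (2 * a)) * i) (at a)"
    unfolding i .
  have "((\<lambda>a. exp (- z\<^sup>2 / (2 * a)) * inverse (sqrt (2 * pi * a))) has_real_derivative
      (z\<^sup>2 / a\<^sup>2 - 1 / a) * (exp (- z\<^sup>2 / (2 * a)) * i) / 2) (at a)"
  proof (rule DERIV_cong[OF DERIV_mult[OF _ d]])
    show "((\<lambda>a. exp (- z\<^sup>2 / (2 * a))) has_real_derivative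
        exp (- z\<^sup>2 / (2 * a)) * (z\<^sup>2 / (2 * a\<^sup>2))) (at a)"
    proof (rule DERIV_fun_exp)
      have "((\<lambda>a. - z\<^sup>2 / 2 * inverse a) has_real_derivative
          - z\<^sup>2 / 2 * - (inverse a * 1 * inverse a)) (at a)"
        by (rule DERIV_cmult[OF DERIV_inverse'[OF DERIV_ident]]) (use assms in simp)
      moreover have "(\<lambda>a. - z\<^sup>2 / 2 * inverse a) = (\<lambda>a. - z\<^sup>2 / (2 * a))"
        by (simp add: inverse_eq_divide)
      moreover have "- z\<^sup>2 / 2 * - (inverse a * 1 * inverse a) = z\<^sup>2 / (2 * a\<^sup>2)"
        by (simp add: inverse_eq_divide power2_eq_square)
      ultimately show "((\<lambda>a. - z\<^sup>2 / (2 * a)) has_real_derivative z\<^sup>2 / (2 * a\<^sup>2)) (at a)"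
        by (simp only:)
    qed
    have "E * (P / 2) * I + (- (Q / 2) * I) * E = (P - Q) * (E * I) / 2" for E P Q I :: real
      by (simp add: algebra_simps diff_divide_distrib)
    from this[of "exp (- z\<^sup>2 / (2 * a))" "z\<^sup>2 / a\<^sup>2" "inverse (sqrt (2 * pi * a))" "1 / a"]
    show "exp (- z\<^sup>2 / (2 * a)) * (z\<^sup>2 / (2 * a\<^sup>2)) * inverse (sqrt (2 * pi * a)) +
        - (1 / (2 * a)) * i * exp (- z\<^sup>2 / (2 * a)) =
      (z\<^sup>2 / a\<^sup>2 - 1 / a) * (exp (- z\<^sup>2 / (2 * a)) * i) / 2"
      by (simp only: i_def divide_divide_eq_left mult.commute[of 2])
  qed
  then have *: "((\<lambda>a. exp (- z\<^sup>2 / (2 * a)) / sqrt (2 * pi * a)) has_real_derivative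
      (z\<^sup>2 / a\<^sup>2 - 1 / a) * (exp (- z\<^sup>2 / (2 * a)) / sqrt (2 * pi * a)) / 2) (at a)"
    by (simp only: divide_inverse i_def)
  have "\<forall>\<^sub>F b in nhds a. b \<in> {0<..}" using assms by (intro eventually_nhds_in_open) auto
  then have "\<forall>\<^sub>F b in nhds a. heat_kernel b z = exp (- z\<^sup>2 / (2 * b)) / sqrt (2 * pi * b)"
    by eventually_elim (simp add: heat_kernel_eq)
  from DERIV_cong_ev[OF refl this refl] * show ?thesis using assms by (simp add: heat_kernel_eq)
qed

lemma times_exp_minus_le_one: "u * exp (- u) \<le> (1::real)"
proof -
  have "u \<le> exp u" using exp_ge_add_one_self[of u] by linarith
  then show ?thesis by (simp add: exp_minus field_simps)
qed

text \<open>Uniformity in \<open>z\<close> and in all \<open>a \<ge> b\<close> turns these into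
  dominating constants. The polynomial factors are absorbed by the Gaussian through
  \<open>times_exp_minus_le_one\<close> with \<open>u = z\<^sup>2 / (2 * a)\<close>.\<close>

lemma heat_kernel_le:
  assumes "0 < b" "b \<le> a"
  shows "heat_kernel a z \<le> 1 / sqrt (2 * pi * b)"
    "\<bar>- (z / a) * heat_kernel a z\<bar> \<le> (1 + 1 / b) / sqrt (2 * pi * b)"
    "\<bar>(z\<^sup>2 / a\<^sup>2 - 1 / a) * heat_kernel a z\<bar> \<le> (3 / b) / sqrt (2 * pi * b)"
proof -
  have a: "a > 0" using assms by simp
  define e where "e = exp (- z\<^sup>2 / (2 * a))"
  have e: "0 \<le> e" "e \<le> 1" using a by (auto simp: e_def)
  have z: "z\<^sup>2 / a * e \<le> 2"
    using times_exp_minus_le_one[of "z\<^sup>2 / (2 * a)"] a by (simp add: e_def field_simps)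
  have s: "1 / sqrt (2 * pi * a) \<le> 1 / sqrt (2 * pi * b)"
    using assms by (intro divide_left_mono) auto
  have k: "heat_kernel a z = e * (1 / sqrt (2 * pi * a))" using a by (simp add: heat_kernel_eq e_def)
  have kk: "\<bar>c * heat_kernel a z\<bar> \<le> C / sqrt (2 * pi * b)" if "\<bar>c\<bar> * e \<le> C" for c C
  proof -
    have "\<bar>c * heat_kernel a z\<bar> = \<bar>c\<bar> * e * (1 / sqrt (2 * pi * a))"
      using e a by (simp add: k abs_mult)
    also have "\<dots> \<le> C * (1 / sqrt (2 * pi * b))"
      using that s e a order_trans[OF mult_nonneg_nonneg[of "\<bar>c\<bar>" e] that] by (intro mult_mono) auto
    finally show ?thesis by simp
  qed
  have z0: "0 \<le> z\<^sup>2 / a * e" using e a by simp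
  have ab: "1 / a \<le> 1 / b" using assms by (intro divide_left_mono) auto
  show "heat_kernel a z \<le> 1 / sqrt (2 * pi * b)" using kk[of 1 1] e heat_kernel_nonneg[of a z] by simp
  have "\<bar>z / a\<bar> \<le> z\<^sup>2 / a / 2 + 1 / a / 2"
  proof -
    have "0 \<le> (\<bar>z\<bar> - 1)\<^sup>2" by simp
    then have "2 * \<bar>z\<bar> \<le> z\<^sup>2 + 1" by (simp add: power2_diff)
    then show ?thesis using a by (simp add: field_simps)
  qed
  then have "\<bar>z / a\<bar> * e \<le> (z\<^sup>2 / a / 2 + 1 / a / 2) * e" using e by (intro mult_right_mono) auto
  also have "\<dots> = (z\<^sup>2 / a * e) / 2 + 1 / a * e / 2" by (simp add: algebra_simps)
  also have "\<dots> \<le> 1 + 1 / b"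
  proof -
    have "1 / a * e \<le> 1 / b * 1" using e ab a assms by (intro mult_mono) auto
    moreover have "1 / b > 0" using assms by simp
    moreover have "X / 2 + Y / 2 \<le> 1 + B" if "X \<le> 2" "Y \<le> B * 1" "0 < B" for X Y B :: real
      using that by simp
    ultimately show ?thesis using z by blast
  qed
  finally show "\<bar>- (z / a) * heat_kernel a z\<bar> \<le> (1 + 1 / b) / sqrt (2 * pi * b)"
    by (intro kk) simp
  have "\<bar>z\<^sup>2 / a\<^sup>2 - 1 / a\<bar> * e \<le> (z\<^sup>2 / a + 1) / a * e"
    using e a by (intro mult_right_mono) (auto simp: abs_le_iff field_simps power2_eq_square)
  also have "\<dots> = 1 / a * (z\<^sup>2 / a * e + e)" by (simp add: algebra_simps add_divide_distrib)
  also have "\<dots> \<le> 1 / b * 3"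
    using ab z e z0 a assms by (intro mult_mono) auto
  finally show "\<bar>(z\<^sup>2 / a\<^sup>2 - 1 / a) * heat_kernel a z\<bar> \<le> (3 / b) / sqrt (2 * pi * b)"
    by (intro kk) simp
qed

section \<open>The heat evolution of an integrable function on the line\<close>

definition heat_ext :: "(real \<Rightarrow> real) \<Rightarrow> real \<Rightarrow> real \<Rightarrow> real" where
  "heat_ext g a x = (\<integral>y. g y * heat_kernel a (x - y) \<partial>lborel)"

context
  fixes g :: "real \<Rightarrow> real"
  assumes g: "integrable lborel g"
begin

lemma integrable_lborel_measurable: "g \<in> borel_measurable borel"
  using borel_measurable_integrable[OF g] by simp

lemma integrable_times_bounded:
  assumes "\<And>y. \<bar>h y\<bar> \<le> C" "h \<in> borel_measurable borel"
  shows "integrable lborel (\<lambda>y. g y * h y)"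
proof (rule Bochner_Integration.integrable_bound)
  show "integrable lborel (\<lambda>y. C * g y)" using g by simp
  show "(\<lambda>y. g y * h y) \<in> borel_measurable lborel" using integrable_lborel_measurable assms(2) by simp
  have "\<bar>g y\<bar> * \<bar>h y\<bar> \<le> \<bar>C\<bar> * \<bar>g y\<bar>" for y
    using mult_left_mono[of "\<bar>h y\<bar>" "\<bar>C\<bar>" "\<bar>g y\<bar>"] assms(1)[of y] by (simp add: mult.commute)
  then show "AE y in lborel. norm (g y * h y) \<le> norm (C * g y)" by (auto simp: abs_mult)
qed

lemma heat_ext_integrable:
  assumes "a > 0"
  shows "integrable lborel (\<lambda>y. g y * heat_kernel a (x - y))"
  using heat_kernel_le(1)[OF assms order_refl] heat_kernel_nonneg
  by (intro integrable_times_bounded[where C = "1 / sqrt (2 * pi * a)"]) auto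

lemma heat_ext_heat_at:
  assumes a: "a > 0"
  shows "(heat_ext g a has_real_derivative
      (\<integral>y. g y * (- ((x - y) / a) * heat_kernel a (x - y)) \<partial>lborel)) (at x)"
    and "heat_at (heat_ext g) a x"
proof -
  define z1 where "z1 = (\<lambda>x. \<integral>y. g y * (- ((x - y) / a) * heat_kernel a (x - y)) \<partial>lborel)"
  define z2 where "z2 = (\<integral>y. g y * (((x - y)\<^sup>2 / a\<^sup>2 - 1 / a) * heat_kernel a (x - y)) \<partial>lborel)"
  let ?C1 = "(1 + 1 / a) / sqrt (2 * pi * a)"
  let ?C2 = "(3 / a) / sqrt (2 * pi * a)"
  let ?C3 = "(3 / (a/2)) / sqrt (2 * pi * (a/2))"
  have mult: "\<bar>g y * c\<bar> \<le> \<bar>g y\<bar> * C" if "\<bar>c\<bar> \<le> C" for y c C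
    using that by (simp add: abs_mult mult_left_mono)
  have w: "integrable lborel (\<lambda>y. \<bar>g y\<bar> * C)" for C
    using g by (intro integrable_mult_left integrable_abs)
  have 1: "(heat_ext g a has_real_derivative z1 x) (at x)" for x
    unfolding heat_ext_def[abs_def] z1_def
  proof (rule has_real_derivative_lebesgue_integral[where d = 1 and w = "\<lambda>y. \<bar>g y\<bar> * ?C1"])
    show "((\<lambda>x. g y * heat_kernel a (x - y)) has_real_derivative
        g y * (- ((x - y) / a) * heat_kernel a (x - y))) (at x)" for x y
      using a by (auto intro!: derivative_eq_intros DERIV_chain2[OF heat_kernel_deriv_x])
    show "\<bar>g y * (- ((x - y) / a) * heat_kernel a (x - y))\<bar> \<le> \<bar>g y\<bar> * ?C1" for x y
      using heat_kernel_le(2)[OF a order_refl] by (intro mult) auto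
  qed (use a g integrable_lborel_measurable in \<open>auto intro!: heat_ext_integrable\<close>)
  then show "(heat_ext g a has_real_derivative
      (\<integral>y. g y * (- ((x - y) / a) * heat_kernel a (x - y)) \<partial>lborel)) (at x)"
    by (simp add: z1_def)
  have 2: "(z1 has_real_derivative z2) (at x)"
    unfolding z1_def z2_def
  proof (rule has_real_derivative_lebesgue_integral[where d = 1 and w = "\<lambda>y. \<bar>g y\<bar> * ?C2"])
    show "((\<lambda>x. g y * (- ((x - y) / a) * heat_kernel a (x - y))) has_real_derivative
        g y * (((x - y)\<^sup>2 / a\<^sup>2 - 1 / a) * heat_kernel a (x - y))) (at x)" for x y
    proof (rule DERIV_cmult)
      have "((\<lambda>x. - ((x + - y) / a) * heat_kernel a (x + - y)) has_real_derivative
        ((x + - y)\<^sup>2 / a\<^sup>2 - 1 / a) * heat_kernel a (x + - y)) (at x)"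
        using heat_kernel_deriv_xx[OF a, of "x + - y"]
        by (simp only: DERIV_shift)
      then show "((\<lambda>x. - ((x - y) / a) * heat_kernel a (x - y)) has_real_derivative
        ((x - y)\<^sup>2 / a\<^sup>2 - 1 / a) * heat_kernel a (x - y)) (at x)" by simp
    qed
    show "\<bar>g y * (((x - y)\<^sup>2 / a\<^sup>2 - 1 / a) * heat_kernel a (x - y))\<bar> \<le> \<bar>g y\<bar> * ?C2" for x y
      using heat_kernel_le(3)[OF a order_refl] by (intro mult) auto
    show "integrable lborel (\<lambda>y. g y * (- ((x - y) / a) * heat_kernel a (x - y)))" for x
      using heat_kernel_le(2)[OF a order_refl] by (intro integrable_times_bounded[where C = ?C1]) auto
  qed (use a g integrable_lborel_measurable in auto)
  have 3: "((\<lambda>a. heat_ext g a x) has_real_derivative z2 / 2) (at a)"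
  proof -
    have "((\<lambda>a. heat_ext g a x) has_real_derivative
      (\<integral>y. g y * (((x - y)\<^sup>2 / a\<^sup>2 - 1 / a) * heat_kernel a (x - y) / 2) \<partial>lborel)) (at a)"
      unfolding heat_ext_def
    \<comment> \<open>Times within \<open>a/2\<close> of \<open>a\<close> stay above
      \<open>a/2\<close>, so the constant of \<open>heat_kernel_le\<close> at \<open>b = a/2\<close>
      dominates all of them.\<close>
    proof (rule has_real_derivative_lebesgue_integral[where d = "a/2" and w = "\<lambda>y. \<bar>g y\<bar> * ?C3"
          and F' = "\<lambda>a y. g y * (((x - y)\<^sup>2 / a\<^sup>2 - 1 / a) * heat_kernel a (x - y) / 2)"])
      fix b assume b: "\<bar>b - a\<bar> < a / 2"
      have b0: "b > 0" "a / 2 \<le> b" using b a by (auto simp: abs_if split: if_splits)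
      show "integrable lborel (\<lambda>y. g y * heat_kernel b (x - y))" by (rule heat_ext_integrable[OF b0(1)])
      fix y
      show "((\<lambda>b. g y * heat_kernel b (x - y)) has_real_derivative
        g y * (((x - y)\<^sup>2 / b\<^sup>2 - 1 / b) * heat_kernel b (x - y) / 2)) (at b)"
        by (rule DERIV_cmult[OF heat_kernel_deriv_t[OF b0(1)]])
      show "\<bar>g y * (((x - y)\<^sup>2 / b\<^sup>2 - 1 / b) * heat_kernel b (x - y) / 2)\<bar> \<le> \<bar>g y\<bar> * ?C3"
      proof (rule mult)
        have "\<bar>X / 2\<bar> \<le> C" if "\<bar>X\<bar> \<le> C" for X C :: real using that by simp
        from this[OF heat_kernel_le(3)[OF half_gt_zero[OF a] b0(2)]]
        show "\<bar>((x - y)\<^sup>2 / b\<^sup>2 - 1 / b) * heat_kernel b (x - y) / 2\<bar> \<le> ?C3" .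
      qed
    qed (use a g integrable_lborel_measurable in auto)
    then show ?thesis by (simp add: z2_def)
  qed
  show "heat_at (heat_ext g) a x" unfolding heat_at_def
    using 1 2 3 by (intro exI[of _ z1] exI[of _ z2]) auto
qed

text \<open>The smoothing from \<open>L\<^sup>1\<close> to the supremum norm. It turns smallness in
  \<open>L\<^sup>1\<close> into a pointwise bound and later controls the trace at 0.\<close>

lemma heat_ext_le:
  assumes "a > 0"
  shows "\<bar>heat_ext g a x\<bar> \<le> (\<integral>y. \<bar>g y\<bar> \<partial>lborel) / sqrt (2 * pi * a)"
proof -
  have "\<bar>heat_ext g a x\<bar> \<le> (\<integral>y. \<bar>g y * heat_kernel a (x - y)\<bar> \<partial>lborel)"
    unfolding heat_ext_def by (rule integral_abs_bound)
  also have "\<dots> \<le> (\<integral>y. \<bar>g y\<bar> * (1 / sqrt (2 * pi * a)) \<partial>lborel)"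
  proof (rule integral_mono)
    show "integrable lborel (\<lambda>y. \<bar>g y\<bar> * (1 / sqrt (2 * pi * a)))"
      using g by (intro integrable_mult_left integrable_abs)
    show "\<bar>g y * heat_kernel a (x - y)\<bar> \<le> \<bar>g y\<bar> * (1 / sqrt (2 * pi * a))" for y
      unfolding abs_mult using heat_kernel_le(1)[OF assms order_refl] heat_kernel_nonneg
      by (intro mult_left_mono) auto
  qed (intro integrable_abs heat_ext_integrable assms)
  finally show ?thesis by simp
qed

end

text \<open>The same semigroup as the mean of \<open>h (x + sqrt a * Z)\<close> for a standard
  normal \<open>Z\<close>. In contrast to the kernel form it is meaningful at \<open>a = 0\<close>,
  where it is the identity, so that continuity up to the initial time can be expressed.\<close>

definition gauss_avg :: "(real \<Rightarrow> real) \<Rightarrow> real \<Rightarrow> real \<Rightarrow> real" where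
  "gauss_avg h a x = (\<integral>z. h (x + sqrt a * z) * std_normal_density z \<partial>lborel)"

lemma gauss_avg_0 [simp]: "gauss_avg h 0 x = h x"
  by (simp add: gauss_avg_def)

lemma gauss_avg_nonneg: "(\<And>y. 0 \<le> h y) \<Longrightarrow> 0 \<le> gauss_avg h a x"
  by (simp add: gauss_avg_def)

lemma heat_ext_eq_gauss_avg:
  assumes "a > 0"
  shows "heat_ext h a x = gauss_avg h a x"
proof -
  have "sqrt a * heat_kernel a (- (sqrt a * z)) = std_normal_density z" for z
    using assms by (simp add: heat_kernel_eq std_normal_density_def power_mult_distrib real_sqrt_mult)
  then have eq: "h (x + sqrt a * z) * std_normal_density z
      = sqrt a * (h (x + sqrt a * z) * heat_kernel a (x - (x + sqrt a * z)))" for z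
    by (simp add: mult.left_commute)
  show ?thesis
    unfolding heat_ext_def gauss_avg_def eq integral_mult_right_zero
    using lborel_integral_real_affine[of "sqrt a" "\<lambda>y. h y * heat_kernel a (x - y)" x] assms
    by simp
qed

section \<open>Gaussian averages of bounded functions, and duality\<close>

context
  fixes h :: "real \<Rightarrow> real" and B :: real
  assumes h_meas [measurable]: "h \<in> borel_measurable borel" and h_bdd: "\<And>y. \<bar>h y\<bar> \<le> B"
begin

lemma gauss_avg_integrand_le: "\<bar>h (x + sqrt a * z) * std_normal_density z\<bar> \<le> B * std_normal_density z"
  by (simp add: abs_mult h_bdd mult_right_mono)

lemma gauss_avg_integrable: "integrable lborel (\<lambda>z. h (x + sqrt a * z) * std_normal_density z)"
proof (rule Bochner_Integration.integrable_bound)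
  show "integrable lborel (\<lambda>z. B * std_normal_density z)" by simp
  show "AE z in lborel. norm (h (x + sqrt a * z) * std_normal_density z) \<le> norm (B * std_normal_density z)"
    using gauss_avg_integrand_le[of x a] order_trans[OF _ abs_ge_self] by auto
qed simp

lemma gauss_avg_le: "\<bar>gauss_avg h a x\<bar> \<le> B"
proof -
  have "\<bar>gauss_avg h a x\<bar> \<le> (\<integral>z. \<bar>h (x + sqrt a * z) * std_normal_density z\<bar> \<partial>lborel)"
    unfolding gauss_avg_def by (rule integral_abs_bound)
  also have "\<dots> \<le> (\<integral>z. B * std_normal_density z \<partial>lborel)"
    using gauss_avg_integrand_le by (intro integral_mono integrable_abs gauss_avg_integrable) auto
  finally show ?thesis by simp
qed

text \<open>Dominated convergence after the scaling has moved \<open>a\<close> and \<open>x\<close>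
  into the argument of \<open>h\<close>. The point is that time 0 is included.\<close>

lemma continuous_on_gauss_avg:
  assumes "continuous_on UNIV h"
  shows "continuous_on ({0..} \<times> UNIV) (\<lambda>(a, x). gauss_avg h a x)"
  unfolding continuous_on_sequentially
proof (intro allI ballI impI)
  fix X :: "nat \<Rightarrow> real \<times> real" and p
  assume X: "(\<forall>n. X n \<in> {0..} \<times> UNIV) \<and> X \<longlonglongrightarrow> p"
  have X1: "(\<lambda>n. fst (X n)) \<longlonglongrightarrow> fst p" and X2: "(\<lambda>n. snd (X n)) \<longlonglongrightarrow> snd p"
    using X by (auto intro: tendsto_intros)
  have "(\<lambda>n. gauss_avg h (fst (X n)) (snd (X n))) \<longlonglongrightarrow> gauss_avg h (fst p) (snd p)"
    unfolding gauss_avg_def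
  proof (rule integral_dominated_convergence[where w = "\<lambda>z. B * std_normal_density z"])
    have "isCont h y" for y using assms by (simp add: continuous_on_eq_continuous_at)
    then show "AE z in lborel. (\<lambda>n. h (snd (X n) + sqrt (fst (X n)) * z) * std_normal_density z)
        \<longlonglongrightarrow> h (snd p + sqrt (fst p) * z) * std_normal_density z"
      by (intro AE_I2 tendsto_mult tendsto_const isCont_tendsto_compose[of _ h]
          tendsto_add X1 X2 tendsto_real_sqrt)
  qed (use gauss_avg_integrand_le in auto)
  then show "((\<lambda>(a, x). gauss_avg h a x) \<circ> X) \<longlonglongrightarrow> (\<lambda>(a, x). gauss_avg h a x) p"
    by (simp add: o_def case_prod_unfold)
qed

text \<open>Fubini and the symmetry of the kernel: the semigroup is self-adjoint. Moving it onto the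
  test function yields conservation of mass and, as time tends to 0, weak convergence.\<close>

lemma heat_ext_dual:
  assumes g: "integrable lborel g" and a: "a > 0"
  shows "integrable lborel (\<lambda>x. heat_ext g a x * h x)"
    and "(\<integral>x. heat_ext g a x * h x \<partial>lborel) = (\<integral>y. g y * gauss_avg h a y \<partial>lborel)"
proof -
  have [measurable]: "g \<in> borel_measurable borel" using integrable_lborel_measurable[OF g] .
  let ?f = "\<lambda>(x, y). h x * (g y * heat_kernel a (x - y))"
  have [measurable]: "(\<lambda>p. heat_kernel a (fst p - snd p)) \<in> borel_measurable (lborel \<Otimes>\<^sub>M lborel)"
    by measurable
  have m: "?f \<in> borel_measurable (lborel \<Otimes>\<^sub>M lborel)"
    unfolding case_prod_unfold by measurable
  have k: "has_bochner_integral lborel (\<lambda>x. heat_kernel a (x - y)) 1" for y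
  proof -
    have "heat_kernel a (x - y) = normal_density y (sqrt a) x" for x
      by (simp add: heat_kernel_def normal_density_def)
    then show ?thesis using a by (simp add: has_bochner_integral_iff)
  qed
  have sym: "heat_kernel a (x - y) = heat_kernel a (y - x)" for x y
    by (simp add: heat_kernel_def normal_density_def power2_commute)
  have inner: "integrable lborel (\<lambda>x. h x * (g y * heat_kernel a (x - y)))" for y
  proof -
    have "integrable lborel (\<lambda>x. heat_kernel a (x - y) * h x)"
      using k h_bdd by (intro integrable_times_bounded) (auto simp: has_bochner_integral_iff)
    then have "integrable lborel (\<lambda>x. g y * (heat_kernel a (x - y) * h x))" by simp
    then show ?thesis by (simp add: mult_ac)
  qed
  have le: "(\<integral>x. norm (h x * (g y * heat_kernel a (x - y))) \<partial>lborel) \<le> B * \<bar>g y\<bar>" for y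
  proof -
    have "(\<integral>x. norm (h x * (g y * heat_kernel a (x - y))) \<partial>lborel)
        \<le> (\<integral>x. B * \<bar>g y\<bar> * heat_kernel a (x - y) \<partial>lborel)"
    proof (rule integral_mono)
      show "integrable lborel (\<lambda>x. B * \<bar>g y\<bar> * heat_kernel a (x - y))"
        using k[of y] by (intro integrable_mult_right) (simp add: has_bochner_integral_iff)
      show "norm (h x * (g y * heat_kernel a (x - y))) \<le> B * \<bar>g y\<bar> * heat_kernel a (x - y)" for x
        using mult_right_mono[OF h_bdd[of x], of "\<bar>g y\<bar> * heat_kernel a (x - y)"]
        by (simp add: abs_mult heat_kernel_nonneg)
    qed (intro integrable_norm inner)
    also have "\<dots> = B * \<bar>g y\<bar>" using k[of y] by (simp add: has_bochner_integral_iff)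
    finally show ?thesis .
  qed
  have "integrable (lborel \<Otimes>\<^sub>M lborel) (\<lambda>(y, x). h x * (g y * heat_kernel a (x - y)))"
  proof (rule lborel_pair.Fubini_integrable)
    show "integrable lborel (\<lambda>y. \<integral>x. norm ((\<lambda>(y, x). h x * (g y * heat_kernel a (x - y))) (y, x)) \<partial>lborel)"
    proof (rule Bochner_Integration.integrable_bound)
      show "integrable lborel (\<lambda>y. B * \<bar>g y\<bar>)" using g by simp
      show "AE y in lborel. norm (\<integral>x. norm ((\<lambda>(y, x). h x * (g y * heat_kernel a (x - y))) (y, x)) \<partial>lborel)
          \<le> norm (B * \<bar>g y\<bar>)"
        using le by (auto simp: abs_of_nonneg intro: order_trans[OF _ abs_ge_self])
    qed measurable
  qed (use inner in auto)
  from lborel_pair.integrable_product_swap[OF this]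
  have F: "integrable (lborel \<Otimes>\<^sub>M lborel) ?f" by (simp only: prod.case)
  have eq: "(\<integral>y. h x * (g y * heat_kernel a (x - y)) \<partial>lborel) = heat_ext g a x * h x" for x
    by (simp add: heat_ext_def mult.commute)
  show "integrable lborel (\<lambda>x. heat_ext g a x * h x)"
    using lborel_pair.integrable_fst[OF F] by (simp only: prod.case eq)
  have inner_eq: "(\<integral>x. ?f (x, y) \<partial>lborel) = g y * gauss_avg h a y" for y
  proof -
    have "(\<integral>x. ?f (x, y) \<partial>lborel) = (\<integral>x. g y * (h x * heat_kernel a (y - x)) \<partial>lborel)"
      by (simp add: sym[of _ y] mult_ac)
    also have "\<dots> = g y * heat_ext h a y"
      by (simp only: integral_mult_right_zero heat_ext_def)
    finally show ?thesis using a by (simp add: heat_ext_eq_gauss_avg)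
  qed
  have "(\<integral>x. heat_ext g a x * h x \<partial>lborel) = (\<integral>x. (\<integral>y. ?f (x, y) \<partial>lborel) \<partial>lborel)"
    by (simp only: prod.case eq)
  also have "\<dots> = (\<integral>y. (\<integral>x. ?f (x, y) \<partial>lborel) \<partial>lborel)"
    using lborel_pair.Fubini_integral[OF F] by simp
  finally show "(\<integral>x. heat_ext g a x * h x \<partial>lborel) = (\<integral>y. g y * gauss_avg h a y \<partial>lborel)"
    by (simp only: inner_eq)
qed

end

text \<open>The initial values are attained in \<open>L\<^sup>1\<close> only. From any time \<open>s' > s\<close> on, \<open>z\<close> is dominated by the
  heat evolution of its positive part at \<open>s'\<close>, whose supremum is at most a multiple of the \<open>L\<^sup>1\<close> norm.\<close>

lemma heat_max_principle_L1:
  fixes z :: "real \<Rightarrow> real \<Rightarrow> real"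
  assumes pr: "p \<le> r"
    and cont: "continuous_on ({s<..e} \<times> {p..r}) (\<lambda>(t, x). z t x)"
    and heat: "\<And>t x. s < t \<Longrightarrow> t \<le> e \<Longrightarrow> p < x \<Longrightarrow> x < r \<Longrightarrow> heat_at z t x"
    and lat: "\<And>t. t \<in> {s<..e} \<Longrightarrow> z t p \<le> 0" "\<And>t. t \<in> {s<..e} \<Longrightarrow> z t r \<le> 0"
    and init: "((\<lambda>t. \<integral>x. indicator {p..r} x * max 0 (z t x) \<partial>lborel) \<longlongrightarrow> 0) (at_right s)"
    and tx: "t \<in> {s<..e}" "x \<in> {p..r}"
  shows "z t x \<le> 0"
proof -
  define I where "I = (\<lambda>t. \<integral>x. indicator {p..r} x * max 0 (z t x) \<partial>lborel)"
  have "z t x \<le> I s' / sqrt (2 * pi * (t - s'))" if s': "s < s'" "s' < t" for s'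
  proof -
    \<comment> \<open>Clamping the argument extends the positive part continuously to the line. As
      \<open>z s'\<close> is nonpositive at \<open>p\<close> and \<open>r\<close>, the extension
      vanishes outside \<open>{p..r}\<close> and is integrable.\<close>
    define g where "g y = max 0 (z s' (max p (min r y)))" for y
    have zc: "continuous_on {p..r} (z s')"
    proof -
      have "continuous_on {p..r} ((\<lambda>(t, x). z t x) \<circ> (\<lambda>x. (s', x)))"
        using s' tx by (intro continuous_on_compose continuous_intros continuous_on_subset[OF cont]) auto
      then show ?thesis by (simp add: o_def)
    qed
    have gc: "continuous_on UNIV g" unfolding g_def
      using pr by (intro continuous_intros continuous_on_compose2[OF zc]) auto
    have g_eq: "g y = indicator {p..r} y * max 0 (z s' y)" for y
      using lat[of s'] s' tx pr by (auto simp: g_def indicator_def max_def min_def)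
    obtain B where "\<forall>v \<in> z s' ` {p..r}. norm v \<le> B"
      using compact_imp_bounded[OF compact_continuous_image[OF zc compact_Icc]]
      unfolding bounded_iff ..
    then have B: "\<bar>z s' y\<bar> \<le> B" if "y \<in> {p..r}" for y using that by simp
    have gB: "\<bar>g y\<bar> \<le> B" for y
      unfolding g_def using B[of "max p (min r y)"] pr by auto
    have g_meas[measurable]: "g \<in> borel_measurable borel"
      using gc by (rule borel_measurable_continuous_onI)
    have "continuous_on {p..r} (\<lambda>y. max 0 (z s' y))" using zc by (intro continuous_intros)
    then have g_int: "integrable lborel g"
      using borel_integrable_atLeastAtMost'[of p r "\<lambda>y. max 0 (z s' y)"]
      by (simp add: set_integrable_def g_eq[abs_def])
    have g_nn: "0 \<le> g y" for y by (simp add: g_def)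
    \<comment> \<open>The comparison function is nonnegative, hence \<open>W \<le> 0\<close> on the
      lateral sides, and it equals the positive part of \<open>z\<close> at time \<open>s'\<close>.
      The form \<open>gauss_avg\<close> makes \<open>W\<close> continuous down to
      \<open>s'\<close>.\<close>
    define W where "W \<tau> y = z \<tau> y - gauss_avg g (\<tau> - s') y" for \<tau> y
    have "W t x \<le> 0"
    proof (rule heat_max_principle[of s' t p r W])
      have "continuous_on ({s'..t} \<times> {p..r}) ((\<lambda>(a, x). gauss_avg g a x) \<circ> (\<lambda>(\<tau>, y). (\<tau> - s', y)))"
        by (intro continuous_on_compose continuous_on_subset[OF continuous_on_gauss_avg[OF g_meas gB gc]])
           (auto simp: case_prod_unfold intro!: continuous_intros)
      moreover have "continuous_on ({s'..t} \<times> {p..r}) (\<lambda>(t, x). z t x)"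
        using s' tx by (intro continuous_on_subset[OF cont]) auto
      ultimately show "continuous_on ({s'..t} \<times> {p..r}) (\<lambda>(t, x). W t x)"
        unfolding W_def by (auto simp: case_prod_unfold o_def intro!: continuous_intros)
    next
      fix \<tau> y assume \<tau>: "s' < \<tau>" "\<tau> \<le> t" "p < y" "y < r"
      have "heat_at (\<lambda>\<tau> y. heat_ext g (\<tau> + - s') (y + 0)) \<tau> y"
        using \<tau> by (intro heat_at_shift heat_ext_heat_at g_int) auto
      moreover have "heat_at z \<tau> y" using \<tau> s' tx by (intro heat) auto
      ultimately have H: "heat_at (\<lambda>\<tau> y. z \<tau> y - heat_ext g (\<tau> - s') y) \<tau> y"
        using heat_at_diff by fastforce
      have "\<forall>\<^sub>F t in nhds \<tau>. t \<in> {s'<..}" using \<tau> by (intro eventually_nhds_in_open) auto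
      then have ev: "\<forall>\<^sub>F t in nhds \<tau>. z t y - heat_ext g (t - s') y = W t y"
        by eventually_elim (simp add: W_def heat_ext_eq_gauss_avg)
      have "(\<lambda>y. z \<tau> y - heat_ext g (\<tau> - s') y) = W \<tau>"
        using \<tau> by (auto simp: W_def heat_ext_eq_gauss_avg)
      then show "heat_at W \<tau> y"
        using H DERIV_cong_ev[OF refl ev refl] unfolding heat_at_def by simp
    next
      fix \<tau> assume "\<tau> \<in> {s'..t}"
      then have \<tau>: "\<tau> \<in> {s<..e}" using s' tx by simp
      have nn: "0 \<le> gauss_avg g (\<tau> - s') y" for y by (rule gauss_avg_nonneg[OF g_nn])
      show "W \<tau> p \<le> 0" using lat(1)[OF \<tau>] nn[of p] unfolding W_def by linarith
      show "W \<tau> r \<le> 0" using lat(2)[OF \<tau>] nn[of r] unfolding W_def by linarith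
    next
      fix y assume "y \<in> {p..r}"
      then show "W s' y \<le> 0" by (simp add: W_def g_eq)
    qed (use s' tx in auto)
    then have "z t x \<le> heat_ext g (t - s') x"
      using s' by (simp add: W_def heat_ext_eq_gauss_avg)
    also have "\<dots> \<le> (\<integral>y. \<bar>g y\<bar> \<partial>lborel) / sqrt (2 * pi * (t - s'))"
      using heat_ext_le[OF g_int, of "t - s'" x] s' by auto
    also have "(\<integral>y. \<bar>g y\<bar> \<partial>lborel) = I s'"
      using g_nn by (simp add: I_def g_eq[symmetric])
    finally show ?thesis .
  qed
  \<comment> \<open>As \<open>s'\<close> decreases to \<open>s\<close>, the numerator tends to 0
    while \<open>t - s'\<close> stays away from 0.\<close>
  then have "\<forall>\<^sub>F s' in at_right s. z t x \<le> I s' / sqrt (2 * pi * (t - s'))"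
    using tx eventually_at_right_real[of s t] by (auto elim: eventually_mono)
  moreover have "((\<lambda>s'. I s' / sqrt (2 * pi * (t - s'))) \<longlongrightarrow> 0 / sqrt (2 * pi * (t - s))) (at_right s)"
    using tx by (intro tendsto_intros init[folded I_def]) auto
  ultimately show ?thesis
    using tendsto_lowerbound[of _ _ "at_right s" "z t x"] by fastforce
qed

section \<open>Joint continuity of pointwise solutions\<close>

text \<open>Natural numbers as constants: Baire's theorem needs a countable family of sets of
  times.\<close>

definition lip_at :: "(real \<Rightarrow> real \<Rightarrow> real) \<Rightarrow> real set \<Rightarrow> real \<Rightarrow> nat \<Rightarrow> bool" where
  "lip_at v I t n \<longleftrightarrow> (\<forall>x\<in>I. \<forall>y\<in>I. \<bar>v t x - v t y\<bar> \<le> real n * \<bar>x - y\<bar>)"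

text \<open>Everything here is separate in time and space, apart from the \<open>L\<^sup>1\<close>
  clause. That clause is one-sided because barriers are run forward from the time
  \<open>t\<close>.\<close>

definition separate_heat :: "(real \<Rightarrow> real \<Rightarrow> real) \<Rightarrow> real \<Rightarrow> real \<Rightarrow> real \<Rightarrow> bool" where
  "separate_heat v T p r \<longleftrightarrow> p < r \<and>
     (\<forall>x\<in>{p..r}. continuous_on {0<..<T} (\<lambda>t. v t x)) \<and>
     (\<forall>t\<in>{0<..<T}. \<exists>n. lip_at v {p..r} t n) \<and>
     (\<forall>t\<in>{0<..<T}. \<forall>x\<in>{p<..<r}. heat_at v t x) \<and>
     (\<forall>t\<in>{0<..<T}. ((\<lambda>s. \<integral>x. indicator {p..r} x * \<bar>v s x - v t x\<bar> \<partial>lborel) \<longlongrightarrow> 0) (at_right t))"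

lemma separate_heatD:
  assumes "separate_heat v T p r"
  shows "p < r" "\<And>x. x \<in> {p..r} \<Longrightarrow> continuous_on {0<..<T} (\<lambda>t. v t x)"
    "\<And>t. t \<in> {0<..<T} \<Longrightarrow> \<exists>n. lip_at v {p..r} t n"
    "\<And>t x. t \<in> {0<..<T} \<Longrightarrow> x \<in> {p<..<r} \<Longrightarrow> heat_at v t x"
    "\<And>t. t \<in> {0<..<T} \<Longrightarrow>
       ((\<lambda>s. \<integral>x. indicator {p..r} x * \<bar>v s x - v t x\<bar> \<partial>lborel) \<longlongrightarrow> 0) (at_right t)"
  using assms unfolding separate_heat_def by auto

lemma lip_at_minus: "lip_at (\<lambda>t x. - v t x) I t n = lip_at v I t n"
proof -
  have "\<bar>- v t x - - v t y\<bar> = \<bar>v t x - v t y\<bar>" for x y by simp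
  then show ?thesis unfolding lip_at_def by simp
qed

lemma separate_heat_minus:
  assumes "separate_heat v T p r"
  shows "separate_heat (\<lambda>t x. - v t x) T p r"
proof -
  have "\<bar>- v s x - - v t x\<bar> = \<bar>v s x - v t x\<bar>" for s t x by simp
  then show ?thesis
    using assms unfolding separate_heat_def lip_at_minus
    by (simp add: continuous_on_minus heat_at_minus)
qed

lemma lip_at_continuous_on:
  assumes "lip_at v I t n"
  shows "continuous_on I (v t)"
proof -
  have "(real n)-lipschitz_on I (v t)"
    using assms unfolding lip_at_def lipschitz_on_def by (auto simp: dist_real_def)
  then show ?thesis by (rule lipschitz_on_continuous_on)
qed

lemma continuous_on_times_local:
  fixes f :: "real \<times> real \<Rightarrow> real"
  assumes "\<And>t. t \<in> S \<Longrightarrow> \<exists>d>0. continuous_on ({t - d<..<t + d} \<times> I) f"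
  shows "continuous_on (S \<times> I) f"
  unfolding continuous_on_eq_continuous_within
proof
  fix q assume q: "q \<in> S \<times> I"
  then obtain d where d: "d > 0" "continuous_on ({fst q - d<..<fst q + d} \<times> I) f"
    using assms[of "fst q"] by auto
  define V where "V = {fst q - d<..<fst q + d} \<times> (UNIV :: real set)"
  have "continuous (at q within {fst q - d<..<fst q + d} \<times> I) f"
    using d q by (auto simp: continuous_on_eq_continuous_within)
  moreover have "at q within (S \<times> I \<inter> V) = at q within (S \<times> I)"
    using d q by (intro at_within_nhd[of _ V]) (auto simp: V_def mem_Times_iff intro!: open_Times)
  moreover have "S \<times> I \<inter> V \<subseteq> {fst q - d<..<fst q + d} \<times> I" by (auto simp: V_def)
  ultimately show "continuous (at q within S \<times> I) f"
    using continuous_within_subset by metis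
qed

text \<open>Comparison with the parabola of \<open>heat_at_parabola\<close>, an exact solution that
  is at least its initial profile at all later times. The function \<open>v\<close> is jointly
  continuous only after \<open>\<alpha>\<close>, so the initial inequality is used in
  \<open>L\<^sup>1\<close>.\<close>

lemma barrier_bound:
  assumes v: "separate_heat v T p r" and \<alpha>: "0 < \<alpha>" "\<alpha> < s" "s < T"
    and cont: "continuous_on ({\<alpha><..s} \<times> {p..r}) (\<lambda>(t, x). v t x)"
    and C: "0 \<le> C"
    and init: "\<And>x. x \<in> {p..r} \<Longrightarrow> v \<alpha> x \<le> D + C * (x - x0)\<^sup>2"
    and lat: "\<And>\<tau>. \<tau> \<in> {\<alpha><..s} \<Longrightarrow> v \<tau> p \<le> D + C * (p - x0)\<^sup>2"
      "\<And>\<tau>. \<tau> \<in> {\<alpha><..s} \<Longrightarrow> v \<tau> r \<le> D + C * (r - x0)\<^sup>2"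
    and x: "x \<in> {p..r}"
  shows "v s x \<le> D + C * ((x - x0)\<^sup>2 + (s - \<alpha>))"
proof -
  note vD = separate_heatD[OF v]
  define b where "b t y = C * ((y - x0)\<^sup>2 + (t - \<alpha>)) + D" for t y
  define z where "z t y = v t y - b t y" for t y
  have b_mono: "D + C * (y - x0)\<^sup>2 \<le> b t y" if "\<alpha> \<le> t" for t y
    using C that by (simp add: b_def distrib_left)
  have "z s x \<le> 0"
  proof (rule heat_max_principle_L1[of p r \<alpha> s z])
    show "continuous_on ({\<alpha><..s} \<times> {p..r}) (\<lambda>(t, x). z t x)"
      using cont unfolding z_def b_def by (auto simp: case_prod_unfold intro!: continuous_intros)
    show "heat_at z t y" if "\<alpha> < t" "t \<le> s" "p < y" "y < r" for t y
      unfolding z_def[abs_def] b_def using that \<alpha> by (intro heat_at_diff heat_at_parabola vD(4)) auto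
    show "z t p \<le> 0" "z t r \<le> 0" if "t \<in> {\<alpha><..s}" for t
      using lat[OF that] b_mono[of t p] b_mono[of t r] that by (auto simp: z_def)
    have int: "integrable lborel (\<lambda>y. indicator {p..r} y * h y)" if "continuous_on {p..r} h" for h :: "real \<Rightarrow> real"
      using borel_integrable_atLeastAtMost'[OF that] by (simp add: set_integrable_def)
    have vc: "continuous_on {p..r} (v t)" if "0 < t" "t < T" for t
      using vD(3)[of t] that lip_at_continuous_on by auto
    have "\<forall>\<^sub>F t in at_right \<alpha>. t \<in> {\<alpha><..<s}" using \<alpha> by (intro eventually_at_right_real) simp
    then have ev: "\<forall>\<^sub>F t in at_right \<alpha>. norm (\<integral>y. indicator {p..r} y * max 0 (z t y) \<partial>lborel)
        \<le> (\<integral>y. indicator {p..r} y * \<bar>v t y - v \<alpha> y\<bar> \<partial>lborel)"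
    proof eventually_elim
      fix t assume t: "t \<in> {\<alpha><..<s}"
      have zc: "continuous_on {p..r} (z t)" unfolding z_def b_def
        using t \<alpha> by (intro continuous_intros vc) auto
      have "(\<integral>y. indicator {p..r} y * max 0 (z t y) \<partial>lborel)
          \<le> (\<integral>y. indicator {p..r} y * \<bar>v t y - v \<alpha> y\<bar> \<partial>lborel)"
      proof (intro integral_mono int)
        \<comment> \<open>Since \<open>v \<alpha> y\<close> already lies below the barrier, the
          excess of \<open>v t y\<close> over it is at most the change of \<open>v\<close> since
          \<open>\<alpha>\<close>.\<close>
        show "indicator {p..r} y * max 0 (z t y) \<le> indicator {p..r} y * \<bar>v t y - v \<alpha> y\<bar>" for y
          using b_mono[of t y] init[of y] t by (auto simp: z_def indicator_def)
        show "continuous_on {p..r} (\<lambda>x. \<bar>v t x - v \<alpha> x\<bar>)" using t \<alpha> by (intro continuous_intros vc) auto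
      qed (intro continuous_intros zc)
      moreover have "0 \<le> (\<integral>y. indicator {p..r} y * max 0 (z t y) \<partial>lborel)" by simp
      ultimately show "norm (\<integral>y. indicator {p..r} y * max 0 (z t y) \<partial>lborel)
          \<le> (\<integral>y. indicator {p..r} y * \<bar>v t y - v \<alpha> y\<bar> \<partial>lborel)" by simp
    qed
    show "((\<lambda>t. \<integral>y. indicator {p..r} y * max 0 (z t y) \<partial>lborel) \<longlongrightarrow> 0) (at_right \<alpha>)"
      using \<alpha> by (intro Lim_null_comparison[OF ev] vD(5)) auto
  qed (use vD(1) \<alpha> x in auto)
  then show ?thesis by (simp add: z_def b_def)
qed

text \<open>By the maximum principle for \<open>v s x - v (s + \<tau>) x\<close>, the family \<open>v s\<close> is uniformly Cauchy as \<open>s\<close>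
  increases to \<open>t\<close>.\<close>

lemma left_limit_uniform:
  assumes v: "separate_heat v T p r" and t: "0 < s0" "s0 < t" "t < T"
    and cont: "continuous_on ({s0..<t} \<times> {p..r}) (\<lambda>(t, x). v t x)" and \<eta>: "0 < \<eta>"
  shows "\<exists>\<delta>>0. \<forall>s\<in>{t - \<delta><..<t}. \<forall>x\<in>{p..r}. v s x \<le> v t x + \<eta>"
proof -
  note vD = separate_heatD[OF v]
  \<comment> \<open>Uniform continuity needs a compact rectangle on which \<open>v\<close> is
    jointly continuous; time \<open>t\<close> has to be left out, and the midpoint does so.\<close>
  define e where "e = (s0 + t) / 2"
  have e: "s0 < e" "e < t" using t by (auto simp: e_def)
  have "uniformly_continuous_on ({s0..e} \<times> {p..r}) (\<lambda>(t, x). v t x)"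
    using e by (intro compact_uniformly_continuous compact_Times compact_Icc continuous_on_subset[OF cont]) auto
  then obtain d1 where d1: "d1 > 0"
    "\<And>q q'. q \<in> {s0..e} \<times> {p..r} \<Longrightarrow> q' \<in> {s0..e} \<times> {p..r} \<Longrightarrow> dist q' q < d1 \<Longrightarrow>
      dist (case q' of (t, x) \<Rightarrow> v t x) (case q of (t, x) \<Rightarrow> v t x) < \<eta>"
    unfolding uniformly_continuous_on_def using \<eta> by metis
  have init: "v s0 x \<le> v (s0 + \<tau>) x + \<eta>" if "0 < \<tau>" "\<tau> < d1" "\<tau> < e - s0" "x \<in> {p..r}" for \<tau> x
    using d1(2)[of "(s0, x)" "(s0 + \<tau>, x)"] that e by (auto simp: dist_Pair_Pair dist_real_def)
  have lat: "\<exists>d>0. \<forall>s\<in>{s0..t}. \<forall>s'\<in>{s0..t}. \<bar>s' - s\<bar> < d \<longrightarrow> v s y \<le> v s' y + \<eta>" if "y \<in> {p..r}" for y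
  proof -
    have "uniformly_continuous_on {s0..t} (\<lambda>t. v t y)"
      using t that by (intro compact_uniformly_continuous compact_Icc continuous_on_subset[OF vD(2)]) auto
    then obtain d where d: "d > 0"
      "\<And>s s'. s \<in> {s0..t} \<Longrightarrow> s' \<in> {s0..t} \<Longrightarrow> dist s' s < d \<Longrightarrow> dist (v s' y) (v s y) < \<eta>"
      unfolding uniformly_continuous_on_def using \<eta> by metis
    show ?thesis
    proof (intro exI[of _ d] conjI ballI impI d(1))
      fix s s' assume "s \<in> {s0..t}" "s' \<in> {s0..t}" "\<bar>s' - s\<bar> < d"
      then show "v s y \<le> v s' y + \<eta>" using d(2)[of s s'] by (simp add: dist_real_def)
    qed
  qed
  obtain d2 where d2: "d2 > 0"
    "\<forall>s\<in>{s0..t}. \<forall>s'\<in>{s0..t}. \<bar>s' - s\<bar> < d2 \<longrightarrow> v s p \<le> v s' p + \<eta>"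
    using lat[of p] vD(1) by auto
  obtain d3 where d3: "d3 > 0"
    "\<forall>s\<in>{s0..t}. \<forall>s'\<in>{s0..t}. \<bar>s' - s\<bar> < d3 \<longrightarrow> v s r \<le> v s' r + \<eta>"
    using lat[of r] vD(1) by auto
  define \<delta> where "\<delta> = Min {d1, e - s0, d2, d3}"
  have \<delta>: "\<delta> > 0" "\<delta> \<le> d1" "\<delta> \<le> e - s0" "\<delta> \<le> d2" "\<delta> \<le> d3"
    using d1 d2 d3 e by (auto simp: \<delta>_def)
  have shift: "v s x - v (s + \<tau>) x \<le> \<eta>"
    if \<tau>: "0 < \<tau>" "\<tau> < \<delta>" and s: "s0 \<le> s" "s + \<tau> < t" and x: "x \<in> {p..r}" for s \<tau> x
  proof (rule heat_max_principle[of s0 s p r "\<lambda>s x. v s x - v (s + \<tau>) x"])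
    have "continuous_on ({s0..s} \<times> {p..r}) ((\<lambda>(t, x). v t x) \<circ> (\<lambda>(a, y). (a + \<tau>, y)))"
      using s \<tau> by (intro continuous_on_compose continuous_on_subset[OF cont])
         (auto simp: case_prod_unfold intro!: continuous_intros)
    moreover have "continuous_on ({s0..s} \<times> {p..r}) (\<lambda>(t, x). v t x)"
      using s \<tau> by (intro continuous_on_subset[OF cont]) auto
    ultimately show "continuous_on ({s0..s} \<times> {p..r}) (\<lambda>(t, x). v t x - v (t + \<tau>) x)"
      by (auto simp: case_prod_unfold o_def intro!: continuous_intros)
    fix a y assume a: "s0 < a" "a \<le> s" "p < y" "y < r"
    have "heat_at (\<lambda>t x. v (t + \<tau>) (x + 0)) a y"
      using a s \<tau> t by (intro heat_at_shift vD(4)) auto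
    then show "heat_at (\<lambda>s x. v s x - v (s + \<tau>) x) a y"
      using a s \<tau> t by (intro heat_at_diff vD(4)) auto
  next
    fix a assume a: "a \<in> {s0..s}"
    then show "v a p - v (a + \<tau>) p \<le> \<eta>" "v a r - v (a + \<tau>) r \<le> \<eta>"
      using d2(2)[rule_format, of a "a + \<tau>"] d3(2)[rule_format, of a "a + \<tau>"] s \<tau> \<delta> by auto
  next
    fix y assume y: "y \<in> {p..r}"
    then show "v s0 y - v (s0 + \<tau>) y \<le> \<eta>" using init[of \<tau> y] \<tau> \<delta> by auto
  qed (use s x in auto)
  define \<delta>' where "\<delta>' = min \<delta> (t - s0)"
  show ?thesis
  proof (intro exI[of _ \<delta>'] conjI ballI)
    show "\<delta>' > 0" using \<delta> t by (simp add: \<delta>'_def)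
    fix s x assume s: "s \<in> {t - \<delta>'<..<t}" and x: "x \<in> {p..r}"
    \<comment> \<open>In \<open>shift\<close> the later time can now tend to \<open>t\<close> for
      fixed \<open>x\<close>, and the bound keeps its uniformity in \<open>x\<close>.\<close>
    have "isCont (\<lambda>t. v t x) t"
      using vD(2)[OF x] t by (auto simp: continuous_on_eq_continuous_at)
    then have "((\<lambda>t. v t x) \<longlongrightarrow> v t x) (at_left t)"
      unfolding isCont_def by (rule tendsto_within_subset) simp
    moreover have "\<forall>\<^sub>F s' in at_left t. v s x - \<eta> \<le> v s' x"
    proof -
      have "\<forall>\<^sub>F s' in at_left t. s' \<in> {s<..<t}" using s by (intro eventually_at_left_real) simp
      then show ?thesis
      proof eventually_elim
        fix s' assume "s' \<in> {s<..<t}"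
        then show "v s x - \<eta> \<le> v s' x"
          using shift[of "s' - s" s x] s x by (auto simp: \<delta>'_def min_def split: if_splits)
      qed
    qed
    ultimately have "v s x - \<eta> \<le> v t x"
      by (intro tendsto_lowerbound[of _ _ "at_left t"]) auto
    then show "v s x \<le> v t x + \<eta>" by simp
  qed
qed

text \<open>\<open>K\<close> plays the role of the set of times at which joint continuity fails. The value at \<open>(s, x)\<close> is
  controlled by a parabolic barrier started at the last time in \<open>K\<close> before \<open>s\<close>; if \<open>K\<close> does not
  accumulate at \<open>t\<close> from the left, then times before \<open>t\<close> are covered by \<open>left_limit_uniform\<close>.\<close>

lemma bad_time_usc:
  assumes v: "separate_heat v T p r" and J: "{a<..<b} \<subseteq> {0<..<T}"
    and reg: "\<And>\<tau>. \<tau> \<in> {a<..<b} - K \<Longrightarrow> \<exists>d>0. continuous_on ({\<tau> - d<..<\<tau> + d} \<times> {p..r}) (\<lambda>(t, x). v t x)"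
    and clo: "\<And>a' b'. a < a' \<Longrightarrow> b' < b \<Longrightarrow> closed (K \<inter> {a'..b'})"
    and lip: "\<And>k. k \<in> K \<inter> {a<..<b} \<Longrightarrow> lip_at v {p..r} k n"
    and t: "t \<in> K \<inter> {a<..<b}" and x0: "x0 \<in> {p..r}" and \<epsilon>: "0 < \<epsilon>"
  shows "\<exists>\<delta>>0. \<forall>s\<in>{t - \<delta><..<t + \<delta>}. \<forall>x\<in>{p..r}. \<bar>x - x0\<bar> < \<delta> \<longrightarrow> v s x \<le> v t x0 + \<epsilon>"
proof -
  note vD = separate_heatD[OF v]
  have contJ: "continuous_on (S \<times> {p..r}) (\<lambda>(t, x). v t x)" if "S \<subseteq> {a<..<b} - K" for S
    using that by (intro continuous_on_times_local reg) auto
  \<comment> \<open>The worst case spends \<open>\<eta> / 2\<close> on passing from \<open>t\<close>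
    to the starting time of the barrier, and \<open>\<eta>\<close> each on the slack of the barrier,
    its quadratic part and the elapsed time.\<close>
  define \<eta> where "\<eta> = \<epsilon> / 4"
  have \<eta>: "0 < \<eta>" using \<epsilon> by (simp add: \<eta>_def)
  define M where "M = \<bar>v t p\<bar> + \<bar>v t r\<bar> + \<bar>v t x0\<bar> + \<eta>"
  \<comment> \<open>The first summand makes the parabola plus \<open>\<eta>\<close> dominate the
    cone \<open>real n * \<bar>y - x0\<bar>\<close> (a completed square, see \<open>Cn\<close>). The
    other two lift it above the lateral values. If \<open>x0\<close> is an endpoint, its summand is
    a division by zero, hence 0, and continuity in time handles that side.\<close>
  define C where "C = (real n)\<^sup>2 / (4 * \<eta>) + 2 * M / (p - x0)\<^sup>2 + 2 * M / (r - x0)\<^sup>2"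
  have M: "0 \<le> M" using \<eta> by (simp add: M_def)
  have C0: "0 \<le> C" using \<eta> M by (simp add: C_def)
  have Cp: "2 * M \<le> C * (y - x0)\<^sup>2" if "y \<in> {p, r}" "y \<noteq> x0" for y
  proof -
    have "2 * M / (y - x0)\<^sup>2 \<le> C" using that \<eta> M by (auto simp: C_def)
    then have "2 * M / (y - x0)\<^sup>2 * (y - x0)\<^sup>2 \<le> C * (y - x0)\<^sup>2" by (intro mult_right_mono) auto
    then show ?thesis using that by simp
  qed
  have Cn: "real n * d \<le> \<eta> + C * d\<^sup>2" for d
  proof -
    have "0 \<le> (real n * d / 2 - \<eta>)\<^sup>2" by simp
    then have "real n * d * \<eta> \<le> \<eta>\<^sup>2 + (real n)\<^sup>2 * d\<^sup>2 / 4"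
      by (simp add: power2_eq_square algebra_simps)
    then have "real n * d \<le> \<eta> + (real n)\<^sup>2 / (4 * \<eta>) * d\<^sup>2"
      using \<eta> by (simp add: field_simps power2_eq_square)
    also have "\<dots> \<le> \<eta> + C * d\<^sup>2"
      using \<eta> M by (intro add_left_mono mult_right_mono) (auto simp: C_def)
    finally show ?thesis .
  qed
  have near: "\<exists>d>0. \<forall>\<tau>. \<bar>\<tau> - t\<bar> < d \<longrightarrow> \<bar>v \<tau> y - v t y\<bar> \<le> \<eta> / 2" if "y \<in> {p..r}" for y
  proof -
    have "isCont (\<lambda>t. v t y) t"
      using vD(2)[OF that] t J by (auto simp: continuous_on_eq_continuous_at)
    then obtain d where d: "d > 0" "\<And>\<tau>. dist \<tau> t < d \<Longrightarrow> dist (v \<tau> y) (v t y) < \<eta> / 2"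
      unfolding continuous_at_eps_delta using half_gt_zero[OF \<eta>] by (metis dist_real_def)
    then show ?thesis by (intro exI[of _ d]) (force simp: dist_real_def)
  qed
  obtain d1 d2 d3 where d: "d1 > 0" "d2 > 0" "d3 > 0"
    and near1: "\<And>\<tau>. \<bar>\<tau> - t\<bar> < d1 \<Longrightarrow> \<bar>v \<tau> p - v t p\<bar> \<le> \<eta> / 2"
    and near2: "\<And>\<tau>. \<bar>\<tau> - t\<bar> < d2 \<Longrightarrow> \<bar>v \<tau> r - v t r\<bar> \<le> \<eta> / 2"
    and near3: "\<And>\<tau>. \<bar>\<tau> - t\<bar> < d3 \<Longrightarrow> \<bar>v \<tau> x0 - v t x0\<bar> \<le> \<eta> / 2"
    using near[of p] near[of r] near[OF x0] vD(1) x0 by (metis atLeastAtMost_iff order.refl less_imp_le)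
  have n1: "v \<tau> p \<le> v t p + \<eta> / 2" if "\<bar>\<tau> - t\<bar> < d1" for \<tau>
    using near1[OF that] unfolding abs_le_iff by linarith
  have n2: "v \<tau> r \<le> v t r + \<eta> / 2" if "\<bar>\<tau> - t\<bar> < d2" for \<tau>
    using near2[OF that] unfolding abs_le_iff by linarith
  have n3: "v \<tau> x0 \<le> v t x0 + \<eta> / 2" "v t x0 - \<eta> / 2 \<le> v \<tau> x0" if "\<bar>\<tau> - t\<bar> < d3" for \<tau>
    using near3[OF that] unfolding abs_le_iff by linarith+
  \<comment> \<open>The starting time \<open>\<alpha>\<close> and \<open>s\<close> both lie within
    \<open>\<delta>0\<close> of \<open>t\<close>. The last entry therefore bounds \<open>C\<close>
    times the elapsed time by \<open>\<eta>\<close>.\<close>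
  define \<delta>0 where "\<delta>0 = Min {d1, d2, d3, t - a, b - t, \<eta> / (2 * (C + 1))}"
  have \<delta>0: "\<delta>0 > 0" "\<delta>0 \<le> d1" "\<delta>0 \<le> d2" "\<delta>0 \<le> d3" "\<delta>0 \<le> t - a" "\<delta>0 \<le> b - t" "\<delta>0 \<le> \<eta> / (2 * (C + 1))"
    using d t \<eta> C0 by (auto simp: \<delta>0_def)
  have C\<delta>0: "C * (2 * \<delta>0) \<le> \<eta>"
  proof -
    have "C * (2 * \<delta>0) \<le> (C + 1) * (2 * (\<eta> / (2 * (C + 1))))"
      using \<delta>0 C0 by (intro mult_mono) auto
    also have "\<dots> = \<eta>" using C0 by (simp add: field_simps)
    finally show ?thesis .
  qed
  define \<rho> where "\<rho> = Min {1, \<eta> / (C + 1), \<eta> / (real n + 1)}"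
  have \<rho>: "\<rho> > 0" "\<rho> \<le> 1" "\<rho> \<le> \<eta> / (C + 1)" "\<rho> \<le> \<eta> / (real n + 1)"
    using \<eta> C0 by (auto simp: \<rho>_def add_nonneg_pos)
  have C\<rho>: "C * (x - x0)\<^sup>2 \<le> \<eta>" "real n * \<bar>x - x0\<bar> \<le> \<eta>" if "\<bar>x - x0\<bar> < \<rho>" for x
  proof -
    have "(x - x0)\<^sup>2 = \<bar>x - x0\<bar> * \<bar>x - x0\<bar>" by (simp add: power2_eq_square)
    also have "\<dots> \<le> \<rho> * 1" using that \<rho> by (intro mult_mono) auto
    finally have "C * (x - x0)\<^sup>2 \<le> (C + 1) * (\<eta> / (C + 1))"
      using \<rho> C0 by (intro mult_mono) auto
    then show "C * (x - x0)\<^sup>2 \<le> \<eta>" using C0 by simp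
    have "real n * \<bar>x - x0\<bar> \<le> (real n + 1) * (\<eta> / (real n + 1))"
      using that \<rho> by (intro mult_mono) auto
    then show "real n * \<bar>x - x0\<bar> \<le> \<eta>" by simp
  qed
  have lipx: "v k x \<le> v k x0 + real n * \<bar>x - x0\<bar>" if "k \<in> K \<inter> {a<..<b}" "x \<in> {p..r}" for k x
    using lip[OF that(1)] that(2) x0 unfolding lip_at_def by (smt (verit))
  have main: "v s x \<le> v t x0 + \<epsilon>"
    if k: "k \<in> K" "t - \<delta>0 < k" "k \<le> s" and s: "s < t + \<delta>0" and x: "x \<in> {p..r}" "\<bar>x - x0\<bar> < \<rho>" for k s x
  proof -
    have "closed (K \<inter> {k..s})" using k s \<delta>0 by (intro clo) auto
    then have "compact (K \<inter> {k..s})"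
      using compact_Int_closed[OF compact_Icc[of k s]] by (metis Int_assoc Int_absorb inf_commute)
    moreover have "K \<inter> {k..s} \<noteq> {}" using k by auto
    ultimately obtain \<alpha> where \<alpha>: "\<alpha> \<in> K \<inter> {k..s}" "\<And>y. y \<in> K \<inter> {k..s} \<Longrightarrow> y \<le> \<alpha>"
      using compact_attains_sup by metis
    have \<alpha>J: "\<alpha> \<in> K \<inter> {a<..<b}" "\<bar>\<alpha> - t\<bar> < \<delta>0" using \<alpha>(1) k s \<delta>0 by auto
    have \<alpha>x: "v \<alpha> x0 \<le> v t x0 + \<eta> / 2" "v t x0 - \<eta> / 2 \<le> v \<alpha> x0"
      using n3[of \<alpha>] \<alpha>J(2) \<delta>0(4) by linarith+
    show ?thesis
    proof (cases "\<alpha> = s")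
      case True
      then show ?thesis using lipx[OF \<alpha>J(1) x(1)] \<alpha>x C\<rho>(2)[OF x(2)] \<eta> by (simp add: \<eta>_def)
    next
      case False
      then have "\<alpha> < s" using \<alpha> by auto
      have "s < b" "a < \<alpha>" using s \<delta>0 \<alpha>J(1) by auto
      moreover from this have "s \<in> {a<..<b}" "\<alpha> \<in> {a<..<b}" using \<open>\<alpha> < s\<close> by auto
      ultimately have sJ: "s < b" "s < T" "0 < \<alpha>" "a < \<alpha>" using J by (auto dest: subsetD)
      have "v s x \<le> (v \<alpha> x0 + \<eta>) + C * ((x - x0)\<^sup>2 + (s - \<alpha>))"
      proof (rule barrier_bound[OF v \<open>0 < \<alpha>\<close> \<open>\<alpha> < s\<close> \<open>s < T\<close> _ C0 _ _ _ x(1)])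
        show "continuous_on ({\<alpha><..s} \<times> {p..r}) (\<lambda>(t, x). v t x)"
        proof (intro contJ subsetI)
          fix \<tau> assume \<tau>: "\<tau> \<in> {\<alpha><..s}"
          then have "\<tau> \<notin> K" using \<alpha>(1) \<alpha>(2)[of \<tau>] by auto
          then show "\<tau> \<in> {a<..<b} - K" using \<tau> sJ by auto
        qed
        show "v \<alpha> y \<le> v \<alpha> x0 + \<eta> + C * (y - x0)\<^sup>2" if "y \<in> {p..r}" for y
          using lipx[OF \<alpha>J(1) that] Cn[of "\<bar>y - x0\<bar>"] by simp
        fix \<tau> assume \<tau>: "\<tau> \<in> {\<alpha><..s}"
        then have \<tau>t: "\<bar>\<tau> - t\<bar> < d1" "\<bar>\<tau> - t\<bar> < d2" using \<alpha>J(2) s \<delta>0 by auto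
        have CC: "0 \<le> C * (y - x0)\<^sup>2" for y using C0 by simp
        show "v \<tau> p \<le> v \<alpha> x0 + \<eta> + C * (p - x0)\<^sup>2"
        proof (cases "p = x0")
          case True then show ?thesis using n1[OF \<tau>t(1)] \<alpha>x by simp
        next
          case False
          then have "2 * M \<le> C * (p - x0)\<^sup>2" by (intro Cp) auto
          then show ?thesis using n1[OF \<tau>t(1)] \<alpha>x \<eta> abs_ge_self[of "v t p"] abs_ge_self[of "v t r"]
              abs_ge_minus_self[of "v t x0"] abs_ge_zero[of "v t p"] abs_ge_zero[of "v t r"]
            unfolding M_def by argo
        qed
        show "v \<tau> r \<le> v \<alpha> x0 + \<eta> + C * (r - x0)\<^sup>2"
        proof (cases "r = x0")
          case True then show ?thesis using n2[OF \<tau>t(2)] \<alpha>x by simp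
        next
          case False
          then have "2 * M \<le> C * (r - x0)\<^sup>2" by (intro Cp) auto
          then show ?thesis using n2[OF \<tau>t(2)] \<alpha>x \<eta> abs_ge_self[of "v t p"] abs_ge_self[of "v t r"]
              abs_ge_minus_self[of "v t x0"] abs_ge_zero[of "v t p"] abs_ge_zero[of "v t r"]
            unfolding M_def by argo
        qed
      qed
      moreover have "C * (s - \<alpha>) \<le> C * (2 * \<delta>0)"
        using C0 \<alpha>J(2) s by (intro mult_left_mono) auto
      ultimately show ?thesis
        using C\<rho>(1)[OF x(2)] C\<delta>0 \<alpha>x \<eta> unfolding distrib_left by (simp add: \<eta>_def)
    qed
  qed
  show ?thesis
  proof (cases "\<exists>k\<in>K. t - \<delta>0 < k \<and> k < t")
    case True
    then obtain k where k: "k \<in> K" "t - \<delta>0 < k" "k < t" by blast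
    show ?thesis
      using k \<delta>0 \<rho> by (intro exI[of _ "Min {t - k, \<delta>0, \<rho>}"]) (auto intro!: main[of k])
  next
    case False
    define s0 where "s0 = t - \<delta>0 / 2"
    have "s0 \<in> {a<..<b}" using \<delta>0 t by (simp add: s0_def)
    then have "s0 \<in> {0<..<T}" "t \<in> {0<..<T}" using J t by blast+
    then have s0: "0 < s0" "s0 < t" "t < T" using \<delta>0(1) by (auto simp: s0_def)
    have "continuous_on ({s0..<t} \<times> {p..r}) (\<lambda>(t, x). v t x)"
      using False \<delta>0 t by (intro contJ) (force simp: s0_def)
    from left_limit_uniform[OF v s0 this \<eta>] obtain \<delta>1 where \<delta>1: "\<delta>1 > 0"
      "\<And>s x. s \<in> {t - \<delta>1<..<t} \<Longrightarrow> x \<in> {p..r} \<Longrightarrow> v s x \<le> v t x + \<eta>" by blast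
    show ?thesis
    proof (intro exI[of _ "Min {\<delta>1, \<delta>0, \<rho>}"] conjI ballI impI)
      show "Min {\<delta>1, \<delta>0, \<rho>} > 0" using \<delta>1 \<delta>0 \<rho> by simp
      fix s x assume s: "s \<in> {t - Min {\<delta>1, \<delta>0, \<rho>}<..<t + Min {\<delta>1, \<delta>0, \<rho>}}"
        and x: "x \<in> {p..r}" "\<bar>x - x0\<bar> < Min {\<delta>1, \<delta>0, \<rho>}"
      show "v s x \<le> v t x0 + \<epsilon>"
      proof (cases "s < t")
        case True
        then have "v s x \<le> v t x + \<eta>" using s x by (intro \<delta>1) auto
        also have "v t x \<le> v t x0 + \<eta>" using lipx[OF t x(1)] C\<rho>(2)[of x] x by auto
        finally show ?thesis using \<eta> by (simp add: \<eta>_def)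
      next
        case False
        \<comment> \<open>From \<open>t\<close> onwards, \<open>t\<close> itself is an element of
          \<open>K\<close> not after \<open>s\<close>.\<close>
        then show ?thesis using s x t \<delta>0 by (intro main[of t]) auto
      qed
    qed
  qed
qed

text \<open>If bad times exist, Baire's theorem gives a portion of them with a common Lipschitz
  constant. There \<open>bad_time_usc\<close> for \<open>v\<close> and for \<open>- v\<close> proves
  joint continuity at every bad time, and good times have it by definition; so a bad time would be
  good.\<close>

theorem separate_heat_continuous:
  assumes v: "separate_heat v T p r"
  shows "continuous_on ({0<..<T} \<times> {p..r}) (\<lambda>(t, x). v t x)"
proof -
  note vD = separate_heatD[OF v]
  define U where "U = {t. \<exists>d>0. continuous_on ({t - d<..<t + d} \<times> {p..r}) (\<lambda>(t, x). v t x)}"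
  have U: "open U"
    unfolding open_dist
  proof
    fix t assume "t \<in> U"
    then obtain d where d: "d > 0" "continuous_on ({t - d<..<t + d} \<times> {p..r}) (\<lambda>(t, x). v t x)"
      unfolding U_def by auto
    have "y \<in> U" if "dist y t < d / 2" for y
      unfolding U_def using d that
      by (intro CollectI exI[of _ "d/2"] conjI continuous_on_subset[OF d(2)])
         (auto simp: dist_real_def abs_if split: if_splits)
    then show "\<exists>e>0. \<forall>y. dist y t < e \<longrightarrow> y \<in> U" using d by (intro exI[of _ "d/2"]) auto
  qed
  have "{0<..<T} \<subseteq> U"
  proof (rule ccontr)
    assume "\<not> {0<..<T} \<subseteq> U"
    then obtain c where c: "c \<in> {0<..<T}" "c \<notin> U" by blast
    define d where "d = min c (T - c) / 2"
    have d: "d > 0" "{c - d..c + d} \<subseteq> {0<..<T}" using c by (auto simp: d_def min_def field_simps split: if_splits)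
    \<comment> \<open>Closed, as Baire's theorem requires, yet every point of \<open>S\<close> is a
      limit of bad times in the open interval; hence each portion of \<open>S\<close> contains such
      a time.\<close>
    define S where "S = closure ({c - d<..<c + d} - U)"
    have "S \<subseteq> {c - d..c + d} - U"
      unfolding S_def using U by (intro closure_minimal closed_Diff) auto
    moreover have "c \<in> S"
      unfolding S_def using c d closure_subset[of "{c - d<..<c + d} - U"] by auto
    ultimately have S: "closed S" "S \<subseteq> {c - d..c + d} - U" "c \<in> S"
      by (auto simp: S_def)
    define A where "A n = {t \<in> S. lip_at v {p..r} t n}" for n
    have clA: "closed (A n)" for n
    proof -
      \<comment> \<open>For fixed \<open>x\<close> and \<open>y\<close> this is a closed condition,
        by continuity in time alone.\<close>
      have "closed {t \<in> S. \<bar>v t x - v t y\<bar> \<le> real n * \<bar>x - y\<bar>}" if "x \<in> {p..r}" "y \<in> {p..r}" for x y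
        using S d by (intro continuous_on_closed_Collect_le continuous_intros continuous_on_subset[OF vD(2)] that) auto
      then have "closed (S \<inter> (\<Inter>x\<in>{p..r}. \<Inter>y\<in>{p..r}. {t \<in> S. \<bar>v t x - v t y\<bar> \<le> real n * \<bar>x - y\<bar>}))"
        using S by (intro closed_Int closed_INT) auto
      also have "\<dots> = A n" unfolding A_def lip_at_def by auto
      finally show ?thesis .
    qed
    have UA: "\<exists>n. t \<in> A n" if "t \<in> S" for t
      using that vD(3)[of t] S d by (auto simp: A_def)
    have "\<exists>n. \<not> S \<subseteq> closure (S - A n)"
    proof (rule ccontr)
      assume "\<not> ?thesis"
      then have "S \<subseteq> closure (\<Inter>(range (\<lambda>n. S - A n)))"
        using S(1) clA by (intro Baire) (auto simp: Diff_eq intro!: openin_open_Int open_Compl)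
      moreover have "\<Inter>(range (\<lambda>n. S - A n)) = {}" using UA by auto
      ultimately show False using S(3) by (metis closure_empty empty_iff subsetD)
    qed
    then obtain n q where q: "q \<in> S" "q \<notin> closure (S - A n)" by blast
    then obtain e where e: "e > 0" "\<forall>y\<in>S - A n. \<not> dist y q < e"
      unfolding closure_approachable by blast
    obtain t where t: "t \<in> {c - d<..<c + d} - U" "dist t q < e"
      using q(1) e(1) unfolding S_def closure_approachable by blast
    define a where "a = max (c - d) (q - e)"
    define b where "b = min (c + d) (q + e)"
    have J: "{a<..<b} \<subseteq> {0<..<T}" using d by (auto simp: a_def b_def)
    have tJ: "t \<in> {a<..<b}" using t by (auto simp: a_def b_def dist_real_def)
    have lip: "lip_at v {p..r} k n" if "k \<in> (- U) \<inter> {a<..<b}" for k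
    proof -
      have "k \<in> {c - d<..<c + d} - U" using that by (auto simp: a_def b_def)
      then have "k \<in> S" unfolding S_def by (rule closure_subset[THEN subsetD])
      moreover have "dist k q < e" using that by (auto simp: a_def b_def dist_real_def)
      ultimately show ?thesis using e(2) unfolding A_def by blast
    qed
    have reg: "\<exists>d>0. continuous_on ({\<tau> - d<..<\<tau> + d} \<times> {p..r}) (\<lambda>(t, x). v t x)"
      if "\<tau> \<in> {a<..<b} - (- U)" for \<tau> using that by (auto simp: U_def)
    have clo: "closed ((- U) \<inter> {a'..b'})" for a' b'
      using U by (intro closed_Int closed_atLeastAtMost closed_Compl)
    have reg': "\<exists>d>0. continuous_on ({\<tau> - d<..<\<tau> + d} \<times> {p..r}) (\<lambda>(t, x). - v t x)"
      if "\<tau> \<in> {a<..<b} - (- U)" for \<tau>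
      using reg[OF that] continuous_on_minus[of _ "\<lambda>(t, x). v t x"] unfolding case_prod_unfold by blast
    have usc: "\<exists>\<delta>>0. \<forall>s\<in>{k - \<delta><..<k + \<delta>}. \<forall>x\<in>{p..r}. \<bar>x - x0\<bar> < \<delta> \<longrightarrow> \<bar>v s x - v k x0\<bar> \<le> \<epsilon>"
      if k: "k \<in> (- U) \<inter> {a<..<b}" and x0: "x0 \<in> {p..r}" and \<epsilon>: "0 < \<epsilon>" for k x0 \<epsilon>
    proof -
      obtain d1 where d1: "d1 > 0"
        "\<forall>s\<in>{k - d1<..<k + d1}. \<forall>x\<in>{p..r}. \<bar>x - x0\<bar> < d1 \<longrightarrow> v s x \<le> v k x0 + \<epsilon>"
        using bad_time_usc[OF v J reg clo lip k x0 \<epsilon>] by blast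
      obtain d2 where d2: "d2 > 0"
        "\<forall>s\<in>{k - d2<..<k + d2}. \<forall>x\<in>{p..r}. \<bar>x - x0\<bar> < d2 \<longrightarrow> - v s x \<le> - v k x0 + \<epsilon>"
        using bad_time_usc[OF separate_heat_minus[OF v] J reg' clo _ k x0 \<epsilon>] lip
        unfolding lip_at_minus by blast
      show ?thesis
      proof (intro exI[of _ "min d1 d2"] conjI ballI impI)
        fix s x assume sx: "s \<in> {k - min d1 d2<..<k + min d1 d2}" "x \<in> {p..r}" "\<bar>x - x0\<bar> < min d1 d2"
        then have "s \<in> {k - d1<..<k + d1}" "s \<in> {k - d2<..<k + d2}" by auto
        then have "v s x \<le> v k x0 + \<epsilon>" "- v s x \<le> - v k x0 + \<epsilon>"
          using d1(2) d2(2) sx by simp_all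
        then show "\<bar>v s x - v k x0\<bar> \<le> \<epsilon>" by (simp add: abs_le_iff)
      qed (use d1 d2 in auto)
    qed
    have "continuous_on ({a<..<b} \<times> {p..r}) (\<lambda>(t, x). v t x)"
      unfolding continuous_on_eq_continuous_within
    proof
      fix w assume w: "w \<in> {a<..<b} \<times> {p..r}"
      then obtain k x0 where w_eq: "w = (k, x0)" and k: "k \<in> {a<..<b}" and x0: "x0 \<in> {p..r}" by auto
      show "continuous (at w within {a<..<b} \<times> {p..r}) (\<lambda>(t, x). v t x)"
      proof (cases "k \<in> U")
        case True
        have "continuous_on (({a<..<b} \<inter> U) \<times> {p..r}) (\<lambda>(t, x). v t x)"
          by (rule continuous_on_times_local) (auto simp: U_def)
        then have "continuous (at w within ({a<..<b} \<inter> U) \<times> {p..r}) (\<lambda>(t, x). v t x)"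
          using k x0 True by (auto simp: continuous_on_eq_continuous_within w_eq)
        moreover have "at w within ({a<..<b} \<inter> U) \<times> {p..r} = at w within {a<..<b} \<times> {p..r}"
          using True U by (intro at_within_nhd[of _ "U \<times> UNIV"]) (auto simp: w_eq intro!: open_Times)
        ultimately show ?thesis by simp
      next
        case False
        show ?thesis unfolding continuous_within_eps_delta
        proof (intro allI impI)
          fix \<epsilon> :: real assume "\<epsilon> > 0"
          then obtain \<delta> where \<delta>: "\<delta> > 0"
            "\<forall>s\<in>{k - \<delta><..<k + \<delta>}. \<forall>x\<in>{p..r}. \<bar>x - x0\<bar> < \<delta> \<longrightarrow> \<bar>v s x - v k x0\<bar> \<le> \<epsilon> / 2"
            using usc[of k x0 "\<epsilon> / 2"] False k x0 by auto
          have "dist (case w' of (t, x) \<Rightarrow> v t x) (case w of (t, x) \<Rightarrow> v t x) < \<epsilon>"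
            if w': "w' \<in> {a<..<b} \<times> {p..r}" "dist w' w < \<delta>" for w'
          proof -
            obtain s x where sx: "w' = (s, x)" by (cases w')
            have "\<bar>s - k\<bar> < \<delta>" "\<bar>x - x0\<bar> < \<delta>"
              using dist_fst_le[of w' w] dist_snd_le[of w' w] w'(2) by (auto simp: sx w_eq dist_real_def)
            then have "\<bar>v s x - v k x0\<bar> \<le> \<epsilon> / 2"
              using \<delta>(2)[rule_format, of s x] w'(1) by (auto simp: sx abs_less_iff)
            then show ?thesis using \<open>\<epsilon> > 0\<close> by (simp add: sx w_eq dist_real_def)
          qed
          then show "\<exists>d>0. \<forall>x'\<in>{a<..<b} \<times> {p..r}. dist x' w < d \<longrightarrow>
              dist (case x' of (t, x) \<Rightarrow> v t x) (case w of (t, x) \<Rightarrow> v t x) < \<epsilon>"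
            using \<delta>(1) by blast
        qed
      qed
    qed
    note cJ = this
    have "t \<in> U" unfolding U_def using tJ
      by (intro CollectI exI[of _ "min (t - a) (b - t)"] conjI continuous_on_subset[OF cJ]) auto
    then show False using t by simp
  qed
  then show ?thesis
    by (intro continuous_on_times_local) (auto simp: U_def)
qed

section \<open>Uniqueness for solutions of unit mass\<close>

text \<open>With equal integrals, the \<open>L\<^sup>1\<close> distance is twice the integral of the
  positive part of \<open>f - F n\<close>, and that is dominated by \<open>f\<close>.\<close>

lemma scheffe:
  fixes f :: "'a \<Rightarrow> real" and F :: "nat \<Rightarrow> 'a \<Rightarrow> real"
  assumes F: "\<And>n. integrable M (F n)" "\<And>n x. 0 \<le> F n x"
    and f: "integrable M f" "\<And>x. 0 \<le> f x"
    and eq: "\<And>n. integral\<^sup>L M (F n) = integral\<^sup>L M f"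
    and lim: "AE x in M. (\<lambda>n. F n x) \<longlonglongrightarrow> f x"
  shows "(\<lambda>n. \<integral>x. \<bar>F n x - f x\<bar> \<partial>M) \<longlonglongrightarrow> 0"
proof -
  have split: "\<bar>F n x - f x\<bar> = F n x - f x + 2 * max 0 (f x - F n x)" for n x by (simp add: max_def)
  have max_int: "integrable M (\<lambda>x. max 0 (f x - F n x))" for n
    using F f by (intro integrable_max) auto
  have dist: "(\<integral>x. \<bar>F n x - f x\<bar> \<partial>M) = 2 * (\<integral>x. max 0 (f x - F n x) \<partial>M)" for n
    unfolding split using F(1)[of n] f(1) eq[of n] max_int[of n] by simp
  have "(\<lambda>n. \<integral>x. max 0 (f x - F n x) \<partial>M) \<longlonglongrightarrow> (\<integral>x. 0 \<partial>M)"
  proof (rule integral_dominated_convergence[where w = f])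
    show "AE x in M. (\<lambda>n. max 0 (f x - F n x)) \<longlonglongrightarrow> 0"
      using lim
    proof eventually_elim
      fix x assume "(\<lambda>n. F n x) \<longlonglongrightarrow> f x"
      then have "(\<lambda>n. max 0 (f x - F n x)) \<longlonglongrightarrow> max 0 (f x - f x)" by (intro tendsto_intros)
      then show "(\<lambda>n. max 0 (f x - F n x)) \<longlonglongrightarrow> 0" by simp
    qed
    show "AE x in M. norm (max 0 (f x - F n x)) \<le> f x" for n
      using F(2) f(2) by (auto simp: max_def)
  qed (use f max_int in auto)
  from tendsto_mult_left[OF this, of 2] show ?thesis unfolding dist by simp
qed

lemma halfline_densityD:
  assumes "halfline_density g"
  shows "integrable lborel (\<lambda>x. indicator {0..} x * g x)" "\<And>x. 0 \<le> indicator {0..} x * g x"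
    "(\<integral>x. indicator {0..} x * g x \<partial>lborel) = 1"
  using assms unfolding halfline_density_def
  by (auto simp: set_integrable_def set_lebesgue_integral_def indicator_def)

lemma measure_halfline_law:
  fixes h :: "real \<Rightarrow> real"
  assumes g: "halfline_density g"
  shows "real_distribution (halfline_law g)"
    and "A \<in> sets borel \<Longrightarrow>
      measure (halfline_law g) A = (\<integral>x. indicator A x * (indicator {0..} x * g x) \<partial>lborel)"
    and "h \<in> borel_measurable borel \<Longrightarrow>
      integral\<^sup>L (halfline_law g) h = (\<integral>x. indicator {0..} x * g x * h x \<partial>lborel)"
proof -
  note gD = halfline_densityD[OF g]
  have m: "(\<lambda>x. indicator {0..} x * g x) \<in> borel_measurable lborel"
    using gD(1) by (rule borel_measurable_integrable)
  have "prob_space (halfline_law g)"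
  proof
    show "emeasure (halfline_law g) (space (halfline_law g)) = 1"
      unfolding halfline_law_def using m gD nn_integral_eq_integral[OF gD(1)]
      by (simp add: emeasure_density)
  qed
  then interpret prob_space "halfline_law g" .
  show "real_distribution (halfline_law g)"
    by unfold_locales (simp_all add: halfline_law_def)
  show int: "integral\<^sup>L (halfline_law g) h = (\<integral>x. indicator {0..} x * g x * h x \<partial>lborel)"
    if "h \<in> borel_measurable borel" for h :: "real \<Rightarrow> real"
    unfolding halfline_law_def using m gD(2) that by (subst integral_density) auto
  show "measure (halfline_law g) A = (\<integral>x. indicator A x * (indicator {0..} x * g x) \<partial>lborel)"
    if "A \<in> sets borel"
  proof -
    have "measure (halfline_law g) A = integral\<^sup>L (halfline_law g) (indicator A)"
      by (simp add: halfline_law_def)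
    also have "\<dots> = (\<integral>x. indicator A x * (indicator {0..} x * g x) \<partial>lborel)"
      using that by (subst int) (auto simp: mult_ac)
    finally show ?thesis .
  qed
qed

text \<open>The horizon is finite because the clock of an arbitrary solution is not known to run to
  infinity; it can be inverted only below its values.\<close>

definition heat_density :: "(real \<Rightarrow> real \<Rightarrow> real) \<Rightarrow> real \<Rightarrow> bool" where
  "heat_density v T \<longleftrightarrow> (\<forall>t\<in>{0<..<T}. halfline_density (v t) \<and> (\<forall>x>0. heat_at v t x))"

lemma heat_at_isCont: "heat_at v t x \<Longrightarrow> isCont (\<lambda>t. v t x) t"
  unfolding heat_at_def by (auto dest: DERIV_isCont)

lemma heat_at_DERIV:
  assumes "heat_at v t x"
  shows "(v t has_real_derivative deriv (v t) x) (at x)" "isCont (deriv (v t)) x"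
proof -
  obtain z1 z2 where z: "\<forall>\<^sub>F y in nhds x. (v t has_real_derivative z1 y) (at y)"
    "(z1 has_real_derivative z2) (at x)"
    using assms unfolding heat_at_def by blast
  have ev: "\<forall>\<^sub>F y in nhds x. deriv (v t) y = z1 y"
    using z(1) by eventually_elim (rule DERIV_imp_deriv)
  then show "isCont (deriv (v t)) x"
    using DERIV_isCont[OF z(2)] by (simp add: isCont_cong)
  show "(v t has_real_derivative deriv (v t) x) (at x)"
    using eventually_nhds_x_imp_x[OF z(1)] eventually_nhds_x_imp_x[OF ev] by simp
qed

lemma heat_density_L1_continuous:
  assumes v: "heat_density v T" and t: "t \<in> {0<..<T}"
  shows "((\<lambda>s. \<integral>x. \<bar>indicator {0..} x * v s x - indicator {0..} x * v t x\<bar> \<partial>lborel) \<longlongrightarrow> 0) (at t)"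
proof -
  have "((\<lambda>s. \<integral>x. \<bar>indicator {0..} x * v s x - indicator {0..} x * v t x\<bar> \<partial>lborel) \<longlongrightarrow> 0) (at t within {0<..<T})"
    unfolding tendsto_at_iff_sequentially o_def
  proof (intro allI impI)
    fix X :: "nat \<Rightarrow> real" assume X: "\<forall>i. X i \<in> {0<..<T} - {t}" "X \<longlonglongrightarrow> t"
    have d: "halfline_density (v (X i))" "halfline_density (v t)" for i
      using v t X unfolding heat_density_def by auto
    show "(\<lambda>i. \<integral>x. \<bar>indicator {0..} x * v (X i) x - indicator {0..} x * v t x\<bar> \<partial>lborel) \<longlonglongrightarrow> 0"
    proof (rule scheffe)
      have "AE x in lborel. x \<noteq> (0::real)" by (rule AE_lborel_singleton)
      then show "AE x in lborel. (\<lambda>i. indicator {0..} x * v (X i) x) \<longlonglongrightarrow> indicator {0..} x * v t x"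
      proof eventually_elim
        fix x :: real assume "x \<noteq> 0"
        show "(\<lambda>i. indicator {0..} x * v (X i) x) \<longlonglongrightarrow> indicator {0..} x * v t x"
        proof (cases "x > 0")
          case True
          then have "isCont (\<lambda>t. v t x) t" using v t unfolding heat_density_def by (auto intro: heat_at_isCont)
          then show ?thesis using X(2) by (intro tendsto_mult tendsto_const) (rule isCont_tendsto_compose)
        qed (use \<open>x \<noteq> 0\<close> in \<open>auto simp: indicator_def\<close>)
      qed
    qed (use halfline_densityD[OF d(1)] halfline_densityD[OF d(2)] in simp_all)
  qed
  then show ?thesis unfolding at_within_open[OF t open_greaterThanLessThan] .
qed

text \<open>The space derivative is itself differentiable, hence continuous and bounded on the
  compact interval, which stays clear of 0; this gives the Lipschitz constants.\<close>

lemma heat_density_separate_heat: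
  assumes v: "heat_density v T" and pr: "0 < p" "p < r"
  shows "separate_heat v T p r"
  unfolding separate_heat_def
proof (intro conjI ballI)
  show "p < r" by fact
  show "heat_at v t x" if "t \<in> {0<..<T}" "x \<in> {p<..<r}" for t x
    using v that pr unfolding heat_density_def by auto
  show "continuous_on {0<..<T} (\<lambda>t. v t x)" if "x \<in> {p..r}" for x
    using v that pr unfolding heat_density_def
    by (intro continuous_at_imp_continuous_on ballI heat_at_isCont) auto
  have at: "heat_at v t x" if "t \<in> {0<..<T}" "x \<in> {p..r}" for t x
    using v that pr unfolding heat_density_def by auto
  show "\<exists>n. lip_at v {p..r} t n" if t: "t \<in> {0<..<T}" for t
  proof -
    have "continuous_on {p..r} (deriv (v t))"
      by (intro continuous_at_imp_continuous_on ballI heat_at_DERIV at t)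
    then have "bounded (deriv (v t) ` {p..r})"
      by (intro compact_imp_bounded compact_continuous_image compact_Icc)
    then obtain B where B: "\<forall>y\<in>deriv (v t) ` {p..r}. norm y \<le> B" unfolding bounded_iff ..
    obtain n where n: "B \<le> real n" using real_arch_simple by blast
    have "\<bar>v t x - v t y\<bar> \<le> real n * \<bar>x - y\<bar>" if "x \<in> {p..r}" "y \<in> {p..r}" for x y
    proof -
      have "norm (v t x - v t y) \<le> real n * norm (x - y)"
      proof (rule field_differentiable_bound[of "{p..r}" "v t" "deriv (v t)"])
        show "(v t has_real_derivative deriv (v t) z) (at z within {p..r})" if "z \<in> {p..r}" for z
          using heat_at_DERIV(1)[OF at[OF t that]] by (rule has_field_derivative_at_within)
        show "norm (deriv (v t) z) \<le> real n" if "z \<in> {p..r}" for z using B n that by force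
      qed (use that in auto)
      then show ?thesis by simp
    qed
    then show ?thesis unfolding lip_at_def by blast
  qed
  show "((\<lambda>s. \<integral>x. indicator {p..r} x * \<bar>v s x - v t x\<bar> \<partial>lborel) \<longlongrightarrow> 0) (at_right t)"
    if t: "t \<in> {0<..<T}" for t
  proof (rule Lim_null_comparison)
    show "((\<lambda>s. \<integral>x. \<bar>indicator {0..} x * v s x - indicator {0..} x * v t x\<bar> \<partial>lborel) \<longlongrightarrow> 0) (at_right t)"
      using heat_density_L1_continuous[OF v t] by (rule tendsto_within_subset) simp
    have "\<forall>\<^sub>F s in at_right t. s \<in> {t<..<T}" using t by (intro eventually_at_right_real) simp
    then show "\<forall>\<^sub>F s in at_right t. norm (\<integral>x. indicator {p..r} x * \<bar>v s x - v t x\<bar> \<partial>lborel)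
        \<le> (\<integral>x. \<bar>indicator {0..} x * v s x - indicator {0..} x * v t x\<bar> \<partial>lborel)"
    proof eventually_elim
      fix s assume s: "s \<in> {t<..<T}"
      have int: "integrable lborel (\<lambda>x. \<bar>indicator {0..} x * v s x - indicator {0..} x * v t x\<bar>)"
        using v s t unfolding heat_density_def
        by (intro integrable_abs Bochner_Integration.integrable_diff halfline_densityD(1)) auto
      have le: "indicator {p..r} x * \<bar>v s x - v t x\<bar> \<le> \<bar>indicator {0..} x * v s x - indicator {0..} x * v t x\<bar>" for x
        using pr by (auto simp: indicator_def)
      have "(\<integral>x. indicator {p..r} x * \<bar>v s x - v t x\<bar> \<partial>lborel)
          \<le> (\<integral>x. \<bar>indicator {0..} x * v s x - indicator {0..} x * v t x\<bar> \<partial>lborel)"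
        using int le by (intro integral_mono') auto
      moreover have "0 \<le> (\<integral>x. indicator {p..r} x * \<bar>v s x - v t x\<bar> \<partial>lborel)" by simp
      ultimately show "norm (\<integral>x. indicator {p..r} x * \<bar>v s x - v t x\<bar> \<partial>lborel)
        \<le> (\<integral>x. \<bar>indicator {0..} x * v s x - indicator {0..} x * v t x\<bar> \<partial>lborel)" by simp
    qed
  qed
qed

lemma integral_split_uniform:
  fixes f :: "real \<Rightarrow> real"
  assumes "0 \<le> c" "f integrable_on {a..a + real N * c}"
  shows "integral {a..a + real N * c} f = (\<Sum>j<N. integral {a + real j * c..a + real (Suc j) * c} f)"
  using assms(2)
proof (induction N)
  case (Suc N)
  have le: "a \<le> a + real N * c" "a + real N * c \<le> a + real (Suc N) * c"
    using assms(1) by (auto simp: algebra_simps)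
  have "f integrable_on {a..a + real N * c}"
    by (rule integrable_subinterval_real[OF Suc.prems]) (use le in auto)
  then show ?case
    using Suc.IH Henstock_Kurzweil_Integration.integral_combine[OF le Suc.prems] by simp
qed simp

lemma riemann_sum_close:
  fixes f :: "real \<Rightarrow> real"
  assumes h: "0 \<le> h" and N: "0 < N" and cont: "continuous_on {x..x + h} f"
    and osc: "\<And>y y'. y \<in> {x..x + h} \<Longrightarrow> y' \<in> {x..x + h} \<Longrightarrow> \<bar>y - y'\<bar> \<le> h / real N \<Longrightarrow> \<bar>f y - f y'\<bar> \<le> e"
  shows "\<bar>integral {x..x + h} f - (\<Sum>j<N. h / real N * f (x + real j * (h / real N)))\<bar> \<le> h * e"
proof -
  define c where "c = h / real N"
  have c: "0 \<le> c" "real N * c = h" using h N by (auto simp: c_def)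
  have piece: "\<bar>integral {x + real j * c..x + real (Suc j) * c} f - c * f (x + real j * c)\<bar> \<le> e * c" if j: "j < N" for j
  proof -
    have "real (Suc j) * c \<le> real N * c" using j c by (intro mult_right_mono) auto
    then have sub: "{x + real j * c..x + real (Suc j) * c} \<subseteq> {x..x + h}"
      using c by (auto simp: c(2) intro: order_trans[of _ "x + real j * c"])
    then have cf: "continuous_on {x + real j * c..x + real (Suc j) * c} f"
      using cont continuous_on_subset by blast
    have "norm (integral {x + real j * c..x + real (Suc j) * c} (\<lambda>y. f y - f (x + real j * c)))
        \<le> e * (x + real (Suc j) * c - (x + real j * c))"
    proof (rule integral_bound)
      show "norm (f y - f (x + real j * c)) \<le> e" if "y \<in> {x + real j * c..x + real (Suc j) * c}" for y
      proof -
        have "x + real j * c \<in> {x + real j * c..x + real (Suc j) * c}" using c by (simp add: algebra_simps)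
        moreover have "\<bar>y - (x + real j * c)\<bar> \<le> c" using that by (auto simp: algebra_simps)
        ultimately show ?thesis using osc[of y "x + real j * c"] that sub unfolding c_def real_norm_def by blast
      qed
    qed (use c cf in \<open>auto intro!: continuous_intros simp: algebra_simps\<close>)
    moreover have "integral {x + real j * c..x + real (Suc j) * c} (\<lambda>y. f y - f (x + real j * c))
        = integral {x + real j * c..x + real (Suc j) * c} f - c * f (x + real j * c)"
      using c cf by (subst Henstock_Kurzweil_Integration.integral_diff)
         (auto intro!: integrable_continuous_real simp: algebra_simps)
    ultimately show ?thesis by (simp add: algebra_simps)
  qed
  have "integral {x..x + h} f = (\<Sum>j<N. integral {x + real j * c..x + real (Suc j) * c} f)"
    using integral_split_uniform[of c f x N] c cont by (simp add: integrable_continuous_real)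
  then have "\<bar>integral {x..x + h} f - (\<Sum>j<N. c * f (x + real j * c))\<bar>
      \<le> (\<Sum>j<N. \<bar>integral {x + real j * c..x + real (Suc j) * c} f - c * f (x + real j * c)\<bar>)"
    by (simp add: sum_subtractf[symmetric] del: of_nat_Suc)
  also have "\<dots> \<le> (\<Sum>j<N. e * c)" by (intro sum_mono piece) auto
  also have "\<dots> = h * e" using c by (simp add: mult.left_commute mult.commute)
  finally show ?thesis by (simp add: c_def)
qed

text \<open>Differentiating the window integral would need bounds on derivatives. Its left Riemann
  sums are finite combinations of translates of \<open>w\<close>, so they satisfy
  \<open>heat_at\<close>, and uniform continuity makes their error at most
  \<open>\<epsilon> / 2\<close> everywhere.\<close>

lemma heat_max_principle_average:
  fixes w :: "real \<Rightarrow> real \<Rightarrow> real"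
  assumes h: "0 < h" and pr: "p \<le> r"
    and cont: "continuous_on ({s..e} \<times> {p..r + h}) (\<lambda>(t, x). w t x)"
    and heat: "\<And>t x. s < t \<Longrightarrow> t \<le> e \<Longrightarrow> p < x \<Longrightarrow> x < r + h \<Longrightarrow> heat_at w t x"
    and init: "\<And>x. x \<in> {p..r} \<Longrightarrow> integral {x..x + h} (w s) \<le> m"
    and lat: "\<And>t. t \<in> {s..e} \<Longrightarrow> integral {p..p + h} (w t) \<le> m"
      "\<And>t. t \<in> {s..e} \<Longrightarrow> integral {r..r + h} (w t) \<le> m"
    and tx: "t \<in> {s..e}" "x \<in> {p..r}"
  shows "integral {x..x + h} (w t) \<le> m"
proof (rule field_le_epsilon)
  fix \<epsilon> :: real assume \<epsilon>: "0 < \<epsilon>"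
  define e' where "e' = \<epsilon> / 2 / h"
  have e': "e' > 0" "h * e' = \<epsilon> / 2" using \<epsilon> h by (auto simp: e'_def)
  have "uniformly_continuous_on ({s..e} \<times> {p..r + h}) (\<lambda>(t, x). w t x)"
    by (intro compact_uniformly_continuous cont compact_Times compact_Icc)
  then obtain d where d: "d > 0"
    "\<And>q q'. q \<in> {s..e} \<times> {p..r + h} \<Longrightarrow> q' \<in> {s..e} \<times> {p..r + h} \<Longrightarrow> dist q' q < d \<Longrightarrow>
      dist (case q' of (t, x) \<Rightarrow> w t x) (case q of (t, x) \<Rightarrow> w t x) < e'"
    unfolding uniformly_continuous_on_def using e'(1) by metis
  obtain n where n: "h / d < real n" using reals_Archimedean2 by blast
  define N where "N = Suc n"
  have "h / d < real N" using n by (simp add: N_def)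
  then have N: "0 < N" "h / real N < d" using d(1) h by (auto simp: N_def field_simps)
  \<comment> \<open>The summand \<open>t + 0\<close> only matches the form of
    \<open>heat_at_shift\<close>.\<close>
  define S where "S t x = (\<Sum>j<N. h / real N * w (t + 0) (x + real j * (h / real N)))" for t x
  have close: "\<bar>integral {x..x + h} (w t) - S t x\<bar> \<le> \<epsilon> / 2" if "t \<in> {s..e}" "x \<in> {p..r}" for t x
  proof -
    have sub: "{x..x + h} \<subseteq> {p..r + h}" using that by auto
    have "continuous_on {x..x + h} ((\<lambda>(t, x). w t x) \<circ> (\<lambda>x. (t, x)))"
      using that sub by (intro continuous_on_compose continuous_intros continuous_on_subset[OF cont]) auto
    then have "continuous_on {x..x + h} (w t)" by (simp add: o_def)
    moreover have "\<bar>w t y - w t y'\<bar> \<le> e'" if "y \<in> {x..x + h}" "y' \<in> {x..x + h}" "\<bar>y - y'\<bar> \<le> h / real N" for y y'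
      using d(2)[of "(t, y')" "(t, y)"] that sub N \<open>t \<in> {s..e}\<close>
      by (auto simp: dist_Pair_Pair dist_real_def)
    ultimately show ?thesis
      using riemann_sum_close[of h N x "w t" e'] h N(1) e'(2) by (simp add: S_def)
  qed
  have jN: "0 \<le> real j * (h / real N)" "real j * (h / real N) \<le> h" if "j < N" for j
  proof -
    have "real j * (h / real N) \<le> real N * (h / real N)" using that h by (intro mult_right_mono) auto
    then show "real j * (h / real N) \<le> h" using N by simp
  qed (use h in simp)
  have "S t x \<le> m + \<epsilon> / 2"
  proof (rule heat_max_principle[of s e p r S])
    show "continuous_on ({s..e} \<times> {p..r}) (\<lambda>(t, x). S t x)"
    proof -
      have "continuous_on ({s..e} \<times> {p..r}) ((\<lambda>(t, x). w t x) \<circ> (\<lambda>(t, x). (t + 0, x + real j * (h / real N))))"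
        if "j < N" for j
        using jN[OF that] by (intro continuous_on_compose continuous_on_subset[OF cont])
          (auto simp: case_prod_unfold intro!: continuous_intros add_mono)
      then show ?thesis unfolding S_def case_prod_unfold o_def
        by (intro continuous_on_sum continuous_on_mult continuous_on_const) auto
    qed
    fix t x assume tx: "s < t" "t \<le> e" "p < x" "x < r"
    have "heat_at (\<lambda>t x. h / real N * w (t + 0) (x + real j * (h / real N))) t x" if "j < N" for j
    proof -
      have "heat_at (\<lambda>t x. w (t + 0) (x + real j * (h / real N))) t x"
        using jN[OF that] tx by (intro heat_at_shift heat) auto
      from heat_at_lincomb[OF this this, of "h / real N" 0] show ?thesis by simp
    qed
    then show "heat_at S t x" unfolding S_def[abs_def] by (intro heat_at_sum) auto
  next
    fix x assume "x \<in> {p..r}"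
    then show "S s x \<le> m + \<epsilon> / 2" using close[of s x] init[of x] tx unfolding abs_le_iff by auto
  next
    fix t assume "t \<in> {s..e}"
    then show "S t p \<le> m + \<epsilon> / 2" "S t r \<le> m + \<epsilon> / 2"
      using close[of t p] close[of t r] lat[of t] pr unfolding abs_le_iff by auto
  qed (use tx in auto)
  then show "integral {x..x + h} (w t) \<le> m + \<epsilon>"
    using close[OF tx] unfolding abs_le_iff by auto
qed

section \<open>Distribution functions of unit-mass solutions\<close>

abbreviation halfline_cdf :: "(real \<Rightarrow> real) \<Rightarrow> real \<Rightarrow> real" where
  "halfline_cdf g \<equiv> cdf (halfline_law g)"

lemma halfline_cdf_bounds:
  assumes "halfline_density g"
  shows "mono (halfline_cdf g)" "0 \<le> halfline_cdf g x" "halfline_cdf g x \<le> 1"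
    "isCont (halfline_cdf g) x" "x \<le> 0 \<Longrightarrow> halfline_cdf g x = 0"
    "(halfline_cdf g \<longlongrightarrow> 1) at_top"
proof -
  interpret real_distribution "halfline_law g" by (rule measure_halfline_law(1)[OF assms])
  show "mono (halfline_cdf g)" by (intro monoI cdf_nondecreasing)
  show "0 \<le> halfline_cdf g x" by (rule cdf_nonneg)
  show "halfline_cdf g x \<le> 1" by (rule cdf_bounded_prob)
  show "(halfline_cdf g \<longlongrightarrow> 1) at_top" by (rule cdf_lim_at_top_prob)
  have "AE y in lborel. y \<noteq> x" by (rule AE_lborel_singleton)
  then have "AE y in lborel. indicator {x} y * (indicator {0..} y * g y) = 0"
    by eventually_elim (simp add: indicator_def)
  from integral_eq_zero_AE[OF this] have "measure (halfline_law g) {x} = 0"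
    using measure_halfline_law(2)[OF assms, of "{x}"] by simp
  then show "isCont (halfline_cdf g) x" by (simp add: isCont_cdf)
  assume "x \<le> 0"
  have "AE y in lborel. y \<noteq> (0::real)" by (rule AE_lborel_singleton)
  then have "AE y in lborel. indicator {..x} y * (indicator {0..} y * g y) = 0"
    by eventually_elim (use \<open>x \<le> 0\<close> in \<open>auto simp: indicator_def\<close>)
  from integral_eq_zero_AE[OF this] show "halfline_cdf g x = 0"
    unfolding cdf_def using measure_halfline_law(2)[OF assms, of "{..x}"] by simp
qed

lemma halfline_cdf_diff:
  assumes g: "halfline_density g" and xy: "0 \<le> x" "x < y" and cont: "continuous_on {x..y} g"
  shows "integral {x..y} g = halfline_cdf g y - halfline_cdf g x"
proof -
  interpret real_distribution "halfline_law g" by (rule measure_halfline_law(1)[OF g])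
  have "halfline_cdf g y - halfline_cdf g x = (\<integral>z. indicator {x<..y} z * (indicator {0..} z * g z) \<partial>lborel)"
    using cdf_diff_eq[OF xy(2)] measure_halfline_law(2)[OF g] by simp
  also have "\<dots> = (LBINT z:{x..y}. g z)"
    unfolding set_lebesgue_integral_def
  proof (rule integral_cong_AE)
    have "AE z in lborel. z \<noteq> x" by (rule AE_lborel_singleton)
    then show "AE z in lborel. indicator {x<..y} z * (indicator {0..} z * g z) = indicator {x..y} z *\<^sub>R g z"
      by eventually_elim (use xy in \<open>auto simp: indicator_def\<close>)
    show "(\<lambda>z. indicator {x..y} z *\<^sub>R g z) \<in> borel_measurable lborel"
      using borel_integrable_atLeastAtMost'[OF cont] unfolding set_integrable_def by auto
    have "(\<lambda>z. indicator {0..} z * g z) \<in> borel_measurable lborel"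
      using halfline_densityD(1)[OF g] by auto
    then show "(\<lambda>z. indicator {x<..y} z * (indicator {0..} z * g z)) \<in> borel_measurable lborel"
      by (rule borel_measurable_times[rotated]) simp
  qed
  also have "\<dots> = integral {x..y} g"
    by (rule set_borel_integral_eq_integral(2)[OF borel_integrable_atLeastAtMost'[OF cont]])
  finally show ?thesis by simp
qed

lemma halfline_cdf_dist_le:
  assumes g: "halfline_density g" and k: "halfline_density k"
  shows "\<bar>halfline_cdf g x - halfline_cdf k x\<bar> \<le> (\<integral>y. \<bar>indicator {0..} y * g y - indicator {0..} y * k y\<bar> \<partial>lborel)"
proof -
  have int: "integrable lborel (\<lambda>y. indicator {..x} y * (indicator {0..} y * m y))" if "halfline_density m" for m
    using integrable_mult_indicator[OF _ halfline_densityD(1)[OF that], of "{..x}"] by simp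
  have eq: "halfline_cdf g x - halfline_cdf k x =
      (\<integral>y. indicator {..x} y * (indicator {0..} y * g y) - indicator {..x} y * (indicator {0..} y * k y) \<partial>lborel)"
    using int[OF g] int[OF k] measure_halfline_law(2)[OF g, of "{..x}"] measure_halfline_law(2)[OF k, of "{..x}"]
    by (simp add: cdf_def)
  have "\<bar>halfline_cdf g x - halfline_cdf k x\<bar> \<le> (\<integral>y. \<bar>indicator {..x} y * (indicator {0..} y * g y) - indicator {..x} y * (indicator {0..} y * k y)\<bar> \<partial>lborel)"
    unfolding eq by (rule integral_abs_bound)
  also have "\<dots> \<le> (\<integral>y. \<bar>indicator {0..} y * g y - indicator {0..} y * k y\<bar> \<partial>lborel)"
  proof (rule integral_mono)
    show "integrable lborel (\<lambda>y. \<bar>indicator {0..} y * g y - indicator {0..} y * k y\<bar>)"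
      by (rule integrable_abs[OF Bochner_Integration.integrable_diff[OF halfline_densityD(1)[OF g] halfline_densityD(1)[OF k]]])
    show "\<bar>indicator {..x} y * (indicator {0..} y * g y) - indicator {..x} y * (indicator {0..} y * k y)\<bar>
      \<le> \<bar>indicator {0..} y * g y - indicator {0..} y * k y\<bar>" for y :: real
      by (auto simp: indicator_def)
  qed (rule integrable_abs[OF Bochner_Integration.integrable_diff[OF int[OF g] int[OF k]]])
  finally show ?thesis .
qed

text \<open>Polya's theorem: monotonicity interpolates between finitely many grid points. Half of
  \<open>\<epsilon>\<close> pays for convergence on the grid, half for the oscillation of
  \<open>F\<close> between neighbouring points or for its tail beyond \<open>A\<close>.\<close>

lemma distribution_functions_uniform:
  fixes F :: "real \<Rightarrow> real" and Fn :: "nat \<Rightarrow> real \<Rightarrow> real"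
  assumes Fn: "\<And>n. mono (Fn n)" "\<And>n x. Fn n x \<le> 1" "\<And>n x. x \<le> 0 \<Longrightarrow> Fn n x = 0"
    and F: "mono F" "\<And>x. isCont F x" "\<And>x. F x \<le> 1" "\<And>x. x \<le> 0 \<Longrightarrow> F x = 0" "(F \<longlongrightarrow> 1) at_top"
    and lim: "\<And>x. (\<lambda>n. Fn n x) \<longlonglongrightarrow> F x" and \<epsilon>: "0 < \<epsilon>"
  shows "\<forall>\<^sub>F n in sequentially. \<forall>x. \<bar>Fn n x - F x\<bar> \<le> \<epsilon>"
proof -
  define e where "e = \<epsilon> / 2"
  have e: "0 < e" "2 * e = \<epsilon>" using \<epsilon> by (auto simp: e_def)
  have "\<forall>\<^sub>F x in at_top. 1 - e < F x" using F(5) e by (intro order_tendstoD) auto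
  then obtain A0 where A0: "\<And>x. x \<ge> A0 \<Longrightarrow> 1 - e < F x" unfolding eventually_at_top_linorder by blast
  define A where "A = max 1 A0"
  have A: "0 < A" "1 - e < F A" using A0 by (auto simp: A_def)
  have "uniformly_continuous_on {0..A} F"
    using F(2) by (intro compact_uniformly_continuous continuous_at_imp_continuous_on compact_Icc) auto
  then obtain d where d: "d > 0"
    "\<And>x x'. x \<in> {0..A} \<Longrightarrow> x' \<in> {0..A} \<Longrightarrow> dist x' x < d \<Longrightarrow> dist (F x') (F x) < e"
    unfolding uniformly_continuous_on_def using e(1) by metis
  obtain N where N: "A / d < real N" using reals_Archimedean2 by blast
  have "0 < A / d" using A d by simp
  then have N0: "0 < real N" using N by linarith
  define c where "c = A / real N"
  have c: "0 < c" "c < d" "real N * c = A" using N N0 A d by (auto simp: c_def field_simps)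
  have "\<forall>\<^sub>F n in sequentially. \<forall>j\<in>{..N}. \<bar>Fn n (real j * c) - F (real j * c)\<bar> < e"
  proof (intro eventually_ball_finite ballI)
    fix j show "\<forall>\<^sub>F n in sequentially. \<bar>Fn n (real j * c) - F (real j * c)\<bar> < e"
      using tendstoD[OF lim e(1), of "real j * c"] by (simp add: dist_real_def)
  qed simp
  then show ?thesis
  proof eventually_elim
    fix n assume g: "\<forall>j\<in>{..N}. \<bar>Fn n (real j * c) - F (real j * c)\<bar> < e"
    have g1: "Fn n (real j * c) \<le> F (real j * c) + e" "F (real j * c) - e \<le> Fn n (real j * c)" if "j \<le> N" for j
      using g that by (force simp: abs_less_iff)+
    show "\<forall>x. \<bar>Fn n x - F x\<bar> \<le> \<epsilon>"
    proof
      fix x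
      consider "x \<le> 0" | "0 < x" "x < A" | "A \<le> x" by linarith
      then show "\<bar>Fn n x - F x\<bar> \<le> \<epsilon>"
      proof cases
        case 1 then show ?thesis using Fn(3) F(4) \<epsilon> by simp
      next
        case 3
        have "1 - 2 * e \<le> Fn n A" using g1(2)[of N] A c by simp
        then have "1 - 2 * e \<le> Fn n x" "1 - e \<le> F x"
          using monoD[OF Fn(1) 3, of n] monoD[OF F(1) 3] A by auto
        then show ?thesis using Fn(2)[of n x] F(3)[of x] e unfolding abs_le_iff by auto
      next
        case 2
        define j where "j = nat \<lfloor>x / c\<rfloor>"
        have "real j \<le> x / c" "x / c < real j + 1" using 2 c by (auto simp: j_def)
        then have j: "real j * c \<le> x" "x < real (Suc j) * c" using c by (auto simp: field_simps)
        have "real j * c < real N * c" using j 2 c by simp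
        then have jN: "j < N" using c(1) by (simp only: mult_less_cancel_right_pos of_nat_less_iff)
        then have "real (Suc j) * c \<le> real N * c" using c by (intro mult_right_mono) auto
        then have "dist (F (real (Suc j) * c)) (F (real j * c)) < e"
          using c j 2 by (intro d(2)) (auto simp: dist_real_def algebra_simps)
        then have Fs: "F (real (Suc j) * c) \<le> F (real j * c) + e" by (simp add: dist_real_def abs_less_iff)
        have "Fn n x \<le> Fn n (real (Suc j) * c)" "F (real j * c) \<le> F x" "Fn n (real j * c) \<le> Fn n x"
          "F x \<le> F (real (Suc j) * c)"
          using j by (auto intro!: monoD[OF Fn(1)] monoD[OF F(1)] simp del: of_nat_Suc)
        then show ?thesis using g1[of j] g1[of "Suc j"] jN Fs e unfolding abs_le_iff
          by (simp del: of_nat_Suc)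
      qed
    qed
  qed
qed

text \<open>Otherwise times with too much mass below \<open>1 / (n + 1)\<close> or above
  \<open>n\<close> accumulate at some \<open>l\<close>, and continuity in \<open>L\<^sup>1\<close>
  at \<open>l\<close> contradicts the tails of the single law at \<open>l\<close>.\<close>

lemma heat_density_cdf_tail:
  assumes v: "heat_density v T" and J: "{\<delta>..e} \<subseteq> {0<..<T}" and \<epsilon>: "0 < \<epsilon>"
  shows "\<exists>\<eta>>0. \<exists>X. \<forall>t\<in>{\<delta>..e}. halfline_cdf (v t) \<eta> \<le> \<epsilon> \<and> 1 - halfline_cdf (v t) X \<le> \<epsilon>"
proof (rule ccontr)
  assume contra: "\<not> ?thesis"
  have dens: "halfline_density (v t)" if "t \<in> {0<..<T}" for t
    using v that unfolding heat_density_def by auto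
  have "\<exists>t\<in>{\<delta>..e}. \<epsilon> < halfline_cdf (v t) (1 / real (Suc n)) \<or> \<epsilon> < 1 - halfline_cdf (v t) (real n)" for n
  proof -
    have "0 < 1 / real (Suc n)" by simp
    then show ?thesis using contra by (force simp: not_le)
  qed
  then obtain t where t: "\<And>n. t n \<in> {\<delta>..e}"
    "\<And>n. \<epsilon> < halfline_cdf (v (t n)) (1 / real (Suc n)) \<or> \<epsilon> < 1 - halfline_cdf (v (t n)) (real n)"
    by metis
  obtain l r where l: "l \<in> {\<delta>..e}" and r: "strict_mono r" "(t \<circ> r) \<longlonglongrightarrow> l"
    using compact_Icc[of \<delta> e] t(1) unfolding compact_def by metis
  have lT: "l \<in> {0<..<T}" "\<And>n. t n \<in> {0<..<T}" using subsetD[OF J] l t(1) by blast+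
  let ?D = "\<lambda>s. \<integral>x. \<bar>indicator {0..} x * v s x - indicator {0..} x * v l x\<bar> \<partial>lborel"
  have "isCont ?D l" unfolding isCont_def using heat_density_L1_continuous[OF v lT(1)] by simp
  then have "(\<lambda>n. ?D ((t \<circ> r) n)) \<longlonglongrightarrow> ?D l" using r(2) by (rule isCont_tendsto_compose)
  then have "(\<lambda>n. ?D ((t \<circ> r) n)) \<longlonglongrightarrow> 0" by simp
  then have ev1: "\<forall>\<^sub>F n in sequentially. ?D ((t \<circ> r) n) < \<epsilon> / 2"
    using \<epsilon> by (intro order_tendstoD) auto
  note b = halfline_cdf_bounds[OF dens[OF lT(1)]]
  have "(halfline_cdf (v l) \<longlongrightarrow> 0) (at_right 0)"
    using b(4)[of 0] b(5)[of 0] unfolding isCont_def by (auto intro: tendsto_within_subset)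
  then have "\<forall>\<^sub>F y in at_right 0. halfline_cdf (v l) y < \<epsilon> / 2"
    using \<epsilon> by (intro order_tendstoD) auto
  then obtain \<eta>0 where \<eta>0: "\<eta>0 > 0" "\<And>y. 0 < y \<Longrightarrow> y < \<eta>0 \<Longrightarrow> halfline_cdf (v l) y < \<epsilon> / 2"
    unfolding eventually_at_right_field by auto
  define \<eta> where "\<eta> = \<eta>0 / 2"
  have \<eta>: "0 < \<eta>" "halfline_cdf (v l) \<eta> < \<epsilon> / 2" using \<eta>0 by (auto simp: \<eta>_def)
  have "\<forall>\<^sub>F y in at_top. 1 - \<epsilon> / 2 < halfline_cdf (v l) y"
    using b(6) \<epsilon> by (intro order_tendstoD) auto
  then obtain X where X: "1 - \<epsilon> / 2 < halfline_cdf (v l) X"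
    unfolding eventually_at_top_linorder by auto
  obtain n1 where n1: "1 / \<eta> < real n1" using reals_Archimedean2 by blast
  obtain n2 where n2: "X < real n2" using reals_Archimedean2 by blast
  obtain n where n: "?D ((t \<circ> r) n) < \<epsilon> / 2" "n1 \<le> n" "n2 \<le> n"
    using eventually_happens[OF eventually_conj[OF ev1 eventually_conj[OF eventually_ge_at_top[of n1] eventually_ge_at_top[of n2]]]]
    by auto
  have rn: "n \<le> r n" using r(1) by (rule seq_suble)
  let ?t = "t (r n)"
  note bt = halfline_cdf_bounds[OF dens[OF lT(2)[of "r n"]]]
  have dist: "\<bar>halfline_cdf (v ?t) y - halfline_cdf (v l) y\<bar> < \<epsilon> / 2" for y
    using halfline_cdf_dist_le[OF dens[OF lT(2)[of "r n"]] dens[OF lT(1)], of y] n(1) by simp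
  have "1 / \<eta> \<le> real (Suc (r n))" using n1 n(2) rn by linarith
  then have "1 / real (Suc (r n)) \<le> \<eta>" using \<eta>(1) by (simp add: field_simps)
  then have "halfline_cdf (v ?t) (1 / real (Suc (r n))) \<le> halfline_cdf (v ?t) \<eta>" by (rule monoD[OF bt(1)])
  moreover have "halfline_cdf (v ?t) X \<le> halfline_cdf (v ?t) (real (r n))"
    using n2 n(3) rn by (intro monoD[OF bt(1)]) linarith
  ultimately show False
    using dist[of \<eta>] dist[of X] \<eta>(2) X t(2)[of "r n"] unfolding abs_less_iff by linarith
qed

text \<open>For large \<open>X\<close>, the integral of \<open>v1 - v2\<close> over \<open>{x..x + X}\<close> is small on the whole parabolic boundary.\<close>

lemma heat_density_cdf_compare:
  assumes v1: "heat_density v1 T" and v2: "heat_density v2 T"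
    and \<delta>: "0 < \<delta>" "\<delta> \<le> t" "t < T" and x: "0 < x" and \<epsilon>: "0 < \<epsilon>"
    and init: "\<And>x. \<bar>halfline_cdf (v1 \<delta>) x - halfline_cdf (v2 \<delta>) x\<bar> \<le> \<epsilon>"
  shows "halfline_cdf (v2 t) x - halfline_cdf (v1 t) x \<le> 3 * \<epsilon>"
proof -
  have J: "{\<delta>..t} \<subseteq> {0<..<T}" using \<delta> by auto
  have dens: "halfline_density (v1 s)" "halfline_density (v2 s)" if "s \<in> {\<delta>..t}" for s
    using v1 v2 that J unfolding heat_density_def by blast+
  obtain \<eta>1 X1 where 1: "\<eta>1 > 0"
    "\<And>s. s \<in> {\<delta>..t} \<Longrightarrow> halfline_cdf (v1 s) \<eta>1 \<le> \<epsilon> \<and> 1 - halfline_cdf (v1 s) X1 \<le> \<epsilon>"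
    using heat_density_cdf_tail[OF v1 J \<epsilon>] by blast
  obtain \<eta>2 X2 where 2: "\<eta>2 > 0"
    "\<And>s. s \<in> {\<delta>..t} \<Longrightarrow> halfline_cdf (v2 s) \<eta>2 \<le> \<epsilon> \<and> 1 - halfline_cdf (v2 s) X2 \<le> \<epsilon>"
    using heat_density_cdf_tail[OF v2 J \<epsilon>] by blast
  define \<eta> where "\<eta> = Min {\<eta>1, \<eta>2, x}"
  define X where "X = Max {X1, X2, x}"
  have \<eta>: "0 < \<eta>" "\<eta> \<le> \<eta>1" "\<eta> \<le> \<eta>2" "\<eta> \<le> x" and X: "X1 \<le> X" "X2 \<le> X" "x \<le> X"
    using 1 2 x by (auto simp: \<eta>_def X_def)
  define H where "H s y = halfline_cdf (v1 s) y - halfline_cdf (v2 s) y" for s y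
  have H_small: "\<bar>H s y\<bar> \<le> \<epsilon>" if s: "s \<in> {\<delta>..t}" and y: "y \<le> \<eta> \<or> X \<le> y" for s y
    using y
  proof
    assume "y \<le> \<eta>"
    then have "halfline_cdf (v1 s) y \<le> halfline_cdf (v1 s) \<eta>1" "halfline_cdf (v2 s) y \<le> halfline_cdf (v2 s) \<eta>2"
      using \<eta> by (auto intro!: monoD[OF halfline_cdf_bounds(1)] dens s)
    then show ?thesis
      using 1(2)[OF s] 2(2)[OF s] halfline_cdf_bounds(2)[OF dens(1)[OF s], of y]
        halfline_cdf_bounds(2)[OF dens(2)[OF s], of y] unfolding H_def abs_le_iff by linarith
  next
    assume "X \<le> y"
    then have "halfline_cdf (v1 s) X1 \<le> halfline_cdf (v1 s) y" "halfline_cdf (v2 s) X2 \<le> halfline_cdf (v2 s) y"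
      using X by (auto intro!: monoD[OF halfline_cdf_bounds(1)] dens s)
    then show ?thesis
      using 1(2)[OF s] 2(2)[OF s] halfline_cdf_bounds(3)[OF dens(1)[OF s], of y]
        halfline_cdf_bounds(3)[OF dens(2)[OF s], of y] unfolding H_def abs_le_iff by linarith
  qed
  define w where "w s y = v1 s y - v2 s y" for s y
  have X0: "0 < X" "\<eta> \<le> X" using x X \<eta> by auto
  have cont: "continuous_on ({0<..<T} \<times> {\<eta>..X + X}) (\<lambda>(t, x). v t x)" if "heat_density v T" for v
    using that X0 \<eta> by (intro separate_heat_continuous heat_density_separate_heat) auto
  have cont_x: "continuous_on {y..y + X} (v s)"
    if "heat_density v T" "s \<in> {\<delta>..t}" "y \<in> {\<eta>..X}" for v s y
  proof -
    have "continuous_on {y..y + X} ((\<lambda>(t, x). v t x) \<circ> (\<lambda>x. (s, x)))"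
      using that J by (intro continuous_on_compose continuous_intros continuous_on_subset[OF cont[OF that(1)]]) auto
    then show ?thesis by (simp add: o_def)
  qed
  have int: "integral {y..y + X} (w s) = H s (y + X) - H s y" if s: "s \<in> {\<delta>..t}" and y: "y \<in> {\<eta>..X}" for s y
  proof -
    have "integral {y..y + X} (w s) = integral {y..y + X} (v1 s) - integral {y..y + X} (v2 s)"
      unfolding w_def using cont_x[OF v1 s y] cont_x[OF v2 s y]
      by (intro Henstock_Kurzweil_Integration.integral_diff integrable_continuous_real)
    also have "\<dots> = H s (y + X) - H s y"
      using halfline_cdf_diff[OF dens(1)[OF s] _ _ cont_x[OF v1 s y]]
        halfline_cdf_diff[OF dens(2)[OF s] _ _ cont_x[OF v2 s y]] y \<eta> X0 by (simp add: H_def)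
    finally show ?thesis .
  qed
  have "integral {x..x + X} (w t) \<le> 2 * \<epsilon>"
  proof (rule heat_max_principle_average[of X \<eta> X \<delta> t])
    have "continuous_on ({\<delta>..t} \<times> {\<eta>..X + X}) (\<lambda>(t, x). v t x)" if "heat_density v T" for v
      using J by (intro continuous_on_subset[OF cont[OF that]]) auto
    from this[OF v1] this[OF v2] show "continuous_on ({\<delta>..t} \<times> {\<eta>..X + X}) (\<lambda>(t, x). w t x)"
      unfolding w_def case_prod_unfold by (intro continuous_on_diff)
    show "heat_at w s y" if "\<delta> < s" "s \<le> t" "\<eta> < y" "y < X + X" for s y
      unfolding w_def using v1 v2 that \<delta> \<eta> unfolding heat_density_def
      by (intro heat_at_diff) auto
    show "integral {y..y + X} (w \<delta>) \<le> 2 * \<epsilon>" if "y \<in> {\<eta>..X}" for y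
      using int[OF _ that, of \<delta>] init[of y] init[of "y + X"] \<delta> unfolding H_def abs_le_iff by auto
    \<comment> \<open>Both ends of both windows lie in the range of \<open>H_small\<close>, because
      \<open>\<eta> + X\<close> and \<open>X + X\<close> are at least \<open>X\<close>.\<close>
    show "integral {\<eta>..\<eta> + X} (w s) \<le> 2 * \<epsilon>" "integral {X..X + X} (w s) \<le> 2 * \<epsilon>" if s: "s \<in> {\<delta>..t}" for s
      using int[OF s, of \<eta>] int[OF s, of X] H_small[OF s, of \<eta>] H_small[OF s, of "\<eta> + X"]
        H_small[OF s, of X] H_small[OF s, of "X + X"] X0 \<eta> unfolding abs_le_iff by auto
  qed (use X0 \<delta> \<eta> X in auto)
  then show ?thesis
    \<comment> \<open>The third \<open>\<epsilon>\<close> removes the right end: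
      \<open>H t (x + X)\<close> is at least \<open>- \<epsilon>\<close>.\<close>
    using int[of t x] H_small[of t "x + X"] \<delta> \<eta> X x unfolding H_def abs_le_iff by auto
qed

text \<open>At the times \<open>d n\<close> both distribution functions are uniformly close to that
  of \<open>f\<close>, and the comparison carries this closeness to time \<open>t\<close>. The
  densities are then recovered as derivatives, \<open>v t\<close> being continuous at positive
  points.\<close>

theorem heat_density_unique:
  assumes v1: "heat_density v1 T" and v2: "heat_density v2 T" and f: "halfline_density f"
    and d: "\<And>n. d n \<in> {0<..<T}" "d \<longlonglongrightarrow> 0"
    and w1: "weak_conv_m (\<lambda>n. halfline_law (v1 (d n))) (halfline_law f)"
    and w2: "weak_conv_m (\<lambda>n. halfline_law (v2 (d n))) (halfline_law f)"
    and t: "t \<in> {0<..<T}" and x: "0 < x"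
  shows "v1 t x = v2 t x"
proof -
  have ev: "\<forall>\<^sub>F n in sequentially. \<forall>x. \<bar>halfline_cdf (v (d n)) x - halfline_cdf f x\<bar> \<le> \<epsilon> / 2"
    if v: "heat_density v T" and w: "weak_conv_m (\<lambda>n. halfline_law (v (d n))) (halfline_law f)" and \<epsilon>: "0 < \<epsilon>" for v \<epsilon>
  proof (rule distribution_functions_uniform)
    have dens: "halfline_density (v (d n))" for n using v d(1) unfolding heat_density_def by auto
    show "mono (halfline_cdf (v (d n)))" "halfline_cdf (v (d n)) x \<le> 1" "x \<le> 0 \<Longrightarrow> halfline_cdf (v (d n)) x = 0" for n x
      by (rule halfline_cdf_bounds[OF dens] | assumption)+
    show "(\<lambda>n. halfline_cdf (v (d n)) x) \<longlonglongrightarrow> halfline_cdf f x" for x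
      using w halfline_cdf_bounds(4)[OF f] unfolding weak_conv_m_def weak_conv_def by auto
  qed (use halfline_cdf_bounds[OF f] \<epsilon> in auto)
  have eq: "halfline_cdf (v1 t) y = halfline_cdf (v2 t) y" if y: "0 < y" for y
  proof -
    have close: "\<bar>halfline_cdf (v1 t) y - halfline_cdf (v2 t) y\<bar> \<le> 3 * \<epsilon>" if \<epsilon>: "0 < \<epsilon>" for \<epsilon>
    proof -
      have "\<forall>\<^sub>F n in sequentially. d n < t" using d(2) t by (intro order_tendstoD) auto
      from eventually_happens[OF eventually_conj[OF this eventually_conj[OF ev[OF v1 w1 \<epsilon>] ev[OF v2 w2 \<epsilon>]]]]
      obtain n where n: "d n < t" "\<And>x. \<bar>halfline_cdf (v1 (d n)) x - halfline_cdf f x\<bar> \<le> \<epsilon> / 2"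
        "\<And>x. \<bar>halfline_cdf (v2 (d n)) x - halfline_cdf f x\<bar> \<le> \<epsilon> / 2" by auto
      have i: "\<bar>halfline_cdf (v1 (d n)) x - halfline_cdf (v2 (d n)) x\<bar> \<le> \<epsilon>"
        "\<bar>halfline_cdf (v2 (d n)) x - halfline_cdf (v1 (d n)) x\<bar> \<le> \<epsilon>" for x
        using n(2,3)[of x] unfolding abs_le_iff by linarith+
      have "0 < d n" "d n \<le> t" "t < T" using d(1)[of n] n(1) t by auto
      from heat_density_cdf_compare[OF v1 v2 this y \<epsilon> i(1)] heat_density_cdf_compare[OF v2 v1 this y \<epsilon> i(2)]
      show ?thesis unfolding abs_le_iff by linarith
    qed
    have "\<bar>halfline_cdf (v1 t) y - halfline_cdf (v2 t) y\<bar> \<le> 0 + e" if "0 < e" for e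
      using close[of "e / 3"] that by simp
    then have "\<bar>halfline_cdf (v1 t) y - halfline_cdf (v2 t) y\<bar> \<le> 0" by (rule field_le_epsilon)
    then show ?thesis by simp
  qed
  have deriv: "((\<lambda>y. halfline_cdf (v t) y) has_real_derivative v t x) (at x)" if v: "heat_density v T" for v
  proof -
    have dens: "halfline_density (v t)" using v t unfolding heat_density_def by auto
    have cont: "continuous_on {x/2..2*x} (v t)"
      using v t x unfolding heat_density_def
      by (intro continuous_at_imp_continuous_on ballI DERIV_isCont[OF heat_at_DERIV(1)]) auto
    have "((\<lambda>y. integral {x/2..y} (v t)) has_real_derivative v t x) (at x within {x/2..2*x})"
      using x by (intro integral_has_real_derivative cont) auto
    moreover have "at x within {x/2..2*x} = at x" using x by (intro at_within_Icc_at) auto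
    ultimately have d: "((\<lambda>y. halfline_cdf (v t) (x/2) + integral {x/2..y} (v t)) has_real_derivative v t x) (at x)"
      by (auto intro!: derivative_eq_intros)
    have "\<forall>\<^sub>F y in nhds x. y \<in> {x/2<..<2*x}" using x by (intro eventually_nhds_in_open) auto
    then have "\<forall>\<^sub>F y in nhds x. halfline_cdf (v t) (x/2) + integral {x/2..y} (v t) = halfline_cdf (v t) y"
    proof eventually_elim
      fix y assume y: "y \<in> {x/2<..<2*x}"
      then have "integral {x/2..y} (v t) = halfline_cdf (v t) y - halfline_cdf (v t) (x/2)"
        using x by (intro halfline_cdf_diff[OF dens] continuous_on_subset[OF cont]) auto
      then show "halfline_cdf (v t) (x/2) + integral {x/2..y} (v t) = halfline_cdf (v t) y" by simp
    qed
    from iffD1[OF DERIV_cong_ev[OF refl this refl] d] show ?thesis .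
  qed
  have "\<forall>\<^sub>F y in nhds x. y \<in> {0<..}" using x by (intro eventually_nhds_in_open) auto
  then have "\<forall>\<^sub>F y in nhds x. halfline_cdf (v2 t) y = halfline_cdf (v1 t) y"
    by eventually_elim (simp add: eq)
  from iffD1[OF DERIV_cong_ev[OF refl this refl] deriv[OF v2]] show ?thesis
    by (rule DERIV_unique[OF deriv[OF v1]])
qed

section \<open>The heat semigroup with reflection at the origin\<close>

lemma integral_even_halfline:
  fixes k :: "real \<Rightarrow> real"
  assumes k: "integrable lborel k" and even: "\<And>x. k (- x) = k x"
  shows "(\<integral>x. indicator {0..} x * k x \<partial>lborel) = (\<integral>x. k x \<partial>lborel) / 2"
proof -
  have int: "integrable lborel (\<lambda>x. indicator S x * k x)" if "S \<in> sets borel" for S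
    using integrable_mult_indicator[OF _ k, of S] that by simp
  have "(\<integral>x. k x \<partial>lborel) = (\<integral>x. indicator {0..} x * k x + indicator {..<0} x * k x \<partial>lborel)"
    by (intro Bochner_Integration.integral_cong refl) (auto simp: indicator_def)
  also have "\<dots> = (\<integral>x. indicator {0..} x * k x \<partial>lborel) + (\<integral>x. indicator {..<0} x * k x \<partial>lborel)"
    by (intro Bochner_Integration.integral_add int) auto
  also have "(\<integral>x. indicator {..<0} x * k x \<partial>lborel) = (\<integral>x. indicator {..<0} (- x) * k (- x) \<partial>lborel)"
    using lborel_integral_real_affine[of "-1" "\<lambda>x. indicator {..<0} x * k x" 0] by simp
  also have "\<dots> = (\<integral>x. indicator {0..} x * k x \<partial>lborel)"
  proof (rule integral_cong_AE)
    have "AE x in lborel. x \<noteq> (0::real)" by (rule AE_lborel_singleton)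
    then show "AE x in lborel. indicator {..<0} (- x) * k (- x) = indicator {0..} x * k x"
      by eventually_elim (auto simp: even indicator_def)
    have "(\<lambda>x. indicator {0<..} x * k x) \<in> borel_measurable lborel"
      using int[of "{0<..}"] by auto
    moreover have "(\<lambda>x. indicator {..<0} (- x) * k (- x)) = (\<lambda>x. indicator {0<..} x * k x)"
      by (auto simp: even indicator_def)
    ultimately show "(\<lambda>x. indicator {..<0} (- x) * k (- x)) \<in> borel_measurable lborel" by simp
    show "(\<lambda>x. indicator {0..} x * k x) \<in> borel_measurable lborel"
      using int[of "{0..}"] by auto
  qed
  finally show ?thesis by simp
qed

text \<open>The total mass is 2, so that the half-line gets mass 1. At 0 both summands contribute,
  which affects a null set only.\<close>

definition even_ext :: "(real \<Rightarrow> real) \<Rightarrow> real \<Rightarrow> real" where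
  "even_ext f y = indicator {0..} y * f y + indicator {0..} (- y) * f (- y)"

abbreviation neumann_heat :: "(real \<Rightarrow> real) \<Rightarrow> real \<Rightarrow> real \<Rightarrow> real" where
  "neumann_heat f \<equiv> heat_ext (even_ext f)"

context
  fixes f :: "real \<Rightarrow> real"
  assumes f: "halfline_density f"
begin

lemma even_ext_integrable: "integrable lborel (even_ext f)"
proof -
  have "integrable lborel (\<lambda>y. indicator {0..} (0 + - 1 * y) * f (0 + - 1 * y))"
    by (rule lborel_integrable_real_affine[OF halfline_densityD(1)[OF f]]) simp
  from Bochner_Integration.integrable_add[OF halfline_densityD(1)[OF f] this]
  show ?thesis by (simp add: even_ext_def[abs_def])
qed

lemma even_ext_nonneg: "0 \<le> even_ext f y"
  unfolding even_ext_def using halfline_densityD(2)[OF f] by (simp add: add_nonneg_nonneg)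

lemma even_ext_integral:
  assumes h: "h \<in> borel_measurable borel" "\<And>y. \<bar>h y\<bar> \<le> B" and even: "\<And>y. h (- y) = h y"
  shows "(\<integral>y. even_ext f y * h y \<partial>lborel) = 2 * (\<integral>y. indicator {0..} y * f y * h y \<partial>lborel)"
proof -
  let ?G = "\<lambda>y. indicator {0..} y * f y"
  have i1: "integrable lborel (\<lambda>y. ?G y * h y)"
    by (rule integrable_times_bounded[OF halfline_densityD(1)[OF f] h(2,1)])
  have i2: "integrable lborel (\<lambda>y. ?G (- y) * h (- y))"
    using lborel_integrable_real_affine[OF i1, of "-1" 0] by simp
  have "(\<integral>y. even_ext f y * h y \<partial>lborel) = (\<integral>y. ?G y * h y + ?G (- y) * h (- y) \<partial>lborel)"
    by (simp add: even_ext_def even distrib_right)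
  also have "\<dots> = (\<integral>y. ?G y * h y \<partial>lborel) + (\<integral>y. ?G (- y) * h (- y) \<partial>lborel)"
    by (rule Bochner_Integration.integral_add[OF i1 i2])
  also have "(\<integral>y. ?G (- y) * h (- y) \<partial>lborel) = (\<integral>y. ?G y * h y \<partial>lborel)"
    using lborel_integral_real_affine[of "-1" "\<lambda>y. ?G y * h y" 0] by simp
  finally show ?thesis by simp
qed

lemma neumann_heat_even: "neumann_heat f a (- x) = neumann_heat f a x"
proof -
  have "neumann_heat f a (- x) = (\<integral>y. even_ext f (- y) * heat_kernel a (- x - - y) \<partial>lborel)"
    unfolding heat_ext_def
    using lborel_integral_real_affine[of "-1" "\<lambda>y. even_ext f y * heat_kernel a (- x - y)" 0] by simp
  also have "\<dots> = neumann_heat f a x"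
    unfolding heat_ext_def
    by (intro Bochner_Integration.integral_cong refl)
       (auto simp: even_ext_def heat_kernel_def normal_density_def power2_commute)
  finally show ?thesis .
qed

text \<open>Evenness halves the integral over the line, and duality moves the semigroup onto
  \<open>h\<close>. The choice \<open>h = 1\<close> is conservation of mass.\<close>

lemma neumann_heat_halfline_integral:
  assumes a: "a > 0" and h: "h \<in> borel_measurable borel" "\<And>y. \<bar>h y\<bar> \<le> B" and even: "\<And>y. h (- y) = h y"
  shows "integrable lborel (\<lambda>x. indicator {0..} x * neumann_heat f a x * h x)"
    "(\<integral>x. indicator {0..} x * neumann_heat f a x * h x \<partial>lborel) = (\<integral>y. even_ext f y * gauss_avg h a y \<partial>lborel) / 2"
proof -
  note dual = heat_ext_dual[OF h even_ext_integrable a]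
  show "integrable lborel (\<lambda>x. indicator {0..} x * neumann_heat f a x * h x)"
    using integrable_mult_indicator[OF _ dual(1), of "{0..}"] by (simp add: mult.assoc)
  show "(\<integral>x. indicator {0..} x * neumann_heat f a x * h x \<partial>lborel) = (\<integral>y. even_ext f y * gauss_avg h a y \<partial>lborel) / 2"
    using integral_even_halfline[OF dual(1)] dual(2) by (simp add: neumann_heat_even even mult.assoc)
qed

lemma neumann_heat_halfline_density:
  assumes a: "a > 0"
  shows "halfline_density (neumann_heat f a)"
proof -
  have nn: "0 \<le> neumann_heat f a x" for x
    unfolding heat_ext_def using even_ext_nonneg heat_kernel_nonneg by simp
  note I = neumann_heat_halfline_integral[OF a, of "\<lambda>_. 1" 1, simplified]
  have "(\<integral>x. indicator {0..} x * neumann_heat f a x \<partial>lborel) = 1"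
    using I(2) even_ext_integral[of "\<lambda>_. 1" 1] halfline_densityD(3)[OF f] by (simp add: gauss_avg_def)
  then show ?thesis using nn I(1)
    unfolding halfline_density_def set_integrable_def set_lebesgue_integral_def by simp
qed

lemma neumann_heat_heat_density: "heat_density (neumann_heat f) T"
  unfolding heat_density_def
  using neumann_heat_halfline_density heat_ext_heat_at(2)[OF even_ext_integrable] by auto

text \<open>The derivative of an even function at 0 equals its own negative.\<close>

lemma neumann_heat_boundary:
  assumes a: "a > 0"
  shows "(neumann_heat f a has_real_derivative 0) (at 0)"
proof -
  obtain D where D: "(neumann_heat f a has_real_derivative D) (at 0)"
    using heat_ext_heat_at(1)[OF even_ext_integrable a] by blast
  have "((\<lambda>x. neumann_heat f a (- x)) has_real_derivative D * - 1) (at 0)"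
    by (rule DERIV_chain2[of "neumann_heat f a" D uminus 0]) (use D in \<open>auto intro!: derivative_eq_intros\<close>)
  then have "(neumann_heat f a has_real_derivative D * - 1) (at 0)" by (simp add: neumann_heat_even)
  from DERIV_unique[OF D this] D show ?thesis by simp
qed

lemma neumann_heat_weak_conv:
  assumes a: "\<And>n. 0 < a n" "a \<longlonglongrightarrow> 0"
  shows "weak_conv_m (\<lambda>n. halfline_law (neumann_heat f (a n))) (halfline_law f)"
proof (rule integral_bdd_continuous_conv_imp_weak_conv)
  show "real_distribution (halfline_law (neumann_heat f (a n)))" for n
    by (rule measure_halfline_law(1)[OF neumann_heat_halfline_density[OF a(1)]])
  show "real_distribution (halfline_law f)" by (rule measure_halfline_law(1)[OF f])
  fix h :: "real \<Rightarrow> real" assume cont: "\<And>x. isCont h x" and bdd: "\<And>x. \<bar>h x\<bar> \<le> 1"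
  have h_cont: "continuous_on UNIV h" using cont by (simp add: continuous_at_imp_continuous_on)
  have h_meas: "h \<in> borel_measurable borel" using h_cont by (rule borel_measurable_continuous_onI)
  \<comment> \<open>The laws see \<open>h\<close> on the half-line only; the even version agrees
    there, stays continuous and satisfies the symmetry that duality asks for.\<close>
  define k where "k x = h \<bar>x\<bar>" for x
  have k_cont: "continuous_on UNIV k"
    unfolding k_def by (intro continuous_on_compose2[OF h_cont] continuous_intros) auto
  then have k_meas: "k \<in> borel_measurable borel" by (rule borel_measurable_continuous_onI)
  have k: "\<bar>k x\<bar> \<le> 1" "k (- x) = k x" for x using bdd by (auto simp: k_def)
  have restrict: "integral\<^sup>L (halfline_law m) h = (\<integral>x. indicator {0..} x * m x * k x \<partial>lborel)"
    if "halfline_density m" for m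
    unfolding measure_halfline_law(3)[OF that h_meas]
    by (intro Bochner_Integration.integral_cong refl) (auto simp: k_def indicator_def)
  have "(\<lambda>n. \<integral>y. even_ext f y * gauss_avg k (a n) y \<partial>lborel) \<longlonglongrightarrow> (\<integral>y. even_ext f y * k y \<partial>lborel)"
  proof (rule integral_dominated_convergence[where w = "\<lambda>y. even_ext f y"])
    have gm: "(\<lambda>y. even_ext f y * gauss_avg k (a n) y) \<in> borel_measurable lborel" for n
    proof -
      have "continuous_on UNIV (\<lambda>y. gauss_avg k (a n) y)"
      proof -
        have "continuous_on UNIV ((\<lambda>(a, x). gauss_avg k a x) \<circ> (\<lambda>y. (a n, y)))"
          using a(1)[of n] by (intro continuous_on_compose continuous_intros
            continuous_on_subset[OF continuous_on_gauss_avg[OF k_meas k(1) k_cont]]) auto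
        then show ?thesis by (simp add: o_def)
      qed
      then have "gauss_avg k (a n) \<in> borel_measurable borel" by (rule borel_measurable_continuous_onI)
      then show ?thesis using integrable_lborel_measurable[OF even_ext_integrable] by simp
    qed
    then show "(\<lambda>y. even_ext f y * gauss_avg k (a n) y) \<in> borel_measurable lborel" for n .
    show "(\<lambda>y. even_ext f y * k y) \<in> borel_measurable lborel"
      using integrable_lborel_measurable[OF even_ext_integrable] k_meas by simp
    show "AE y in lborel. norm (even_ext f y * gauss_avg k (a n) y) \<le> even_ext f y" for n
      using gauss_avg_le[OF k_meas k(1), of "a n"] even_ext_nonneg
      by (auto simp: abs_mult intro!: mult_left_le)
    show "AE y in lborel. (\<lambda>n. even_ext f y * gauss_avg k (a n) y) \<longlonglongrightarrow> even_ext f y * k y"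
    proof (intro AE_I2 tendsto_mult tendsto_const)
      fix y :: real
      have "(\<lambda>n. (a n, y)) \<longlonglongrightarrow> (0, y)" using a(2) by (intro tendsto_intros)
      from continuous_on_tendsto_compose[OF continuous_on_gauss_avg[OF k_meas k(1) k_cont] this]
      show "(\<lambda>n. gauss_avg k (a n) y) \<longlonglongrightarrow> k y" using a(1) by (simp add: less_imp_le)
    qed
  qed (rule even_ext_integrable)
  then have "(\<lambda>n. (\<integral>y. even_ext f y * gauss_avg k (a n) y \<partial>lborel) / 2)
      \<longlonglongrightarrow> (\<integral>y. even_ext f y * k y \<partial>lborel) / 2"
    by (intro tendsto_divide tendsto_const) auto
  moreover have "integral\<^sup>L (halfline_law (neumann_heat f (a n))) h
      = (\<integral>y. even_ext f y * gauss_avg k (a n) y \<partial>lborel) / 2" for n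
    unfolding restrict[OF neumann_heat_halfline_density[OF a(1)]]
    by (rule neumann_heat_halfline_integral(2)[OF a(1) k_meas k])
  moreover have "(\<integral>y. even_ext f y * k y \<partial>lborel) / 2 = integral\<^sup>L (halfline_law f) h"
    unfolding restrict[OF f] even_ext_integral[OF k_meas k] by simp
  ultimately show "(\<lambda>n. integral\<^sup>L (halfline_law (neumann_heat f (a n))) h) \<longlonglongrightarrow> integral\<^sup>L (halfline_law f) h"
    by (simp only:)
qed

text \<open>The even extension has mass 2, so \<open>heat_ext_le\<close> gives
  \<open>2 / sqrt (2 * pi * a)\<close>, and \<open>4 \<le> 2 * pi\<close>. This singularity is
  integrable and is the source of \<open>L a \<le> sqrt a\<close>.\<close>

lemma neumann_heat_trace_bounds:
  assumes a: "a > 0"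
  shows "0 \<le> neumann_heat f a 0" "neumann_heat f a 0 \<le> 1 / sqrt a" "isCont (\<lambda>a. neumann_heat f a 0) a"
proof -
  show "isCont (\<lambda>a. neumann_heat f a 0) a" by (rule heat_at_isCont[OF heat_ext_heat_at(2)[OF even_ext_integrable a]])
  show "0 \<le> neumann_heat f a 0" unfolding heat_ext_def using even_ext_nonneg heat_kernel_nonneg by simp
  have m: "(\<integral>y. \<bar>even_ext f y\<bar> \<partial>lborel) = 2"
    using even_ext_integral[of "\<lambda>_. 1" 1] halfline_densityD(3)[OF f] even_ext_nonneg by simp
  have "neumann_heat f a 0 \<le> 2 / sqrt (2 * pi * a)"
    using heat_ext_le[OF even_ext_integrable a, of 0] m by auto
  also have "sqrt (2 * pi * a) = sqrt (2 * pi) * sqrt a" by (simp add: real_sqrt_mult)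
  also have "2 / (sqrt (2 * pi) * sqrt a) \<le> 1 / sqrt a"
  proof -
    have "2 = sqrt 4" by simp
    also have "\<dots> \<le> sqrt (2 * pi)" using pi_ge_two by (intro real_sqrt_le_mono) simp
    finally show ?thesis using a by (simp add: field_simps)
  qed
  finally show "neumann_heat f a 0 \<le> 1 / sqrt a" .
qed

end

section \<open>Antiderivatives and autonomous flows\<close>

text \<open>Normalising an antiderivative by its infimum avoids integrating the singularity at 0.\<close>

lemma antiderivative_on_Ioi:
  fixes h :: "real \<Rightarrow> real"
  assumes h: "\<And>a. 0 < a \<Longrightarrow> isCont h a" "\<And>a. 0 < a \<Longrightarrow> 0 \<le> h a" "\<And>a. 0 < a \<Longrightarrow> h a \<le> C / sqrt a"
  obtains L where "L 0 = 0" "\<And>a. 0 < a \<Longrightarrow> (L has_real_derivative h a) (at a)"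
    "\<And>a. 0 \<le> a \<Longrightarrow> 0 \<le> L a" "\<And>a. 0 \<le> a \<Longrightarrow> L a \<le> 2 * C * sqrt a"
proof -
  have "\<exists>F. \<forall>x::real. ereal 0 < ereal x \<longrightarrow> ereal x < \<infinity> \<longrightarrow> (F has_vector_derivative h x) (at x)"
    using h(1) by (intro einterval_antiderivative) auto
  then obtain M where "\<forall>x::real. ereal 0 < ereal x \<longrightarrow> ereal x < \<infinity> \<longrightarrow> (M has_vector_derivative h x) (at x)" ..
  then have M: "(M has_real_derivative h x) (at x)" if "0 < x" for x
    using that by (simp add: has_real_derivative_iff_has_vector_derivative)
  \<comment> \<open>An antiderivative of the majorant \<open>C / sqrt x\<close>, compared with
    \<open>M\<close>: the difference is nondecreasing.\<close>
  have sq: "((\<lambda>x. 2 * C * sqrt x - M x) has_real_derivative C / sqrt x - h x) (at x)" if "0 < x" for x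
    using that by (auto intro!: derivative_eq_intros M simp: field_simps)
  have incr: "M b \<le> M a" if "0 < b" "b \<le> a" for a b
    using that h(2) by (intro DERIV_nonneg_imp_nondecreasing[of b a M]) (auto intro!: M exI)
  have growth: "M a - M b \<le> 2 * C * sqrt a" if "0 < b" "b \<le> a" for a b
  proof -
    have "2 * C * sqrt b - M b \<le> 2 * C * sqrt a - M a"
      using that h(3) by (intro DERIV_nonneg_imp_nondecreasing[of b a "\<lambda>x. 2 * C * sqrt x - M x"])
        (auto intro!: exI[of _ "C / sqrt _ - h _"] sq)
    moreover have "0 \<le> C" using h(2,3)[of 1] by simp
    then have "0 \<le> 2 * C * sqrt b" using that by simp
    ultimately show ?thesis by linarith
  qed
  have bdd: "bdd_below (M ` {0<..})"
  proof (rule bdd_belowI)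
    fix y assume "y \<in> M ` {0<..}"
    then obtain b where b: "0 < b" "y = M b" by auto
    show "M 1 - 2 * C * sqrt 1 \<le> y"
    proof (cases "b \<le> 1")
      case True then show ?thesis using growth[of b 1] b by simp
    next
      case False
      have "0 \<le> C" using h(2,3)[of 1] by simp
      then show ?thesis using incr[of 1 b] b False by simp
    qed
  qed
  \<comment> \<open>As \<open>M\<close> is nondecreasing, this is its limit at 0 from the
    right.\<close>
  define m where "m = Inf (M ` {0<..})"
  define L where "L a = (if a = 0 then 0 else M a - m)" for a
  have L_le: "L a \<le> 2 * C * sqrt a" if "0 < a" for a
  proof -
    have "M a - 2 * C * sqrt a \<le> m" unfolding m_def
    proof (rule cInf_greatest)
      fix y assume "y \<in> M ` {0<..}"
      then obtain b where b: "0 < b" "y = M b" by auto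
      show "M a - 2 * C * sqrt a \<le> y"
      proof (cases "b \<le> a")
        case True then show ?thesis using growth[of b a] b by simp
      next
        case False
        then have "M a \<le> y" using incr[of a b] b that by simp
        moreover have "0 \<le> C" using h(2,3)[of 1] by simp
        then have "0 \<le> 2 * C * sqrt a" using that by simp
        ultimately show ?thesis by linarith
      qed
    qed auto
    then show ?thesis using that by (simp add: L_def)
  qed
  show ?thesis
  proof (rule that[of L])
    show "L 0 = 0" by (simp add: L_def)
    show "(L has_real_derivative h a) (at a)" if a: "0 < a" for a
    proof -
      have "\<forall>\<^sub>F y in nhds a. y \<in> {0<..}" using a by (intro eventually_nhds_in_open) auto
      then have ev: "\<forall>\<^sub>F y in nhds a. M y - m = L y" by eventually_elim (simp add: L_def)
      have "((\<lambda>y. M y - m) has_real_derivative h a) (at a)"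
        using M[OF a] by (auto intro!: derivative_eq_intros)
      from iffD1[OF DERIV_cong_ev[OF refl ev refl] this] show ?thesis .
    qed
    show "0 \<le> L a" if "0 \<le> a" for a
      using cInf_lower[OF _ bdd, of "M a"] that by (auto simp: L_def m_def)
    show "L a \<le> 2 * C * sqrt a" if "0 \<le> a" for a
      using L_le[of a] that by (cases "a = 0") (auto simp: L_def)
  qed
qed

section \<open>Clocks: separation of variables and integral equations\<close>

lemma antiderivative_on_UNIV:
  fixes k :: "real \<Rightarrow> real"
  assumes "\<And>x. isCont k x"
  obtains G where "G 0 = 0" "\<And>x. (G has_real_derivative k x) (at x)"
proof -
  have "\<exists>F. \<forall>x::real. -\<infinity> < ereal x \<longrightarrow> ereal x < \<infinity> \<longrightarrow> (F has_vector_derivative k x) (at x)"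
    using assms by (intro einterval_antiderivative) auto
  then obtain F where "\<forall>x::real. -\<infinity> < ereal x \<longrightarrow> ereal x < \<infinity> \<longrightarrow> (F has_vector_derivative k x) (at x)" ..
  then have F: "(F has_real_derivative k x) (at x)" for x
    by (simp add: has_real_derivative_iff_has_vector_derivative)
  show ?thesis
    by (rule that[of "\<lambda>x. F x - F 0"]) (auto intro!: derivative_eq_intros F)
qed

lemma positive_derivative_strict_mono:
  fixes G :: "real \<Rightarrow> real"
  assumes "\<And>x. (G has_real_derivative k x) (at x)" "\<And>x. 0 < k x"
  shows "strict_mono G"
proof (rule strict_monoI)
  fix x y :: real assume "x < y"
  then show "G x < G y"
  proof (rule DERIV_pos_imp_increasing)
    fix z show "\<exists>d. (G has_real_derivative d) (at z) \<and> 0 < d"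
      using assms(1)[of z] assms(2)[of z] by blast
  qed
qed

text \<open>The range of \<open>G\<close> may be a proper interval. Placing \<open>y\<close>
  strictly between two values makes \<open>inv G\<close> a genuine inverse near
  \<open>y\<close>.\<close>

lemma inverse_has_derivative:
  fixes G :: "real \<Rightarrow> real"
  assumes G: "\<And>x. (G has_real_derivative k x) (at x)" "\<And>x. 0 < k x"
    and y: "G a < y" "y < G b"
  shows "G (inv G y) = y" "(inv G has_real_derivative inverse (k (inv G y))) (at y)"
proof -
  have mono: "strict_mono G" using positive_derivative_strict_mono[OF G] .
  then have inj: "inj G" by (rule strict_mono_imp_inj_on)
  have ab: "a < b" using y mono by (metis less_trans strict_mono_less)
  have range: "\<exists>x. G x = z" if "G a \<le> z" "z \<le> G b" for z
    using IVT'[of G a z b] that ab G(1)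
    by (metis DERIV_isCont continuous_at_imp_continuous_on less_imp_le)
  then have GG: "G (inv G z) = z" if "G a \<le> z" "z \<le> G b" for z using that by (metis f_inv_into_f rangeI)
  then show "G (inv G y) = y" using y by simp
  have "isCont (inv G) (G (inv G y))"
    by (rule isCont_inverse_function[of 1]) (auto simp: inj intro: DERIV_isCont[OF G(1)])
  then have "isCont (inv G) y" using GG y by simp
  then show "(inv G has_real_derivative inverse (k (inv G y))) (at y)"
    using y G(2)[of "inv G y"] GG
    by (intro DERIV_inverse_function[where f = G and g = "inv G" and a = "G a" and b = "G b"] G(1)) auto
qed

text \<open>\<open>G\<close> integrates \<open>1 / k\<close> and \<open>A\<close> is its inverse.
  Linear growth forces \<open>G x \<ge> ln (1 + x) / K\<close>, so there is no explosion; constancy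
  left of 0 makes \<open>G\<close> unbounded below as well. Thus \<open>A\<close> lives on the whole
  line, with a two-sided derivative at 0.\<close>

lemma autonomous_flow:
  fixes k :: "real \<Rightarrow> real"
  assumes k: "\<And>x. isCont k x" "\<And>x. 0 < k x" and growth: "\<And>x. 0 \<le> x \<Longrightarrow> k x \<le> K * (1 + x)"
    and left: "\<And>x. x \<le> 0 \<Longrightarrow> k x = k 0"
  obtains G A where "G 0 = 0" "\<And>x. (G has_real_derivative 1 / k x) (at x)" "\<And>t. G (A t) = t"
    "\<And>x. A (G x) = x" "\<And>t. (A has_real_derivative k (A t)) (at t)"
proof -
  have "isCont (\<lambda>x. 1 / k x) x" for x using k(1)[of x] k(2)[of x] by (intro continuous_intros) auto
  then obtain G where G: "G 0 = 0" "\<And>x. (G has_real_derivative 1 / k x) (at x)"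
    by (rule antiderivative_on_UNIV) (rule that)
  have pos: "0 < 1 / k x" for x using k(2) by simp
  have K: "0 < K" using growth[of 0] k(2)[of 0] by simp
  have up: "ln (1 + x) / K \<le> G x" if "0 \<le> x" for x
  proof -
    have "G 0 - ln (1 + 0) / K \<le> G x - ln (1 + x) / K"
    proof (rule DERIV_nonneg_imp_nondecreasing[OF that])
      fix y :: real assume y: "0 \<le> y" "y \<le> x"
      have "((\<lambda>x. G x - ln (1 + x) / K) has_real_derivative 1 / k y - 1 / (1 + y) / K) (at y)"
        using y K by (auto intro!: derivative_eq_intros G)
      moreover have "1 / (K * (1 + y)) \<le> 1 / k y"
        using growth[OF y(1)] k(2)[of y] K y by (intro divide_left_mono) auto
      ultimately show "\<exists>z. ((\<lambda>x. G x - ln (1 + x) / K) has_real_derivative z) (at y) \<and> 0 \<le> z"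
        by (intro exI[of _ "1 / k y - 1 / (1 + y) / K"]) (simp add: mult.commute)
    qed
    then show ?thesis by (simp add: G(1))
  qed
  have down: "G x \<le> x / k 0" if "x \<le> 0" for x
  proof -
    have "G x - x / k 0 \<le> G 0 - 0 / k 0"
    proof (rule DERIV_nonneg_imp_nondecreasing[OF that])
      fix y :: real assume y: "x \<le> y" "y \<le> 0"
      have "((\<lambda>x. G x - x / k 0) has_real_derivative 1 / k y - 1 / k 0) (at y)"
        using k(2)[of 0] by (auto intro!: derivative_eq_intros G)
      then show "\<exists>z. ((\<lambda>x. G x - x / k 0) has_real_derivative z) (at y) \<and> 0 \<le> z"
        using left[OF y(2)] by auto
    qed
    then show ?thesis by (simp add: G(1))
  qed
  have range: "\<exists>a b. G a < t \<and> t < G b" for t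
  proof -
    \<comment> \<open>Chosen so that the lower bound \<open>ln (1 + b) / K\<close> equals
      \<open>\<bar>t\<bar> + 1\<close>; below, \<open>a / k 0\<close> is the negative of the same
      number.\<close>
    define b where "b = exp (K * (\<bar>t\<bar> + 1)) - 1"
    have "0 \<le> b" using K by (simp add: b_def)
    from up[OF this] have "t < G b" using K by (simp add: b_def)
    moreover define a where "a = - (k 0 * (\<bar>t\<bar> + 1))"
    have "a \<le> 0" using k(2)[of 0] by (simp add: a_def)
    from down[OF this] have "G a < t" using k(2)[of 0] by (simp add: a_def)
    ultimately show ?thesis by blast
  qed
  have inj: "inj G" using positive_derivative_strict_mono[OF G(2) pos] by (rule strict_mono_imp_inj_on)
  show ?thesis
  proof (rule that[of G "inv G"])
    show "G (inv G t) = t" for t using range[of t] inverse_has_derivative(1)[OF G(2) pos] by blast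
    show "inv G (G x) = x" for x using inj by simp
    show "(inv G has_real_derivative k (inv G t)) (at t)" for t
      using range[of t] inverse_has_derivative(2)[OF G(2) pos] by fastforce
  qed (use G in auto)
qed

text \<open>The integrand may be unbounded at 0; nonnegativity lets the improper fundamental theorem
  deliver integrability along with the value. It covers the open interval, and the endpoint
  \<open>t\<close> is added as a null set.\<close>

lemma FTC_Ioc_nonneg:
  fixes F g :: "real \<Rightarrow> real"
  assumes t: "0 < t" and F: "\<And>s. 0 < s \<Longrightarrow> (F has_real_derivative g s) (at s)"
    and g: "\<And>s. 0 < s \<Longrightarrow> isCont g s" "\<And>s. 0 < s \<Longrightarrow> 0 \<le> g s"
    and F0: "(F \<longlongrightarrow> F 0) (at_right 0)"
  shows "set_integrable lborel {0<..t} g" "(LBINT s:{0<..t}. g s) = F t - F 0"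
proof -
  have lim: "((F \<circ> real_of_ereal) \<longlongrightarrow> F 0) (at_right (ereal 0))" "((F \<circ> real_of_ereal) \<longlongrightarrow> F t) (at_left (ereal t))"
    unfolding ereal_tendsto_simps1
    using F0 DERIV_isCont[OF F[OF t]] unfolding isCont_def by (auto intro: tendsto_within_subset)
  have "ereal 0 < ereal t" using t by simp
  note FTC = interval_integral_FTC_nonneg[OF this F g(1) _ lim]
  have ein: "einterval (ereal 0) (ereal t) = {0<..<t}" by (auto simp: einterval_def)
  have int: "integrable lborel (\<lambda>s. indicator {0<..<t} s *\<^sub>R g s)"
    using FTC(1) g(2) unfolding ein set_integrable_def by auto
  have val: "(\<integral>s. indicator {0<..<t} s *\<^sub>R g s \<partial>lborel) = F t - F 0"
    using FTC(2) g(2) t unfolding interval_lebesgue_integral_def ein set_lebesgue_integral_def by auto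
  have eq: "(\<lambda>s. indicator {0<..t} s *\<^sub>R g s) = (\<lambda>s. indicator {0<..<t} s *\<^sub>R g s + indicator {t} s * g t)"
    using t by (auto simp: fun_eq_iff indicator_def)
  have pt: "integrable lborel (\<lambda>s. indicator {t} s * g t)"
    "(\<integral>s. indicator {t} s * g t \<partial>lborel) = 0" by auto
  show "set_integrable lborel {0<..t} g"
    unfolding set_integrable_def eq by (intro Bochner_Integration.integrable_add int pt)
  show "(LBINT s:{0<..t}. g s) = F t - F 0"
    unfolding set_lebesgue_integral_def eq
    by (subst Bochner_Integration.integral_add[OF int pt(1)]) (simp only: val pt add_0_right)
qed

text \<open>The source of continuity of \<open>ell\<close> for an arbitrary solution, of which only
  the integral equation is known.\<close>

lemma continuous_on_indefinite_integral_Ioc: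
  fixes \<phi> :: "real \<Rightarrow> real"
  assumes "\<And>t. 0 \<le> t \<Longrightarrow> set_integrable lborel {0<..t} \<phi>"
  shows "continuous_on {0..} (\<lambda>t. LBINT s:{0<..t}. \<phi> s)"
proof -
  have cont: "continuous_on {0..b} (\<lambda>t. LBINT s:{0<..t}. \<phi> s)" if b: "0 \<le> b" for b
  proof -
    define \<psi> where "\<psi> s = indicator {0<..b} s * \<phi> s" for s
    have \<psi>: "integrable lborel \<psi>" using assms[OF b] by (simp add: set_integrable_def \<psi>_def[abs_def])
    have si: "set_integrable lborel {0..t} \<psi>" for t
      unfolding set_integrable_def using integrable_mult_indicator[OF _ \<psi>] by simp
    have "(LBINT s:{0<..t}. \<phi> s) = integral {0..t} \<psi>" if "t \<in> {0..b}" for t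
    proof -
      have "(LBINT s:{0<..t}. \<phi> s) = (LBINT s:{0..t}. \<psi> s)"
        unfolding set_lebesgue_integral_def \<psi>_def using that
        by (intro Bochner_Integration.integral_cong refl) (auto simp: indicator_def)
      then show ?thesis using set_borel_integral_eq_integral(2)[OF si] by simp
    qed
    then show ?thesis
      by (intro continuous_on_eq[OF indefinite_integral_continuous_1[OF
            set_borel_integral_eq_integral(1)[OF si]]]) simp
  qed
  show ?thesis unfolding continuous_on_eq_continuous_within
  proof
    fix x :: real assume x: "x \<in> {0..}"
    have "continuous (at x within {0..x+1}) (\<lambda>t. LBINT s:{0<..t}. \<phi> s)"
      using cont[of "x + 1"] x by (auto simp: continuous_on_eq_continuous_within)
    moreover have "at x within {0..x+1} = at x within {0..}"
      using x by (intro at_within_nhd[of _ "{..<x+1}"]) auto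
    ultimately show "continuous (at x within {0..}) (\<lambda>t. LBINT s:{0<..t}. \<phi> s)" by simp
  qed
qed

section \<open>Time change and the free boundary\<close>

lemma heat_at_deriv_deriv:
  assumes "heat_at v t x"
  shows "(deriv (v t) has_real_derivative deriv (deriv (v t)) x) (at x)"
    "((\<lambda>s. v s x) has_real_derivative deriv (deriv (v t)) x / 2) (at t)"
proof -
  obtain z1 z2 where z: "\<forall>\<^sub>F y in nhds x. (v t has_real_derivative z1 y) (at y)"
    "(z1 has_real_derivative z2) (at x)" "((\<lambda>s. v s x) has_real_derivative z2 / 2) (at t)"
    using assms unfolding heat_at_def by blast
  have ev: "\<forall>\<^sub>F y in nhds x. z1 y = deriv (v t) y"
    using z(1) by eventually_elim (rule DERIV_imp_deriv[symmetric])
  from iffD1[OF DERIV_cong_ev[OF refl ev refl] z(2)]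
  have d: "(deriv (v t) has_real_derivative z2) (at x)" .
  then have "deriv (deriv (v t)) x = z2" by (rule DERIV_imp_deriv)
  then show "(deriv (v t) has_real_derivative deriv (deriv (v t)) x) (at x)"
    "((\<lambda>s. v s x) has_real_derivative deriv (deriv (v t)) x / 2) (at t)"
    using d z(3) by auto
qed

lemma heat_atI:
  assumes "\<And>y. 0 < y \<Longrightarrow> v t differentiable at y" "0 < x" "deriv (v t) differentiable at x"
    and "((\<lambda>s. v s x) has_real_derivative deriv (deriv (v t)) x / 2) (at t)"
  shows "heat_at v t x"
proof -
  have d: "(h has_real_derivative deriv h y) (at y)" if "h differentiable at y" for h :: "real \<Rightarrow> real" and y
    using that by (metis DERIV_imp_deriv real_differentiableE)
  have "\<forall>\<^sub>F y in nhds x. y \<in> {0<..}" using assms(2) by (intro eventually_nhds_in_open) auto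
  then have "\<forall>\<^sub>F y in nhds x. (v t has_real_derivative deriv (v t) y) (at y)"
    by eventually_elim (use d assms(1) in auto)
  then show ?thesis unfolding heat_at_def
    using d[OF assms(3)] assms(4) by blast
qed

lemma classical_solutionD:
  assumes "classical_solution \<sigma> f q l"
  shows "\<And>t. 0 < t \<Longrightarrow> halfline_density (q t)"
    "\<And>t. 0 \<le> t \<Longrightarrow> 0 \<le> l t"
    "\<And>t x. 0 < t \<Longrightarrow> 0 < x \<Longrightarrow> q t differentiable at x"
    "\<And>t x. 0 < t \<Longrightarrow> 0 < x \<Longrightarrow> deriv (q t) differentiable at x"
    "\<And>t x. 0 < t \<Longrightarrow> 0 < x \<Longrightarrow> ((\<lambda>s. q s x) has_real_derivative
           1 / 2 * (\<sigma> (l t))\<^sup>2 * deriv (deriv (q t)) x) (at t)"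
    "\<And>t. 0 < t \<Longrightarrow> (q t has_real_derivative 0) (at_right 0)"
    "\<And>t. 0 \<le> t \<Longrightarrow> set_integrable lborel {0<..t} (\<lambda>s. q s 0 * (\<sigma> (l s))\<^sup>2)"
    "\<And>t. 0 \<le> t \<Longrightarrow> l t = 1 / 2 * (LBINT s:{0<..t}. q s 0 * (\<sigma> (l s))\<^sup>2)"
    "\<And>\<tau>. (\<And>n. 0 < \<tau> n) \<Longrightarrow> \<tau> \<longlonglongrightarrow> 0 \<Longrightarrow>
        weak_conv_m (\<lambda>n. halfline_law (q (\<tau> n))) (halfline_law f)"
  using assms unfolding classical_solution_def by blast+

text \<open>The inverse clock has derivative \<open>1 / c\<close>, which cancels the coefficient in
  the equation.\<close>

lemma heat_density_time_change:
  assumes dens: "\<And>t. 0 < t \<Longrightarrow> halfline_density (q t)"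
    and diff: "\<And>t x. 0 < t \<Longrightarrow> 0 < x \<Longrightarrow> q t differentiable at x"
      "\<And>t x. 0 < t \<Longrightarrow> 0 < x \<Longrightarrow> deriv (q t) differentiable at x"
    and eq: "\<And>t x. 0 < t \<Longrightarrow> 0 < x \<Longrightarrow> ((\<lambda>s. q s x) has_real_derivative
           1 / 2 * c t * deriv (deriv (q t)) x) (at t)"
    and B: "B 0 = 0" "\<And>s. (B has_real_derivative c s) (at s)" "\<And>s. 0 < c s"
    and t1: "0 < t1"
  shows "heat_density (\<lambda>a. q (inv B a)) (B t1)"
  unfolding heat_density_def
proof (intro ballI conjI allI impI)
  have mono: "strict_mono B" using positive_derivative_strict_mono[OF B(2,3)] .
  fix a assume "a \<in> {0<..<B t1}"
  then have a: "B 0 < a" "a < B t1" using B(1) by auto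
  define s where "s = inv B a"
  note inv = inverse_has_derivative[OF B(2,3) a]
  have s: "0 < s" using inv(1) a(1) strict_mono_less[OF mono, of 0 s] by (simp add: s_def)
  show "halfline_density (q (inv B a))" using dens[OF s] by (simp add: s_def)
  fix x :: real assume x: "0 < x"
  show "heat_at (\<lambda>a. q (inv B a)) a x"
  proof (rule heat_atI)
    have "((\<lambda>a. q (inv B a) x) has_real_derivative
        (1 / 2 * c s * deriv (deriv (q s)) x) * inverse (c s)) (at a)"
      using inv(2) eq[OF s x] unfolding s_def
      by (intro DERIV_chain2[of "\<lambda>s. q s x" _ "inv B"])
    then show "((\<lambda>a. q (inv B a) x) has_real_derivative deriv (deriv (q (inv B a))) x / 2) (at a)"
      using B(3)[of s] by (simp add: s_def field_simps)
  qed (use diff s x in \<open>auto simp: s_def\<close>)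
qed

text \<open>The unknown \<open>l\<close> enters through the clock \<open>B\<close> alone, so
  uniqueness of the heat flow applies before anything is known about \<open>l\<close>.\<close>

lemma classical_solution_eq_neumann_heat:
  assumes f: "halfline_density f" and \<sigma>: "\<And>y. 0 \<le> y \<Longrightarrow> 0 < \<sigma> y" "continuous_on {0..} \<sigma>"
    and sol: "classical_solution \<sigma> f q l"
  obtains B c where "B 0 = 0" "\<And>s. (B has_real_derivative c s) (at s)" "\<And>s. 0 < c s" "\<And>s. isCont c s"
    "\<And>s. 0 \<le> s \<Longrightarrow> c s = (\<sigma> (l s))\<^sup>2"
    "\<And>t x. 0 < t \<Longrightarrow> 0 \<le> x \<Longrightarrow> q t x = neumann_heat f (B t) x"
proof -
  note sD = classical_solutionD[OF sol]
  have "continuous_on {0..} (\<lambda>t. 1 / 2 * (LBINT s:{0<..t}. q s 0 * (\<sigma> (l s))\<^sup>2))"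
    by (intro continuous_intros continuous_on_indefinite_integral_Ioc sD(7))
  then have l_cont: "continuous_on {0..} l"
    by (rule continuous_on_eq) (simp add: sD(8))
  \<comment> \<open>The coefficient is frozen at its initial value for negative times, so that the
    clock has two-sided derivatives at 0.\<close>
  define c where "c s = (\<sigma> (l (max 0 s)))\<^sup>2" for s
  have c_cont: "continuous_on UNIV c"
    unfolding c_def
    by (intro continuous_intros continuous_on_compose2[OF \<sigma>(2)] continuous_on_compose2[OF l_cont])
       (auto intro: sD(2))
  then have c_isCont: "isCont c s" for s by (simp add: continuous_on_eq_continuous_at)
  have c_pos: "0 < c s" for s using \<sigma>(1)[OF sD(2)[of "max 0 s"]] by (simp add: c_def)
  have c_eq: "c s = (\<sigma> (l s))\<^sup>2" if "0 \<le> s" for s using that by (simp add: c_def)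
  obtain B where B: "B 0 = 0" "\<And>s. (B has_real_derivative c s) (at s)"
    using c_isCont by (rule antiderivative_on_UNIV) (rule that)
  have mono: "strict_mono B" using positive_derivative_strict_mono[OF B(2) c_pos] .
  have B_pos: "0 < B s" if "0 < s" for s using strict_mono_less[OF mono, of 0 s] B(1) that by simp
  have inv: "inv B (B s) = s" for s using strict_mono_imp_inj_on[OF mono] by simp
  have int_eq: "q t x = neumann_heat f (B t) x" if t: "0 < t" and x: "0 < x" for t x
  proof -
    have "q (inv B (B t)) x = neumann_heat f (B t) x"
    \<comment> \<open>The horizon \<open>B (2 * t)\<close> leaves room beyond \<open>B t\<close>;
      the clock carries the null sequence \<open>t / (n + 1)\<close> to another one, along which
      both initial laws are attained.\<close>
    proof (rule heat_density_unique[where ?v1.0 = "\<lambda>a. q (inv B a)" and ?v2.0 = "neumann_heat f" and t = "B t" and T = "B (2 * t)" and d = "\<lambda>n. B (t / real (Suc n))"])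
      show "heat_density (\<lambda>a. q (inv B a)) (B (2 * t))"
        using t c_eq sD(5) by (intro heat_density_time_change[OF sD(1,3,4) _ B c_pos]) auto
      show "heat_density (neumann_heat f) (B (2 * t))" by (rule neumann_heat_heat_density[OF f])
      have tn: "0 < t / real (Suc n)" "t / real (Suc n) < 2 * t" for n
        using t by (auto simp: field_simps add_pos_nonneg)
      show d: "B (t / real (Suc n)) \<in> {0<..<B (2 * t)}" for n
        using B_pos[OF tn(1)] strict_monoD[OF mono tn(2)] by simp
      have tn0: "(\<lambda>n. t / real (Suc n)) \<longlonglongrightarrow> 0"
        using tendsto_mult[OF tendsto_const[of t] LIMSEQ_inverse_real_of_nat]
        by (simp add: divide_inverse)
      have "isCont B 0" using DERIV_isCont[OF B(2)] .
      from isCont_tendsto_compose[OF this tn0] show Bn: "(\<lambda>n. B (t / real (Suc n))) \<longlonglongrightarrow> 0" by (simp add: B(1))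
      show "weak_conv_m (\<lambda>n. halfline_law (q (inv B (B (t / real (Suc n)))))) (halfline_law f)"
        unfolding inv using tn(1) tn0 by (rule sD(9))
      show "weak_conv_m (\<lambda>n. halfline_law (neumann_heat f (B (t / real (Suc n))))) (halfline_law f)"
        by (rule neumann_heat_weak_conv[OF f B_pos[OF tn(1)] Bn])
      show "B t \<in> {0<..<B (2 * t)}" using B_pos[OF t] strict_monoD[OF mono, of t "2 * t"] t by simp
    qed (use f x in auto)
    then show ?thesis by (simp add: inv)
  qed
  have "q t x = neumann_heat f (B t) x" if t: "0 < t" and x: "0 \<le> x" for t x
  proof (cases "x = 0")
    case True
    \<comment> \<open>Uniqueness of the flow covers positive \<open>x\<close>. The one-sided
      derivative at 0 supplies right continuity, which determines \<open>q t 0\<close>.\<close>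
    have "(q t \<longlongrightarrow> q t 0) (at_right 0)"
      using DERIV_continuous[OF sD(6)[OF t]] by (simp add: continuous_within)
    moreover have "(neumann_heat f (B t) \<longlongrightarrow> neumann_heat f (B t) 0) (at_right 0)"
      using DERIV_isCont[OF neumann_heat_boundary[OF f B_pos[OF t]]]
      unfolding isCont_def by (rule tendsto_within_subset) simp
    moreover have "\<forall>\<^sub>F y in at_right (0::real). y \<in> {0<..<1}" by (rule eventually_at_right_real) simp
    then have "\<forall>\<^sub>F y in at_right 0. neumann_heat f (B t) y = q t y"
      by eventually_elim (simp add: int_eq[OF t])
    ultimately have "(q t \<longlongrightarrow> neumann_heat f (B t) 0) (at_right 0)"
      by (simp add: tendsto_cong)
    from tendsto_unique[OF _ \<open>(q t \<longlongrightarrow> q t 0) (at_right 0)\<close> this] True show ?thesis by simp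
  qed (use int_eq[OF t] x in auto)
  with B c_pos c_isCont c_eq show ?thesis by (intro that[of B c]) auto
qed

theorem theorem1p1:
  fixes \<sigma> f :: "real \<Rightarrow> real"
  assumes "\<forall>x\<ge>0. 0 < \<sigma> x"
    and "\<exists>L. L-lipschitz_on {0..} \<sigma>"
    and "halfline_density f"
  shows "\<exists>q ell. classical_solution \<sigma> f q ell \<and>
    (\<forall>q' ell'. classical_solution \<sigma> f q' ell' \<longrightarrow>
       (\<forall>t>0. \<forall>x\<ge>0. q' t x = q t x) \<and> (\<forall>t\<ge>0. ell' t = ell t))"
proof -
  note f = assms(3)
  let ?u = "neumann_heat f"
  obtain \<Lambda> where \<Lambda>: "\<Lambda>-lipschitz_on {0..} \<sigma>" using assms(2) ..
  have \<sigma>_pos: "0 < \<sigma> y" if "0 \<le> y" for y using assms(1) that by simp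
  have \<sigma>_cont: "continuous_on {0..} \<sigma>" using \<Lambda> by (rule lipschitz_on_continuous_on)
  have \<Lambda>0: "0 \<le> \<Lambda>" using \<Lambda> by (rule lipschitz_on_nonneg)
  have \<sigma>_le: "\<sigma> y \<le> \<sigma> 0 + \<Lambda> * y" if "0 \<le> y" for y
    using lipschitz_onD[OF \<Lambda>, of y 0] that by (auto simp: dist_real_def abs_le_iff)
  note trace = neumann_heat_trace_bounds[OF f]
  \<comment> \<open>With half of the trace bound, \<open>C = 1 / 2\<close>, the growth of the
    antiderivative is exactly \<open>sqrt a\<close>.\<close>
  obtain L where L: "L 0 = 0" "\<And>a. 0 < a \<Longrightarrow> (L has_real_derivative ?u a 0 / 2) (at a)"
    "\<And>a. 0 \<le> a \<Longrightarrow> 0 \<le> L a" "\<And>a. 0 \<le> a \<Longrightarrow> L a \<le> 2 * (1 / 2) * sqrt a"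
  proof (rule antiderivative_on_Ioi[of "\<lambda>a. ?u a 0 / 2" "1 / 2"])
    show "isCont (\<lambda>a. ?u a 0 / 2) a" if "0 < a" for a
      using trace(3)[OF that] by (intro continuous_intros) auto
  qed (use trace in \<open>auto simp: field_simps\<close>)
  have L_lim0: "(L \<longlongrightarrow> 0) (at_right 0)"
  proof (rule tendsto_sandwich[of "\<lambda>_. 0" L _ sqrt])
    have "\<forall>\<^sub>F y in at_right (0::real). y \<in> {0<..<1}" by (rule eventually_at_right_real) simp
    then show "\<forall>\<^sub>F y in at_right 0. 0 \<le> L y" "\<forall>\<^sub>F y in at_right 0. L y \<le> sqrt y"
      by (eventually_elim, use L(3,4) in force)+
    show "(sqrt \<longlongrightarrow> 0) (at_right 0)"
      using tendsto_real_sqrt[OF tendsto_ident_at[of 0 "{0<..}"]] by simp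
  qed simp
  have L_cont: "continuous_on {0..} L"
    unfolding continuous_on_eq_continuous_within
  proof
    fix a :: real assume "a \<in> {0..}"
    then consider "a = 0" | "0 < a" by force
    then show "continuous (at a within {0..}) L"
    proof cases
      case 1
      have "at (0::real) within {0..} = at_right 0"
        by (rule at_within_nhd[of _ UNIV]) auto
      then show ?thesis using 1 L_lim0 L(1) by (simp add: continuous_within)
    next
      case 2
      then show ?thesis using DERIV_isCont[OF L(2)] by (simp add: continuous_at_imp_continuous_at_within)
    qed
  qed
  \<comment> \<open>Frozen at \<open>k 0\<close> on the negative axis, as
    \<open>autonomous_flow\<close> expects.\<close>
  define k where "k a = (\<sigma> (L (max 0 a)))\<^sup>2" for a
  have "continuous_on UNIV k"
    unfolding k_def
    by (intro continuous_intros continuous_on_compose2[OF \<sigma>_cont] continuous_on_compose2[OF L_cont])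
       (auto intro: L(3))
  then have k_isCont: "isCont k a" for a by (simp add: continuous_on_eq_continuous_at)
  have k_pos: "0 < k a" for a using \<sigma>_pos[OF L(3)[of "max 0 a"]] by (simp add: k_def)
  \<comment> \<open>Squaring turns the growth of \<open>\<sigma> (L a)\<close> by a multiple of
    \<open>sqrt a\<close> into linear growth of \<open>k\<close>.\<close>
  have k_growth: "k a \<le> (2 * (\<sigma> 0)\<^sup>2 + 2 * \<Lambda>\<^sup>2) * (1 + a)" if a: "0 \<le> a" for a
  proof -
    have "\<sigma> (L a) \<le> \<sigma> 0 + \<Lambda> * sqrt a"
      using \<sigma>_le[OF L(3)[OF a]] mult_left_mono[OF L(4)[OF a] \<Lambda>0] by simp
    then have "(\<sigma> (L a))\<^sup>2 \<le> (\<sigma> 0 + \<Lambda> * sqrt a)\<^sup>2"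
      using \<sigma>_pos[OF L(3)[OF a]] by (intro power_mono) auto
    also have "\<dots> \<le> 2 * (\<sigma> 0)\<^sup>2 + 2 * (\<Lambda> * sqrt a)\<^sup>2"
    proof -
      have "0 \<le> (\<sigma> 0 - \<Lambda> * sqrt a)\<^sup>2" by simp
      then show ?thesis by (simp add: power2_sum power2_diff)
    qed
    also have "\<dots> = 2 * (\<sigma> 0)\<^sup>2 + 2 * \<Lambda>\<^sup>2 * a" using a by (simp add: power_mult_distrib)
    also have "\<dots> \<le> (2 * (\<sigma> 0)\<^sup>2 + 2 * \<Lambda>\<^sup>2) * (1 + a)"
      using a by (simp add: algebra_simps)
    finally show ?thesis using a by (simp add: k_def)
  qed
  have k_left: "k a = k 0" if "a \<le> 0" for a using that by (simp add: k_def)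
  obtain G A where G: "G 0 = 0" "\<And>x. (G has_real_derivative 1 / k x) (at x)"
    and GA: "\<And>t. G (A t) = t" "\<And>x. A (G x) = x"
    and A: "\<And>t. (A has_real_derivative k (A t)) (at t)"
    using k_isCont k_pos k_growth k_left by (rule autonomous_flow) (assumption | rule that)+
  have A0: "A 0 = 0" using GA(2)[of 0] G(1) by simp

  \<comment> \<open>Formulated for an arbitrary clock, since it serves both the constructed
    \<open>A\<close> and the clock of a given solution.\<close>
  have trace_integral: "set_integrable lborel {0<..t} (\<lambda>s. ?u (B s) 0 * c s)"
      "L (B t) = 1 / 2 * (LBINT s:{0<..t}. ?u (B s) 0 * c s)"
    if B: "B 0 = 0" "\<And>s. (B has_real_derivative c s) (at s)" "\<And>s. 0 < c s" "\<And>s. isCont c s" and t: "0 < t"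
    for B c t
  proof -
    have B_pos: "0 < B s" if "0 < s" for s
      using strict_mono_less[OF positive_derivative_strict_mono[OF B(2,3)], of 0 s] B(1) that by simp
    have F: "((\<lambda>s. 2 * L (B s)) has_real_derivative ?u (B s) 0 * c s) (at s)" if s: "0 < s" for s
    proof -
      have "((\<lambda>s. L (B s)) has_real_derivative ?u (B s) 0 / 2 * c s) (at s)"
        using L(2)[OF B_pos[OF s]] B(2) by (rule DERIV_chain2)
      from DERIV_cmult[OF this, of 2] show ?thesis by simp
    qed
    have cont: "isCont (\<lambda>s. ?u (B s) 0 * c s) s" if s: "0 < s" for s
      using trace(3)[OF B_pos[OF s]] DERIV_isCont[OF B(2)]
      by (intro continuous_mult B(4) isCont_o2[of s B "\<lambda>a. ?u a 0"])
    have nn: "0 \<le> ?u (B s) 0 * c s" if s: "0 < s" for s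
      using trace(1)[OF B_pos[OF s]] B(3)[of s] by simp
    have lim: "((\<lambda>s. 2 * L (B s)) \<longlongrightarrow> 2 * L (B 0)) (at_right 0)"
    proof -
      have "(B \<longlongrightarrow> B 0) (at_right 0)"
        using DERIV_isCont[OF B(2)] unfolding isCont_def by (rule tendsto_within_subset) simp
      moreover have "\<forall>\<^sub>F s in at_right (0::real). s \<in> {0<..<1}" by (rule eventually_at_right_real) simp
      then have "\<forall>\<^sub>F s in at_right 0. B s \<in> {0..}"
        by eventually_elim (use B_pos in \<open>auto simp: less_imp_le\<close>)
      ultimately have "((\<lambda>s. L (B s)) \<longlongrightarrow> L (B 0)) (at_right 0)"
        by (intro continuous_on_tendsto_compose[OF L_cont]) (auto simp: B(1))
      then show ?thesis by (intro tendsto_intros)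
    qed
    show "set_integrable lborel {0<..t} (\<lambda>s. ?u (B s) 0 * c s)"
      by (rule FTC_Ioc_nonneg(1)[OF t F cont nn lim])
    show "L (B t) = 1 / 2 * (LBINT s:{0<..t}. ?u (B s) 0 * c s)"
      using FTC_Ioc_nonneg(2)[OF t F cont nn lim] by (simp add: B(1) L(1))
  qed

  \<comment> \<open>Existence: the reflected heat flow read along the clock \<open>A\<close>\<close>
  have A_pos: "0 < A t" if "0 < t" for t
    using strict_mono_less[OF positive_derivative_strict_mono[OF A k_pos], of 0 t] A0 that by simp
  have A_nonneg: "0 \<le> A t" if "0 \<le> t" for t
    using A_pos[of t] A0 that by (cases "t = 0") auto
  have k_A: "k (A t) = (\<sigma> (L (A t)))\<^sup>2" if "0 \<le> t" for t
    using A_nonneg[OF that] by (simp add: k_def)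
  have kA_isCont: "isCont (\<lambda>t. k (A t)) t" for t
    by (rule isCont_o2[OF DERIV_isCont[OF A] k_isCont])

  have sol: "classical_solution \<sigma> f (\<lambda>t. ?u (A t)) (\<lambda>t. L (A t))"
    unfolding classical_solution_def
  proof (intro conjI allI impI)
    fix t :: real assume t: "0 < t"
    show "halfline_density (?u (A t))" by (rule neumann_heat_halfline_density[OF f A_pos[OF t]])
    show "(?u (A t) has_real_derivative 0) (at_right 0)"
      using neumann_heat_boundary[OF f A_pos[OF t]] by (rule has_field_derivative_at_within)
    fix x :: real assume x: "0 < x"
    have h: "heat_at ?u (A t) x" by (rule heat_ext_heat_at(2)[OF even_ext_integrable[OF f] A_pos[OF t]])
    show "?u (A t) differentiable at x"
      using heat_at_DERIV(1)[OF h] real_differentiable_def by blast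
    show "deriv (?u (A t)) differentiable at x"
      using heat_at_deriv_deriv(1)[OF h] real_differentiable_def by blast
    have "((\<lambda>s. ?u (A s) x) has_real_derivative deriv (deriv (?u (A t))) x / 2 * k (A t)) (at t)"
      using heat_at_deriv_deriv(2)[OF h] A by (rule DERIV_chain2)
    then show "((\<lambda>s. ?u (A s) x) has_real_derivative
        1 / 2 * (\<sigma> (L (A t)))\<^sup>2 * deriv (deriv (?u (A t))) x) (at t)"
      using k_A[of t] t by (simp add: mult_ac)
  next
    fix t :: real assume t: "0 \<le> t"
    show "0 \<le> L (A t)" by (rule L(3)[OF A_nonneg[OF t]])
    have eq: "indicator {0<..t} s * (?u (A s) 0 * k (A s)) = indicator {0<..t} s * (?u (A s) 0 * (\<sigma> (L (A s)))\<^sup>2)" for s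
      using k_A[of s] by (auto simp: indicator_def)
    show "set_integrable lborel {0<..t} (\<lambda>s. ?u (A s) 0 * (\<sigma> (L (A s)))\<^sup>2)"
    proof (cases "t = 0")
      case False
      then show ?thesis using trace_integral(1)[OF A0 A k_pos kA_isCont, of t] t
        unfolding set_integrable_def real_scaleR_def eq by simp
    qed (simp add: set_integrable_def)
    show "L (A t) = 1 / 2 * (LBINT s:{0<..t}. ?u (A s) 0 * (\<sigma> (L (A s)))\<^sup>2)"
    proof (cases "t = 0")
      case False
      then show ?thesis using trace_integral(2)[OF A0 A k_pos kA_isCont, of t] t
        unfolding set_lebesgue_integral_def real_scaleR_def eq by simp
    qed (simp add: set_lebesgue_integral_def A0 L(1))
  next
    fix \<tau> :: "nat \<Rightarrow> real" assume \<tau>: "\<forall>n. 0 < \<tau> n" "\<tau> \<longlonglongrightarrow> 0"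
    have "isCont A 0" by (rule DERIV_isCont[OF A])
    from isCont_tendsto_compose[OF this \<tau>(2)] have "(\<lambda>n. A (\<tau> n)) \<longlonglongrightarrow> 0" by (simp add: A0)
    with A_pos \<tau>(1) show "weak_conv_m (\<lambda>n. halfline_law (?u (A (\<tau> n)))) (halfline_law f)"
      by (intro neumann_heat_weak_conv[OF f]) auto
  qed

  \<comment> \<open>Uniqueness: the clock of an arbitrary solution coincides with
    \<open>A\<close>\<close>
  have unique: "(\<forall>t>0. \<forall>x\<ge>0. q' t x = ?u (A t) x) \<and> (\<forall>t\<ge>0. l' t = L (A t))"
    if sol': "classical_solution \<sigma> f q' l'" for q' l'
  proof -
    note sD = classical_solutionD[OF sol']
    obtain B c where B: "B 0 = 0" "\<And>s. (B has_real_derivative c s) (at s)" "\<And>s. 0 < c s" "\<And>s. isCont c s"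
      and c: "\<And>s. 0 \<le> s \<Longrightarrow> c s = (\<sigma> (l' s))\<^sup>2"
      and q': "\<And>t x. 0 < t \<Longrightarrow> 0 \<le> x \<Longrightarrow> q' t x = ?u (B t) x"
      using f \<sigma>_pos \<sigma>_cont sol' by (rule classical_solution_eq_neumann_heat) (assumption | rule that)+
    \<comment> \<open>The integral equation, rewritten with \<open>q' s 0 = ?u (B s) 0\<close>, is
      the change of variables of \<open>trace_integral\<close>. Hence \<open>B\<close> satisfies the
      autonomous equation at positive times.\<close>
    have l': "l' t = L (B t)" if t: "0 \<le> t" for t
    proof (cases "t = 0")
      case True
      then show ?thesis using sD(8)[OF t] by (simp add: set_lebesgue_integral_def B(1) L(1))
    next
      case False
      have eq: "indicator {0<..t} s * (q' s 0 * (\<sigma> (l' s))\<^sup>2) = indicator {0<..t} s * (?u (B s) 0 * c s)" for s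
        using c[of s] q'[of s 0] by (auto simp: indicator_def)
      show ?thesis
        using trace_integral(2)[OF B, of t] sD(8)[OF t] False t
        unfolding set_lebesgue_integral_def real_scaleR_def eq by simp
    qed
    have B_pos: "0 < B s" if "0 < s" for s
      using strict_mono_less[OF positive_derivative_strict_mono[OF B(2,3)], of 0 s] B(1) that by simp
    have c_k: "c s = k (B s)" if "0 < s" for s
      using c[of s] l'[of s] B_pos[OF that] that by (simp add: k_def)
    have AB: "B t = A t" if t: "0 \<le> t" for t
    proof -
      \<comment> \<open>This derivative exists at all \<open>s\<close> and gives continuity at 0; it
        vanishes for \<open>s > 0\<close>, so \<open>G (B s)\<close> is the identity there and
        \<open>A\<close> inverts it.\<close>
      have d: "((\<lambda>s. G (B s) - s) has_real_derivative 1 / k (B s) * c s - 1) (at s)" for s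
        by (intro DERIV_diff DERIV_ident DERIV_chain2[OF G(2) B(2)])
      have d0: "((\<lambda>s. G (B s) - s) has_real_derivative 0) (at s)" if "0 < s" for s
        using d[of s] c_k[OF that] k_pos[of "B s"] by simp
      have "G (B t) - t = G (B 0) - 0"
      proof (cases "t = 0")
        case False
        then show ?thesis using t d0
          by (intro DERIV_isconst2[of 0 t "\<lambda>s. G (B s) - s" t])
             (auto intro!: continuous_at_imp_continuous_on DERIV_isCont[OF d])
      qed simp
      then have "G (B t) = t" by (simp add: B(1) G(1))
      then show ?thesis using GA(2)[of "B t"] by simp
    qed
    show ?thesis using q' l' AB by auto
  qed
  show ?thesis using sol unique by blast
qed

end
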